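(* There exists $q_0$ such that the following holds. Let $q\ge q_{0}$ be an integer, let $d=\prod_{p\mid q}p$ be the kernel of $q$, and put $\gamma_{1}=900$, $\gamma=160^{-4}$. Let $N$ be an integer with $$\max\bigl(d^{15},\,e^{\gamma_{1}(\ln q)^{2/3}}\bigr)\le N\le \sqrt{q}.$$ Then for any integers $a,b,c$ with $(a,q)=1$, $$\Bigl|\sum_{\substack{c<n\le c+N\\ (n,q)=1}} e^{2\pi i (a n^{*}+bn)/q}\Bigr|<N\exp\Bigl(-\gamma\,\frac{(\ln N)^{3}}{(\ln q)^{2}}\Bigr),$$ where for $(n,q)=1$, $n^{*}$ denotes an integer with $nn^{*}\equiv 1\pmod q$.
   Context: The sum is an incomplete Kloosterman sum $S_q(N;a,b,c)$; the summation runs over integers $n$ in the interval $c<n\le c+N$ coprime to $q$, and its value does not depend on the choice of the inverse $n^{*}$ modulo $q$. $\ln$ is the natural logarithm. *)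

theory Defs
  imports Complex_Main "HOL-Number_Theory.Number_Theory" "HOL-Number_Theory.Modular_Inverse"
begin

definition squarefree_kernel :: "int \<Rightarrow> int" where
  "squarefree_kernel q = (\<Prod>p \<in> prime_factors q. p)"

(* The summand depends on the inverse of n only modulo q, so the representative
   chosen by modular_inverse is immaterial. *)
definition incomplete_kloosterman_sum :: "int \<Rightarrow> int \<Rightarrow> int \<Rightarrow> int \<Rightarrow> int \<Rightarrow> complex" where
  "incomplete_kloosterman_sum q N a b c =
     (\<Sum>n \<in> {n. c < n \<and> n \<le> c + N \<and> coprime n q}.
        exp (2 * complex_of_real pi * \<i> * of_int (a * modular_inverse q n + b * n) / of_int q))"

end

theory Submission
  imports Defs "HOL-Analysis.Convex" "HOL-Computational_Algebra.Formal_Power_Series"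
begin

text \<open>Let D be such that q divides \<open>D ^ m\<close>, where m is about \<open>5 * ln q / ln N\<close>. The inverse of
  \<open>n + D * x * y\<close> modulo q is then a polynomial of degree at most m in \<open>x * y\<close>, so that averaging over the
  shifts \<open>D * x * y\<close> with x and y below a small power P of N bounds the sum by bilinear polynomial sums.
  Two applications of the power mean inequality estimate these by Vinogradov's mean value, which is bounded
  by Linnik's p-adic iteration, times a product over the coefficients of the polynomial. A positive
  proportion of these coefficients have denominators of a size for which the corresponding factor
  saves a power of N.\<close>

subsection \<open>Additive characters and energies\<close>

text \<open>Put \<open>H = ln N\<close> and \<open>R = ln q / ln N\<close>. The shifts must stay
  short: \<open>D\<close> is at most \<open>N ^ (1/5 + 1/15)\<close>, the 1/15 being the price of
  the kernel, and \<open>P\<close> is about \<open>N ^ 0.3\<close>, so \<open>D * P ^ 2\<close> is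
  at most \<open>N ^ (13/15)\<close>. The degree grows with \<open>R\<close>, hence a mean value
  theorem with unspecified dependence on \<open>m\<close> is useless. Constants of size
  \<open>exp (O (m ^ 4))\<close>, up to a lesser term with \<open>ln H\<close>, are admissible,
  because they are absorbed by a saving of order \<open>R ^ 2 * H\<close> once \<open>H\<close>
  exceeds a large multiple of \<open>R ^ 2\<close>. That is the lower bound on \<open>N\<close> with
  exponent 2/3, the multiple being \<open>900 ^ 3\<close>. The saving comes from at least
  \<open>R / 2\<close> coefficients with a factor \<open>N ^ (- 0.14 * R)\<close> each; it must also
  beat the loss \<open>P ^ (m * (m + 1) / 240)\<close> caused by stopping the p-adic iteration after
  \<open>6 * m\<close> steps. A root of order \<open>4 * k ^ 2\<close>, comparable to
  \<open>R ^ 4\<close>, finally turns \<open>R ^ 2 * H\<close> into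
  \<open>H / R ^ 2 = (ln N) ^ 3 / (ln q) ^ 2\<close>. The linear phase \<open>b * n\<close> is
  harmless: it alters only the coefficient of degree 1, from which no saving is taken.\<close>

definition additive_char :: "int \<Rightarrow> int \<Rightarrow> complex" where
  "additive_char q t = cis (2 * pi * of_int t / of_int q)"

lemma norm_additive_char [simp]: "norm (additive_char q t) = 1"
  by (simp add: additive_char_def)

lemma additive_char_0 [simp]: "additive_char q 0 = 1"
  by (simp add: additive_char_def)

lemma additive_char_add: "additive_char q (s + t) = additive_char q s * additive_char q t"
  by (simp add: additive_char_def cis_mult add_divide_distrib ring_distribs)

lemma additive_char_diff: "additive_char q (s - t) = additive_char q s * cnj (additive_char q t)"
  by (simp add: additive_char_def cis_cnj cis_mult diff_divide_distrib ring_distribs)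

lemma additive_char_sum: "additive_char q (\<Sum>i\<in>A. f i) = (\<Prod>i\<in>A. additive_char q (f i))"
  by (induction A rule: infinite_finite_induct) (auto simp: additive_char_add)

lemma additive_char_of_nat_mult: "additive_char q (of_nat n * t) = additive_char q t ^ n"
  by (induction n) (auto simp: additive_char_add ring_distribs)

lemma additive_char_eq_1_iff:
  assumes "q > 0"
  shows "additive_char q t = 1 \<longleftrightarrow> q dvd t"
proof
  assume "q dvd t"
  then obtain k where "t = q * k" by blast
  then show "additive_char q t = 1"
    using assms cis_multiple_2pi[of "of_int k"] by (auto simp: additive_char_def mult.assoc)
next
  assume "additive_char q t = 1"
  then have "cos (2 * pi * of_int t / of_int q) = 1"
    by (simp add: additive_char_def complex_eq_iff)
  then obtain k :: int where "2 * pi * of_int t / of_int q = of_int k * 2 * pi"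
    by (auto simp: cos_one_2pi_int)
  then have "real_of_int t = of_int (k * q)"
    using assms by (simp add: field_simps)
  then show "q dvd t" by (metis dvd_triv_right of_int_eq_iff)
qed

lemma additive_char_cong:
  assumes "q > 0" "[s = t] (mod q)"
  shows "additive_char q s = additive_char q t"
proof -
  have "q dvd s - t" using assms(2) by (simp add: cong_iff_dvd_diff)
  then have "additive_char q (s - t) = 1" using assms(1) by (simp add: additive_char_eq_1_iff)
  then show ?thesis using additive_char_add[of q "s - t" t] by simp
qed

text \<open>The interval need not consist of full periods of \<open>q\<close>: already
  \<open>q dvd c * int L\<close> gives \<open>w ^ L = 1\<close> for the ratio \<open>w\<close> of
  the geometric sum. The bound for double sums uses this with \<open>L\<close> a multiple of the
  reduced denominator only.\<close>

lemma sum_additive_char_interval: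
  fixes L :: nat
  assumes "q > 0" "q dvd c * int L"
  shows "(\<Sum>x\<in>{u..<u + int L}. additive_char q (c * x)) = (if q dvd c then of_nat L else 0)"
proof -
  define w where "w = additive_char q c"
  have "(\<Sum>x\<in>{u..<u + int L}. additive_char q (c * x))
      = (\<Sum>i<L. additive_char q (c * (u + int i)))"
    by (rule sum.reindex_bij_witness[of _ "\<lambda>i. u + int i" "\<lambda>x. nat (x - u)"]) auto
  also have "\<dots> = (\<Sum>i<L. additive_char q (c * u) * w ^ i)"
    by (intro sum.cong)
       (auto simp: w_def additive_char_of_nat_mult[symmetric] additive_char_add[symmetric] algebra_simps)
  also have "\<dots> = additive_char q (c * u) * (\<Sum>i<L. w ^ i)"
    by (simp add: sum_distrib_left)
  finally have eq: "(\<Sum>x\<in>{u..<u + int L}. additive_char q (c * x))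
      = additive_char q (c * u) * (\<Sum>i<L. w ^ i)" .
  show ?thesis
  proof (cases "q dvd c")
    case True
    then have "w = 1" "additive_char q (c * u) = 1"
      using assms(1) by (auto simp: w_def additive_char_eq_1_iff)
    then show ?thesis using True eq by simp
  next
    case False
    then have "w \<noteq> 1" using assms(1) by (auto simp: w_def additive_char_eq_1_iff)
    moreover have "w ^ L = 1"
      using assms by (simp add: w_def additive_char_of_nat_mult[symmetric] additive_char_eq_1_iff mult.commute)
    ultimately have "(\<Sum>i<L. w ^ i) = 0" by (simp add: geometric_sum)
    then show ?thesis using False eq by simp
  qed
qed

section \<open>Counting integer solutions by finite Fourier analysis\<close>

definition energy :: "nat set \<Rightarrow> ('a \<Rightarrow> nat \<Rightarrow> int) \<Rightarrow> 'a set \<Rightarrow> nat" where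
  "energy I F S = card {(x, y). x \<in> S \<and> y \<in> S \<and> (\<forall>j\<in>I. F x j = F y j)}"

lemma sum_char_orthogonality:
  assumes "finite I" "Q > 0"
  shows "(\<Sum>a\<in>PiE I (\<lambda>_. {0..<Q}). additive_char Q (\<Sum>j\<in>I. a j * v j))
       = (if \<forall>j\<in>I. Q dvd v j then of_int Q ^ card I else 0)"
proof -
  have "(\<Sum>a\<in>PiE I (\<lambda>_. {0..<Q}). additive_char Q (\<Sum>j\<in>I. a j * v j))
      = (\<Prod>j\<in>I. \<Sum>x\<in>{0..<Q}. additive_char Q (x * v j))"
    using assms by (subst prod_sum_PiE) (auto simp: additive_char_sum)
  also have "\<dots> = (\<Prod>j\<in>I. if Q dvd v j then of_int Q else 0)"
  proof (intro prod.cong refl)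
    fix j
    show "(\<Sum>x\<in>{0..<Q}. additive_char Q (x * v j)) = (if Q dvd v j then of_int Q else 0)"
      using sum_additive_char_interval[of Q "v j" "nat Q" 0] assms(2)
      by (auto simp: mult.commute)
  qed
  also have "\<dots> = (if \<forall>j\<in>I. Q dvd v j then of_int Q ^ card I else 0)"
    using assms(1) by (induction I rule: finite_induct) auto
  finally show ?thesis .
qed

text \<open>A finite substitute for integration over a torus: every difference is smaller than
  \<open>Q\<close> in absolute value, so congruence modulo \<open>Q\<close> is equality and
  orthogonality counts integer solutions.\<close>

lemma card_solutions_fourier:
  fixes h :: "nat \<Rightarrow> int"
  assumes "finite I" "Q > 0" "finite S"
    and big: "\<And>x y j. x \<in> S \<Longrightarrow> y \<in> S \<Longrightarrow> j \<in> I \<Longrightarrow> \<bar>F x j - F y j - h j\<bar> < Q"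
  shows "of_int Q ^ card I * of_nat (card {(x, y). x \<in> S \<and> y \<in> S \<and> (\<forall>j\<in>I. F x j - F y j = h j)})
    = (\<Sum>a\<in>PiE I (\<lambda>_. {0..<Q}). cnj (additive_char Q (\<Sum>j\<in>I. a j * h j)) *
         of_real ((norm (\<Sum>x\<in>S. additive_char Q (\<Sum>j\<in>I. a j * F x j)))\<^sup>2))"
    (is "_ = ?rhs")
proof -
  let ?e = "\<lambda>a x. additive_char Q (\<Sum>j\<in>I. a j * F x j)"
  let ?A = "PiE I (\<lambda>_. {0..<Q})"
  have "?rhs = (\<Sum>a\<in>?A. \<Sum>(x, y)\<in>S \<times> S. additive_char Q (\<Sum>j\<in>I. a j * (F x j - F y j - h j)))"
  proof (intro sum.cong refl)
    fix a
    have "complex_of_real ((norm (\<Sum>x\<in>S. ?e a x))\<^sup>2) = (\<Sum>x\<in>S. ?e a x) * cnj (\<Sum>x\<in>S. ?e a x)"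
      by (simp add: complex_norm_square del: cnj_sum of_real_power)
    also have "\<dots> = (\<Sum>(x, y)\<in>S \<times> S. ?e a x * cnj (?e a y))"
      by (simp add: sum_product sum.cartesian_product)
    finally have eq: "complex_of_real ((norm (\<Sum>x\<in>S. ?e a x))\<^sup>2) = (\<Sum>(x, y)\<in>S \<times> S. ?e a x * cnj (?e a y))" .
    show "cnj (additive_char Q (\<Sum>j\<in>I. a j * h j)) * of_real ((norm (\<Sum>x\<in>S. ?e a x))\<^sup>2) =
      (\<Sum>(x, y)\<in>S \<times> S. additive_char Q (\<Sum>j\<in>I. a j * (F x j - F y j - h j)))"
      unfolding eq sum_distrib_left
      by (intro sum.cong refl)
         (auto simp: right_diff_distrib sum_subtractf additive_char_diff)
  qed
  also have "\<dots> = (\<Sum>(x, y)\<in>S \<times> S. \<Sum>a\<in>?A. additive_char Q (\<Sum>j\<in>I. a j * (F x j - F y j - h j)))"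
    by (subst sum.swap) (simp add: case_prod_unfold)
  also have "\<dots> = (\<Sum>(x, y)\<in>S \<times> S. if \<forall>j\<in>I. F x j - F y j = h j then of_int Q ^ card I else 0)"
  proof (intro sum.cong refl, clarify)
    fix x y assume xy: "x \<in> S" "y \<in> S"
    have "Q dvd F x j - F y j - h j \<longleftrightarrow> F x j - F y j = h j" if "j \<in> I" for j
      using big[OF xy that] zdvd_imp_le[of Q "\<bar>F x j - F y j - h j\<bar>"]
      by (auto simp: abs_le_iff)
    then show "(\<Sum>a\<in>?A. additive_char Q (\<Sum>j\<in>I. a j * (F x j - F y j - h j))) =
       (if \<forall>j\<in>I. F x j - F y j = h j then of_int Q ^ card I else 0)"
      using assms(1,2) by (subst sum_char_orthogonality) auto
  qed
  also have "\<dots> = (\<Sum>xy\<in>{(x, y)\<in>S \<times> S. \<forall>j\<in>I. F x j - F y j = h j}. of_int Q ^ card I)"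
    using assms(3) by (intro sum.mono_neutral_cong_right) (auto split: if_splits)
  also have "\<dots> = of_int Q ^ card I * of_nat (card {(x, y). x \<in> S \<and> y \<in> S \<and> (\<forall>j\<in>I. F x j - F y j = h j)})"
    by (simp add: mult.commute case_prod_unfold mem_Times_iff conj_assoc)
  finally show ?thesis by simp
qed

lemma energy_fourier:
  assumes "finite I" "Q > 0" "finite S"
    and big: "\<And>x y j. x \<in> S \<Longrightarrow> y \<in> S \<Longrightarrow> j \<in> I \<Longrightarrow> \<bar>F x j - F y j\<bar> < Q"
  shows "of_int Q ^ card I * real (energy I F S)
    = (\<Sum>a\<in>PiE I (\<lambda>_. {0..<Q}). (norm (\<Sum>x\<in>S. additive_char Q (\<Sum>j\<in>I. a j * F x j)))\<^sup>2)"
proof -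
  have "complex_of_real (of_int Q ^ card I * real (energy I F S)) = of_real
    (\<Sum>a\<in>PiE I (\<lambda>_. {0..<Q}). (norm (\<Sum>x\<in>S. additive_char Q (\<Sum>j\<in>I. a j * F x j)))\<^sup>2)"
    using card_solutions_fourier[of I Q S F "\<lambda>_. 0"] assms by (simp add: energy_def)
  then show ?thesis by (simp only: of_real_eq_iff)
qed

lemma exists_bound:
  fixes G :: "'b \<Rightarrow> int"
  assumes "finite T"
  obtains Q where "Q > 0" "\<And>t. t \<in> T \<Longrightarrow> \<bar>G t\<bar> < Q"
proof
  show "(1 + (\<Sum>t\<in>T. \<bar>G t\<bar>)) > 0" by (simp add: add_pos_nonneg sum_nonneg)
  fix t assume "t \<in> T"
  then have "\<bar>G t\<bar> \<le> (\<Sum>t\<in>T. \<bar>G t\<bar>)" using assms by (intro member_le_sum) auto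
  then show "\<bar>G t\<bar> < 1 + (\<Sum>t\<in>T. \<bar>G t\<bar>)" by simp
qed

text \<open>The number of solutions with right-hand side \<open>h\<close> is a Fourier coefficient
  of the nonnegative function \<open>norm (...) ^ 2\<close>, hence is largest at
  \<open>h = 0\<close>.\<close>

lemma card_shifted_le_energy:
  assumes "finite I" "finite S"
  shows "card {(x, y). x \<in> S \<and> y \<in> S \<and> (\<forall>j\<in>I. F x j - F y j = h j)} \<le> energy I F S"
proof -
  obtain Q1 where Q1: "Q1 > 0" "\<And>t. t \<in> S \<times> S \<times> I \<Longrightarrow>
      \<bar>(\<lambda>(x, y, j). \<bar>F x j - F y j\<bar> + \<bar>h j\<bar>) t\<bar> < Q1"
    using exists_bound[of "S \<times> S \<times> I"] assms by blast
  have b: "\<bar>F x j - F y j\<bar> + \<bar>h j\<bar> < Q1" if "x \<in> S" "y \<in> S" "j \<in> I" for x y j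
    using Q1(2)[of "(x, y, j)"] that by auto
  have b1: "\<bar>F x j - F y j - h j\<bar> < Q1" and b2: "\<bar>F x j - F y j\<bar> < Q1"
    if "x \<in> S" "y \<in> S" "j \<in> I" for x y j
    using b[OF that] by linarith+
  let ?n = "card {(x, y). x \<in> S \<and> y \<in> S \<and> (\<forall>j\<in>I. F x j - F y j = h j)}"
  have "of_int Q1 ^ card I * real ?n = norm (of_int Q1 ^ card I * of_nat ?n :: complex)"
    using Q1(1) by (simp add: norm_mult norm_power)
  also have "\<dots> = norm (\<Sum>a\<in>PiE I (\<lambda>_. {0..<Q1}). cnj (additive_char Q1 (\<Sum>j\<in>I. a j * h j)) *
         of_real ((norm (\<Sum>x\<in>S. additive_char Q1 (\<Sum>j\<in>I. a j * F x j)))\<^sup>2))"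
    using card_solutions_fourier[OF assms(1) Q1(1) assms(2) b1] by simp
  also have "\<dots> \<le> (\<Sum>a\<in>PiE I (\<lambda>_. {0..<Q1}). (norm (\<Sum>x\<in>S. additive_char Q1 (\<Sum>j\<in>I. a j * F x j)))\<^sup>2)"
    by (rule order.trans[OF norm_sum]) (simp add: norm_mult norm_power)
  also have "\<dots> = of_int Q1 ^ card I * real (energy I F S)"
    using energy_fourier[OF assms(1) Q1(1) assms(2) b2] by simp
  finally show ?thesis using Q1(1) by simp
qed

lemma energy_image_le:
  assumes "finite T" "inj_on g S" "g ` S \<subseteq> T"
    "\<And>x y j. x \<in> S \<Longrightarrow> y \<in> S \<Longrightarrow> (\<forall>j\<in>I. F x j = F y j) \<Longrightarrow> j \<in> I \<Longrightarrow> G (g x) j = G (g y) j"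
  shows "energy I F S \<le> energy I G T"
  unfolding energy_def
proof (rule card_inj_on_le[where f = "map_prod g g"])
  show "inj_on (map_prod g g) {(x, y). x \<in> S \<and> y \<in> S \<and> (\<forall>j\<in>I. F x j = F y j)}"
    using assms(2) by (auto simp: inj_on_def)
  show "finite {(x, y). x \<in> T \<and> y \<in> T \<and> (\<forall>j\<in>I. G x j = G y j)}"
    using assms(1) by (auto intro: finite_subset[of _ "T \<times> T"])
qed (use assms in auto)

lemma energy_eq_sum_squares:
  assumes "finite S"
  shows "energy I F S = (\<Sum>v\<in>(\<lambda>x. restrict (F x) I) ` S. (card {x\<in>S. restrict (F x) I = v})\<^sup>2)"
proof -
  have *: "(\<forall>j\<in>I. F x j = F y j) \<longleftrightarrow> restrict (F x) I = restrict (F y) I" for x y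
    by (auto simp: restrict_def fun_eq_iff)
  have "{(x, y). x \<in> S \<and> y \<in> S \<and> (\<forall>j\<in>I. F x j = F y j)} =
     (\<Union>v\<in>(\<lambda>x. restrict (F x) I) ` S. {x\<in>S. restrict (F x) I = v} \<times> {x\<in>S. restrict (F x) I = v})"
    unfolding * by auto
  also have "card \<dots> = (\<Sum>v\<in>(\<lambda>x. restrict (F x) I) ` S. card ({x\<in>S. restrict (F x) I = v} \<times> {x\<in>S. restrict (F x) I = v}))"
    using assms by (intro card_UN_disjoint) auto
  finally show ?thesis
    by (simp only: energy_def card_cartesian_product power2_eq_square)
qed

text \<open>The energy is the sum of the squared fibre sizes, and fibre sizes are subadditive over
  the cover, which may overlap. One factor \<open>card N\<close> comes from Cauchy-Schwarz, the
  other from summing the bound \<open>E\<close> over \<open>N\<close>.\<close>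

lemma energy_Union_le:
  assumes "finite N" "\<And>i. i \<in> N \<Longrightarrow> finite (T i)" "S \<subseteq> (\<Union>i\<in>N. T i)"
    and bound: "\<And>i. i \<in> N \<Longrightarrow> energy I F (T i) \<le> E"
  shows "energy I F S \<le> (card N)\<^sup>2 * E"
proof -
  let ?r = "\<lambda>T v. card {x\<in>T. restrict (F x) I = v}"
  have finS: "finite S" using assms(1-3) by (meson finite_UN finite_subset)
  let ?V = "(\<lambda>x. restrict (F x) I) ` S"
  have "real (energy I F S) = (\<Sum>v\<in>?V. (real (?r S v))\<^sup>2)"
    using finS by (simp add: energy_eq_sum_squares)
  also have "\<dots> \<le> (\<Sum>v\<in>?V. (\<Sum>i\<in>N. (real (?r (T i) v))\<^sup>2) * card N)"
  proof (intro sum_mono)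
    fix v
    have "?r S v \<le> card (\<Union>i\<in>N. {x\<in>T i. restrict (F x) I = v})"
      using assms by (intro card_mono) auto
    also have "\<dots> \<le> (\<Sum>i\<in>N. ?r (T i) v)" using assms(1) by (rule card_UN_le)
    finally have "real (?r S v) \<le> real (\<Sum>i\<in>N. ?r (T i) v)"
      by (simp only: of_nat_le_iff)
    then have "real (?r S v) \<le> (\<Sum>i\<in>N. real (?r (T i) v))"
      by (simp only: of_nat_sum)
    then have "(real (?r S v))\<^sup>2 \<le> (\<Sum>i\<in>N. real (?r (T i) v))\<^sup>2" by (intro power_mono) auto
    also have "\<dots> \<le> (\<Sum>i\<in>N. (real (?r (T i) v))\<^sup>2) * card N"
      by (rule sum_squared_le_sum_of_squares)
    finally show "(real (?r S v))\<^sup>2 \<le> (\<Sum>i\<in>N. (real (?r (T i) v))\<^sup>2) * card N" .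
  qed
  also have "\<dots> = (\<Sum>i\<in>N. \<Sum>v\<in>?V. (real (?r (T i) v))\<^sup>2) * card N"
    by (subst sum.swap) (simp add: sum_distrib_right)
  also have "\<dots> \<le> (\<Sum>i\<in>N. real E) * card N"
  proof (intro mult_right_mono sum_mono)
    fix i assume i: "i \<in> N"
    have "(\<Sum>v\<in>?V. (real (?r (T i) v))\<^sup>2) = (\<Sum>v\<in>?V \<inter> (\<lambda>x. restrict (F x) I) ` T i. (real (?r (T i) v))\<^sup>2)"
    proof (intro sum.mono_neutral_right ballI)
      fix v assume "v \<in> ?V - ?V \<inter> (\<lambda>x. restrict (F x) I) ` T i"
      then have "{x\<in>T i. restrict (F x) I = v} = {}" by blast
      then show "(real (?r (T i) v))\<^sup>2 = 0"
        by (simp only: card.empty of_nat_0 power2_eq_square mult_zero_left)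
    qed (use finS in auto)
    also have "\<dots> \<le> (\<Sum>v\<in>(\<lambda>x. restrict (F x) I) ` T i. (real (?r (T i) v))\<^sup>2)"
      using i assms(2) by (intro sum_mono2) auto
    also have "\<dots> = real (energy I F (T i))"
      using i assms(2) by (simp add: energy_eq_sum_squares)
    also have "\<dots> \<le> real E" using bound[OF i] by simp
    finally show "(\<Sum>v\<in>?V. (real (?r (T i) v))\<^sup>2) \<le> real E" .
  qed auto
  finally have "real (energy I F S) \<le> real ((card N)\<^sup>2 * E)" by (simp add: power2_eq_square mult_ac)
  then show ?thesis by (simp only: of_nat_le_iff)
qed

lemma sum_power_le_power_mean:
  fixes f :: "'a \<Rightarrow> real"
  assumes "finite B" "\<And>b. b \<in> B \<Longrightarrow> f b \<ge> 0" "n > 0"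
  shows "(\<Sum>b\<in>B. f b) ^ n \<le> real (card B) ^ (n - 1) * (\<Sum>b\<in>B. f b ^ n)"
proof (cases "B = {}")
  case False
  define c where "c = real (card B)"
  have c: "c > 0" using False assms(1) by (simp add: c_def card_gt_0_iff)
  have "convex_on {0::real..} (\<lambda>x. x ^ n)"
    using convex_power_even convex_power_odd by (cases "even n") (auto intro: convex_on_subset)
  then have "(\<Sum>b\<in>B. (1 / c) *\<^sub>R f b) ^ n \<le> (\<Sum>b\<in>B. (1 / c) * f b ^ n)"
    using assms False c by (intro convex_on_sum) (auto simp: c_def)
  also have "(\<Sum>b\<in>B. (1 / c) *\<^sub>R f b) = (\<Sum>b\<in>B. f b) / c" by (simp add: sum_divide_distrib)
  also have "(\<Sum>b\<in>B. (1 / c) * f b ^ n) = (\<Sum>b\<in>B. f b ^ n) / c" by (simp add: sum_divide_distrib)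
  finally have "(\<Sum>b\<in>B. f b) ^ n / c ^ n \<le> (\<Sum>b\<in>B. f b ^ n) / c" by (simp add: power_divide)
  moreover have "c ^ n = c * c ^ (n - 1)" using assms(3) by (cases n) auto
  ultimately show ?thesis using c by (simp add: field_simps flip: c_def)
qed (use assms in \<open>simp add: power_0_left\<close>)

subsection \<open>Newton's identities modulo prime powers\<close>

definition power_sum :: "int list \<Rightarrow> nat \<Rightarrow> int" where
  "power_sum xs j = (\<Sum>x\<leftarrow>xs. x ^ j)"

text \<open>The reversed polynomial with roots \<open>xs\<close>. Its coefficients are the signed
  elementary symmetric functions, and its constant term is 1, which suits a recursion on the
  degree.\<close>

definition root_fps :: "int list \<Rightarrow> int fps" where
  "root_fps xs = (\<Prod>x\<leftarrow>xs. 1 - fps_const x * fps_X)"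

lemma power_sum_Nil [simp]: "power_sum [] j = 0"
  and power_sum_Cons [simp]: "power_sum (x # xs) j = x ^ j + power_sum xs j"
  and power_sum_append [simp]: "power_sum (xs @ ys) j = power_sum xs j + power_sum ys j"
  by (simp_all add: power_sum_def)

lemma root_fps_Nil [simp]: "root_fps [] = 1"
  and root_fps_Cons [simp]: "root_fps (x # xs) = (1 - fps_const x * fps_X) * root_fps xs"
  by (simp_all add: root_fps_def)

lemma geometric_fps: "(1 - fps_const x * fps_X) * Abs_fps (\<lambda>n. x ^ Suc n) = fps_const (x :: int)"
proof (rule fps_ext)
  fix n
  show "fps_nth ((1 - fps_const x * fps_X) * Abs_fps (\<lambda>n. x ^ Suc n)) n = fps_nth (fps_const x) n"
    by (cases n) (auto simp: left_diff_distrib mult.assoc fps_mult_left_const_nth)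
qed

text \<open>The logarithmic derivative of the product generates the power sums; multiplying out
  avoids division in the ring of integer power series. Comparing coefficients gives Newton's
  identities.\<close>

lemma fps_deriv_root_fps:
  "fps_deriv (root_fps xs) = - (root_fps xs * Abs_fps (\<lambda>n. power_sum xs (Suc n)))"
proof (induction xs)
  case Nil
  have "Abs_fps (\<lambda>n. power_sum [] (Suc n)) = 0" by (rule fps_ext) simp
  then show ?case by simp
next
  case (Cons x xs)
  let ?a = "1 - fps_const x * fps_X"
  let ?F = "root_fps xs"
  let ?G = "Abs_fps (\<lambda>n. power_sum xs (Suc n))"
  let ?g = "Abs_fps (\<lambda>n. x ^ Suc n)"
  have G: "Abs_fps (\<lambda>n. power_sum (x # xs) (Suc n)) = ?g + ?G"
    by (rule fps_ext) simp
  have "fps_deriv (root_fps (x # xs)) = ?a * fps_deriv ?F - fps_const x * ?F"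
    by (simp add: fps_const_neg[symmetric] del: fps_const_neg)
  also have "\<dots> = - (?a * ?F * ?G) - (?a * ?g) * ?F"
    by (simp only: Cons.IH geometric_fps) (simp add: algebra_simps)
  also have "\<dots> = - (root_fps (x # xs) * Abs_fps (\<lambda>n. power_sum (x # xs) (Suc n)))"
    unfolding G root_fps_Cons by (simp add: algebra_simps)
  finally show ?case .
qed

lemma newton_identity:
  "int (Suc k) * fps_nth (root_fps xs) (Suc k) =
     - (\<Sum>i=0..k. fps_nth (root_fps xs) i * power_sum xs (Suc (k - i)))"
proof -
  have "fps_nth (fps_deriv (root_fps xs)) k =
     fps_nth (- (root_fps xs * Abs_fps (\<lambda>n. power_sum xs (Suc n)))) k"
    by (simp only: fps_deriv_root_fps)
  then show ?thesis by (simp add: fps_mult_nth add.commute)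
qed

lemma root_fps_nth_0 [simp]: "fps_nth (root_fps xs) 0 = 1"
  by (induction xs) auto

lemma root_fps_nth_Cons:
  "fps_nth (root_fps (x # xs)) (Suc k) = fps_nth (root_fps xs) (Suc k) - x * fps_nth (root_fps xs) k"
  by (simp add: left_diff_distrib mult.assoc fps_mult_left_const_nth)

lemma root_fps_nth_eq_0: "k > length xs \<Longrightarrow> fps_nth (root_fps xs) k = 0"
proof (induction xs arbitrary: k)
  case (Cons x xs)
  then obtain l where l: "k = Suc l" by (cases k) auto
  show ?case using Cons unfolding l root_fps_nth_Cons by simp
qed simp

text \<open>Reading the coefficients backwards undoes the reversal, so that information on
  elementary symmetric functions becomes information on values of the polynomial itself.\<close>

lemma root_fps_eval:
  "(\<Sum>k\<le>length xs. fps_nth (root_fps xs) k * y ^ (length xs - k)) = (\<Prod>x\<leftarrow>xs. y - x)"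
proof (induction xs)
  case (Cons x xs)
  let ?f = "fps_nth (root_fps xs)"
  let ?n = "length xs"
  have "(\<Sum>k\<le>length (x # xs). fps_nth (root_fps (x # xs)) k * y ^ (length (x # xs) - k))
    = y ^ Suc ?n + (\<Sum>k\<le>?n. (?f (Suc k) - x * ?f k) * y ^ (?n - k))"
    by (simp only: length_Cons sum.atMost_Suc_shift root_fps_nth_Cons) (simp del: root_fps_Cons)
  also have "\<dots> = (y ^ Suc ?n + (\<Sum>k\<le>?n. ?f (Suc k) * y ^ (?n - k))) - x * (\<Sum>k\<le>?n. ?f k * y ^ (?n - k))"
    by (simp add: sum_subtractf left_diff_distrib sum_distrib_left mult.assoc)
  also have "y ^ Suc ?n + (\<Sum>k\<le>?n. ?f (Suc k) * y ^ (?n - k)) = (\<Sum>k\<le>Suc ?n. ?f k * y ^ (Suc ?n - k))"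
    by (simp only: sum.atMost_Suc_shift) simp
  also have "\<dots> = (\<Sum>k\<le>?n. ?f k * y ^ (Suc ?n - k))"
    by (simp add: root_fps_nth_eq_0)
  also have "\<dots> = (\<Sum>k\<le>?n. y * (?f k * y ^ (?n - k)))"
    by (intro sum.cong) (auto simp: Suc_diff_le)
  also have "\<dots> = y * (\<Sum>k\<le>?n. ?f k * y ^ (?n - k))" by (simp add: sum_distrib_left)
  finally show ?case unfolding Cons.IH by (simp add: algebra_simps)
qed simp

text \<open>Newton's identity expresses \<open>k\<close> times the coefficient of index
  \<open>k\<close> through earlier ones, and \<open>k\<close> may be cancelled modulo
  \<open>M\<close> because it is coprime to \<open>M\<close>.\<close>

lemma root_fps_cong:
  assumes eq: "\<And>j. 1 \<le> j \<Longrightarrow> j \<le> m \<Longrightarrow> [power_sum xs j = power_sum ys j] (mod M)"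
    and cop: "\<And>k. 1 \<le> k \<Longrightarrow> k \<le> m \<Longrightarrow> coprime (int k) M"
  shows "k \<le> m \<Longrightarrow> [fps_nth (root_fps xs) k = fps_nth (root_fps ys) k] (mod M)"
proof (induction k rule: less_induct)
  case (less k)
  show ?case
  proof (cases k)
    case (Suc l)
    have "[int (Suc l) * fps_nth (root_fps xs) (Suc l) = int (Suc l) * fps_nth (root_fps ys) (Suc l)] (mod M)"
      unfolding newton_identity using less Suc
      by (intro cong_uminus cong_sum cong_mult eq) auto
    then show ?thesis
      using cop[of "Suc l"] less.prems Suc by (simp add: cong_mult_lcancel del: of_nat_Suc)
  qed auto
qed

text \<open>The polynomials with roots xs and ys agree modulo \<open>p ^ e\<close> by Newton's identities, so every
  element of ys is a root modulo \<open>p ^ e\<close> of a polynomial whose roots are distinct modulo p.\<close>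

lemma equal_power_sums_imp_cong:
  fixes p :: nat
  assumes "length xs = m" "length ys = m" "prime p" "p > m" "distinct (map (\<lambda>x. x mod int p) xs)"
    and eq: "\<And>j. 1 \<le> j \<Longrightarrow> j \<le> m \<Longrightarrow> [power_sum xs j = power_sum ys j] (mod int p ^ e)"
    and y: "y \<in> set ys" and e: "e > 0"
  shows "\<exists>x\<in>set xs. [y = x] (mod int p ^ e)"
proof -
  have cop: "coprime (int k) (int p ^ e)" if "1 \<le> k" "k \<le> m" for k
  proof -
    have "\<not> p dvd k" using that assms(4) by (auto dest: dvd_imp_le)
    then have "coprime p k" using assms(3) by (simp add: prime_imp_coprime)
    then show ?thesis by (simp add: coprime_commute)
  qed
  have "[(\<Prod>x\<leftarrow>xs. y - x) = (\<Prod>x\<leftarrow>ys. y - x)] (mod int p ^ e)"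
    unfolding root_fps_eval[symmetric] assms(1,2)
    using root_fps_cong[OF eq cop] by (intro cong_sum cong_mult) auto
  moreover have "(\<Prod>x\<leftarrow>ys. y - x) = 0" using y by (induction ys) auto
  ultimately have dvd: "int p ^ e dvd (\<Prod>x\<leftarrow>xs. y - x)" by (simp add: cong_0_iff)
  have "distinct xs" using assms(5) by (simp add: distinct_map)
  then have prod: "(\<Prod>x\<leftarrow>xs. y - x) = (\<Prod>x\<in>set xs. y - x)"
    by (rule prod.distinct_set_conv_list[symmetric])
  have "int p dvd (\<Prod>x\<in>set xs. y - x)"
    using dvd e unfolding prod by (meson dvd_power dvd_trans)
  moreover have pp: "prime (int p)" using assms(3) by simp
  ultimately obtain x where x: "x \<in> set xs" "int p dvd y - x"
    by (meson prime_dvd_prod_iff List.finite_set)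
  \<comment> \<open>Residues of \<open>xs\<close> modulo \<open>p\<close> are distinct, so
    \<open>p\<close> divides no other factor and the full power \<open>p ^ e\<close> must fall on
    \<open>y - x\<close>.\<close>
  have "coprime (int p ^ e) (\<Prod>z\<in>set xs - {x}. y - z)"
  proof (rule prod_coprime_right)
    fix z assume z: "z \<in> set xs - {x}"
    have "\<not> int p dvd y - z"
    proof
      assume "int p dvd y - z"
      then have "x mod int p = z mod int p"
        using x(2) by (metis mod_eq_dvd_iff)
      then show False using assms(5) z x(1) by (auto simp: distinct_map inj_on_def)
    qed
    then show "coprime (int p ^ e) (y - z)"
      using pp by (simp add: prime_imp_coprime)
  qed
  moreover have "(\<Prod>z\<in>set xs. y - z) = (y - x) * (\<Prod>z\<in>set xs - {x}. y - z)"
    using x(1) by (simp add: prod.remove)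
  ultimately have "int p ^ e dvd y - x"
    using dvd unfolding prod by (simp add: coprime_dvd_mult_left_iff)
  then show ?thesis using x(1) by (auto simp: cong_iff_dvd_diff)
qed

subsection \<open>Vinogradov's mean value\<close>

definition lists_of :: "nat \<Rightarrow> 'a set \<Rightarrow> 'a list set" where
  "lists_of k X = {xs. set xs \<subseteq> X \<and> length xs = k}"

lemma finite_lists_of: "finite X \<Longrightarrow> finite (lists_of k X)"
  unfolding lists_of_def by (rule finite_lists_length_eq)

lemma card_lists_of: "finite X \<Longrightarrow> card (lists_of k X) = card X ^ k"
  unfolding lists_of_def by (rule card_lists_length_eq)

lemma lists_of_mono: "X \<subseteq> Y \<Longrightarrow> lists_of k X \<subseteq> lists_of k Y"
  unfolding lists_of_def by auto

lemma lists_of_0 [simp]: "lists_of 0 X = {[]}"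
  by (auto simp: lists_of_def)

lemma lists_of_Suc: "lists_of (Suc k) X = (\<lambda>(x, xs). x # xs) ` (X \<times> lists_of k X)"
  by (auto simp: lists_of_def length_Suc_conv image_iff)

lemma sum_char_lists_of:
  assumes "finite X"
  shows "(\<Sum>xs\<in>lists_of k X. additive_char Q (\<Sum>j\<in>I. a j * power_sum xs j))
       = (\<Sum>x\<in>X. additive_char Q (\<Sum>j\<in>I. a j * x ^ j)) ^ k"
proof (induction k)
  case (Suc k)
  have inj: "inj_on (\<lambda>(x, xs). x # xs) (X \<times> lists_of k X)" by (auto simp: inj_on_def)
  have "(\<Sum>xs\<in>lists_of (Suc k) X. additive_char Q (\<Sum>j\<in>I. a j * power_sum xs j))
    = (\<Sum>(x, xs)\<in>X \<times> lists_of k X. additive_char Q (\<Sum>j\<in>I. a j * x ^ j) *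
         additive_char Q (\<Sum>j\<in>I. a j * power_sum xs j))"
    unfolding lists_of_Suc sum.reindex[OF inj]
    by (intro sum.cong) (auto simp: additive_char_add ring_distribs sum.distrib)
  also have "\<dots> = (\<Sum>x\<in>X. additive_char Q (\<Sum>j\<in>I. a j * x ^ j)) *
      (\<Sum>xs\<in>lists_of k X. additive_char Q (\<Sum>j\<in>I. a j * power_sum xs j))"
    by (simp add: sum_product sum.cartesian_product)
  finally show ?case by (simp add: Suc.IH)
qed simp

text \<open>A tuple is split into a distinguished part \<open>w\<close>, measured by
  \<open>F\<close>, and free variables \<open>xs\<close>. Its exponential sum factors accordingly,
  so inequalities can be applied to the free variables alone.\<close>

definition append_sum :: "('a \<Rightarrow> nat \<Rightarrow> int) \<Rightarrow> 'a \<times> int list \<Rightarrow> nat \<Rightarrow> int" where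
  "append_sum F = (\<lambda>(w, xs) j. F w j + power_sum xs j)"

lemma sum_char_append_sum:
  assumes "finite X"
  shows "(\<Sum>z\<in>W \<times> lists_of k X. additive_char Q (\<Sum>j\<in>I. a j * append_sum F z j))
       = (\<Sum>w\<in>W. additive_char Q (\<Sum>j\<in>I. a j * F w j)) * (\<Sum>x\<in>X. additive_char Q (\<Sum>j\<in>I. a j * x ^ j)) ^ k"
  unfolding sum_char_lists_of[OF assms, symmetric] sum_product sum.cartesian_product
  by (intro sum.cong) (auto simp: append_sum_def additive_char_add ring_distribs sum.distrib)

text \<open>On the Fourier side the distinguished part is a nonnegative weight and the free
  variables give a power \<open>2 * k\<close> of one sum. The power mean inequality over the classes
  costs \<open>card B ^ (2 * k - 1)\<close>, and summing the bound \<open>E\<close> over the classes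
  costs one more factor.\<close>

lemma energy_holder:
  assumes "finite I" "finite W" "finite B" "\<And>b. b \<in> B \<Longrightarrow> finite (X b)"
    and disj: "\<And>b c. b \<in> B \<Longrightarrow> c \<in> B \<Longrightarrow> b \<noteq> c \<Longrightarrow> X b \<inter> X c = {}"
    and "k > 0"
    and bound: "\<And>b. b \<in> B \<Longrightarrow> energy I (append_sum F) (W \<times> lists_of k (X b)) \<le> E"
  shows "energy I (append_sum F) (W \<times> lists_of k (\<Union>b\<in>B. X b)) \<le> card B ^ (2 * k) * E"
proof -
  let ?Y = "\<Union>b\<in>B. X b"
  let ?T = "W \<times> lists_of k ?Y"
  have finY: "finite ?Y" using assms by blast
  have finT: "finite ?T" using assms finY by (intro finite_cartesian_product finite_lists_of)
  obtain Q where Q: "Q > 0" "\<And>t. t \<in> ?T \<times> ?T \<times> I \<Longrightarrow>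
      \<bar>(\<lambda>(x, y, j). append_sum F x j - append_sum F y j) t\<bar> < Q"
    using exists_bound[of "?T \<times> ?T \<times> I"] assms(1) finT by blast
  have big: "\<bar>append_sum F x j - append_sum F y j\<bar> < Q" if "x \<in> ?T" "y \<in> ?T" "j \<in> I" for x y j
    using Q(2)[of "(x, y, j)"] that by auto
  let ?A = "PiE I (\<lambda>_. {0..<Q})"
  let ?w = "\<lambda>a. norm (\<Sum>w\<in>W. additive_char Q (\<Sum>j\<in>I. a j * F w j))"
  let ?S = "\<lambda>X a. \<Sum>x\<in>X. additive_char Q (\<Sum>j\<in>I. a j * x ^ j)"
  have fourier: "of_int Q ^ card I * real (energy I (append_sum F) (W \<times> lists_of k Z))
     = (\<Sum>a\<in>?A. (?w a)\<^sup>2 * norm (?S Z a) ^ (2 * k))" if "Z \<subseteq> ?Y" for Z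
  proof -
    have sub: "W \<times> lists_of k Z \<subseteq> ?T" using lists_of_mono[OF that] by blast
    have finZ: "finite Z" using that finY by (rule finite_subset)
    have "of_int Q ^ card I * real (energy I (append_sum F) (W \<times> lists_of k Z))
      = (\<Sum>a\<in>?A. (norm (\<Sum>z\<in>W \<times> lists_of k Z. additive_char Q (\<Sum>j\<in>I. a j * append_sum F z j)))\<^sup>2)"
      using sub by (intro energy_fourier big assms(1) Q(1) finite_subset[OF sub finT]) blast+
    also have "\<dots> = (\<Sum>a\<in>?A. (?w a)\<^sup>2 * norm (?S Z a) ^ (2 * k))"
      unfolding sum_char_append_sum[OF finZ]
      by (simp add: norm_mult norm_power power_mult_distrib power_even_eq)
    finally show ?thesis .
  qed
  have "of_int Q ^ card I * real (energy I (append_sum F) ?T) = (\<Sum>a\<in>?A. (?w a)\<^sup>2 * norm (?S ?Y a) ^ (2 * k))"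
    by (rule fourier) simp
  also have "\<dots> \<le> (\<Sum>a\<in>?A. (?w a)\<^sup>2 * (real (card B) ^ (2 * k - 1) * (\<Sum>b\<in>B. norm (?S (X b) a) ^ (2 * k))))"
  proof (intro sum_mono mult_left_mono)
    fix a
    have "?S ?Y a = (\<Sum>b\<in>B. ?S (X b) a)"
      using assms(3,4) disj by (intro sum.UNION_disjoint) auto
    then have "norm (?S ?Y a) ^ (2 * k) \<le> (\<Sum>b\<in>B. norm (?S (X b) a)) ^ (2 * k)"
      by (intro power_mono) (auto intro: norm_sum)
    also have "\<dots> \<le> real (card B) ^ (2 * k - 1) * (\<Sum>b\<in>B. norm (?S (X b) a) ^ (2 * k))"
      using assms by (intro sum_power_le_power_mean) auto
    finally show "norm (?S ?Y a) ^ (2 * k) \<le> real (card B) ^ (2 * k - 1) * (\<Sum>b\<in>B. norm (?S (X b) a) ^ (2 * k))" .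
  qed auto
  also have "\<dots> = real (card B) ^ (2 * k - 1) * (\<Sum>b\<in>B. \<Sum>a\<in>?A. (?w a)\<^sup>2 * norm (?S (X b) a) ^ (2 * k))"
    by (subst sum.swap) (simp add: sum_distrib_left mult_ac)
  also have "\<dots> = real (card B) ^ (2 * k - 1) * (\<Sum>b\<in>B. of_int Q ^ card I * real (energy I (append_sum F) (W \<times> lists_of k (X b))))"
    by (intro arg_cong2[where f = "(*)"] sum.cong refl fourier[symmetric]) auto
  also have "\<dots> \<le> real (card B) ^ (2 * k - 1) * (\<Sum>b\<in>B. of_int Q ^ card I * real E)"
    using Q(1) bound by (intro mult_left_mono sum_mono) auto
  also have "\<dots> = of_int Q ^ card I * (real (card B) ^ (2 * k) * real E)"
    using assms(6) by (cases k) auto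
  finally have "real (energy I (append_sum F) ?T) \<le> real (card B) ^ (2 * k) * real E"
    using Q(1) by simp
  also have "\<dots> = real (card B ^ (2 * k) * E)" by simp
  finally show ?thesis by (simp only: of_nat_le_iff)
qed

text \<open>\<open>V\<close> contains the pairs of distinguished parts that can occur in a solution.
  For each of them the free variables solve an inhomogeneous system, which has at most as many
  solutions as the homogeneous one.\<close>

lemma energy_append_sum_le:
  assumes "finite I" "finite W" "finite X" "finite V"
    and V: "\<And>w w' xs xs'. w \<in> W \<Longrightarrow> w' \<in> W \<Longrightarrow> xs \<in> lists_of k X \<Longrightarrow> xs' \<in> lists_of k X \<Longrightarrow>
      (\<forall>j\<in>I. F w j + power_sum xs j = F w' j + power_sum xs' j) \<Longrightarrow> (w, w') \<in> V"
  shows "energy I (append_sum F) (W \<times> lists_of k X) \<le> card V * energy I power_sum (lists_of k X)"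
proof -
  let ?L = "lists_of k X"
  let ?D = "\<lambda>v. {(x, y). x \<in> ?L \<and> y \<in> ?L \<and> (\<forall>j\<in>I. power_sum x j - power_sum y j = F (snd v) j - F (fst v) j)}"
  let ?Z = "{(x, y). x \<in> W \<times> ?L \<and> y \<in> W \<times> ?L \<and> (\<forall>j\<in>I. append_sum F x j = append_sum F y j)}"
  let ?g = "\<lambda>((w, xs), (w', xs')). ((w, w'), (xs, xs'))"
  have fin: "finite ?L" using assms(3) by (rule finite_lists_of)
  have finD: "finite (?D v)" for v
    using fin by (auto intro: finite_subset[of _ "?L \<times> ?L"])
  have "card ?Z \<le> card (Sigma V ?D)"
  proof (rule card_inj_on_le[where f = ?g])
    show "inj_on ?g ?Z" by (auto simp: inj_on_def)
    show "?g ` ?Z \<subseteq> Sigma V ?D"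
      using V by (fastforce simp: append_sum_def algebra_simps)
    show "finite (Sigma V ?D)" using assms(4) finD by auto
  qed
  also have "\<dots> = (\<Sum>v\<in>V. card (?D v))" using assms(4) finD by (intro card_SigmaI) auto
  also have "\<dots> \<le> (\<Sum>v\<in>V. energy I power_sum ?L)"
    by (intro sum_mono card_shifted_le_energy assms(1) fin)
  finally show ?thesis by (simp add: energy_def)
qed

section \<open>Invariance under translation and dilation\<close>

lemma power_sum_shift:
  "power_sum (map (\<lambda>x. x - b) xs) j = (\<Sum>i\<le>j. of_nat (j choose i) * power_sum xs i * (- b) ^ (j - i))"
proof (induction xs)
  case (Cons x xs)
  have "(x - b) ^ j = (\<Sum>i\<le>j. of_nat (j choose i) * x ^ i * (- b) ^ (j - i))"
    using binomial_ring[of x "- b" j] by simp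
  then show ?case using Cons by (simp add: sum.distrib ring_distribs)
qed simp

lemma power_sum_0 [simp]: "power_sum xs 0 = int (length xs)"
  by (induction xs) auto

lemma power_sum_scale: "power_sum (map (\<lambda>x. c * x) xs) j = c ^ j * power_sum xs j"
  by (induction xs) (auto simp: ring_distribs power_mult_distrib)

text \<open>The binomial expansion of a shifted power sum involves only lower degrees; the term of
  degree 0 is the number of variables, whence the condition on the lengths.\<close>

lemma power_sum_shift_eq:
  assumes "length xs = length ys" "\<And>j. j \<in> {1..m} \<Longrightarrow> power_sum xs j = power_sum ys j" "j \<in> {1..m}"
  shows "power_sum (map (\<lambda>x. x - b) xs) j = power_sum (map (\<lambda>x. x - b) ys) j"
  unfolding power_sum_shift
proof (intro sum.cong refl)
  fix i assume "i \<in> {..j}"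
  then have "power_sum xs i = power_sum ys i" using assms by (cases "i = 0") auto
  then show "int (j choose i) * power_sum xs i * (- b) ^ (j - i) = int (j choose i) * power_sum ys i * (- b) ^ (j - i)"
    by simp
qed

text \<open>Classically \<open>J\<close> with \<open>k\<close> variables on each side, that is
  \<open>2 * k\<close> in total, and equations of degrees 1 to \<open>m\<close>.\<close>

definition vinogradov_mean :: "nat \<Rightarrow> nat \<Rightarrow> nat \<Rightarrow> nat" where
  "vinogradov_mean m k P = energy {1..m} power_sum (lists_of k {0..<int P})"

lemma map_shift_scale:
  fixes b c :: int
  assumes "c > 0" "\<And>x. x \<in> set xs \<Longrightarrow> c dvd x - b"
  shows "map (\<lambda>x. c * x) (map (\<lambda>x. (x - b) div c) xs) = map (\<lambda>x. x - b) xs"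
  using assms by (induction xs) auto

text \<open>The substitution \<open>x = b + c * z\<close> maps solutions in the progression to
  solutions in \<open>{0..<int P}\<close>: the system is invariant under translation, and the
  dilation multiplies the equation of degree \<open>j\<close> by \<open>c ^ j\<close>.\<close>

lemma energy_progression_le:
  assumes "c > 0" "X \<subseteq> (\<lambda>z. b + c * z) ` {0..<int P}"
  shows "energy {1..m} power_sum (lists_of k X) \<le> vinogradov_mean m k P"
  unfolding vinogradov_mean_def
proof (rule energy_image_le[where g = "map (\<lambda>x. (x - b) div c)"])
  have dvd: "c dvd x - b" if "x \<in> X" for x using assms that by auto
  have *: "map (\<lambda>x. c * x) (map (\<lambda>x. (x - b) div c) xs) = map (\<lambda>x. x - b) xs" if "xs \<in> lists_of k X" for xs
    using that dvd by (intro map_shift_scale assms(1)) (auto simp: lists_of_def)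
  show "inj_on (map (\<lambda>x. (x - b) div c)) (lists_of k X)"
  proof (rule inj_onI)
    fix xs ys assume "xs \<in> lists_of k X" "ys \<in> lists_of k X" "map (\<lambda>x. (x - b) div c) xs = map (\<lambda>x. (x - b) div c) ys"
    then have "map (\<lambda>x. x - b) xs = map (\<lambda>x. x - b) ys" using * by metis
    then show "xs = ys" by (metis (no_types, lifting) diff_add_cancel inj_map_eq_map injI)
  qed
  show "map (\<lambda>x. (x - b) div c) ` lists_of k X \<subseteq> lists_of k {0..<int P}"
    using assms by (fastforce simp: lists_of_def)
  fix xs ys j
  assume xy: "xs \<in> lists_of k X" "ys \<in> lists_of k X" "\<forall>j\<in>{1..m}. power_sum xs j = power_sum ys j" "j \<in> {1..m}"
  have "power_sum (map (\<lambda>x. x - b) xs) j = power_sum (map (\<lambda>x. x - b) ys) j"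
    using xy by (intro power_sum_shift_eq[of _ _ m]) (auto simp: lists_of_def)
  then have "c ^ j * power_sum (map (\<lambda>x. (x - b) div c) xs) j = c ^ j * power_sum (map (\<lambda>x. (x - b) div c) ys) j"
    by (simp only: power_sum_scale[symmetric] *[OF xy(1)] *[OF xy(2)])
  then show "power_sum (map (\<lambda>x. (x - b) div c) xs) j = power_sum (map (\<lambda>x. (x - b) div c) ys) j"
    using assms(1) by simp
qed (auto intro: finite_lists_of)

section \<open>Linnik's lemma for tuples distinct modulo p\<close>

definition well_spaced :: "nat \<Rightarrow> nat \<Rightarrow> nat \<Rightarrow> int list set" where
  "well_spaced m p P = {us \<in> lists_of m {0..<int P}. distinct (map (\<lambda>x. x mod int p) us)}"

lemma finite_well_spaced [simp]: "finite (well_spaced m p P)"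
  unfolding well_spaced_def by (intro finite_subset[OF _ finite_lists_of]) auto

lemma card_well_spaced_le: "card (well_spaced m p P) \<le> P ^ m"
proof -
  have "card (well_spaced m p P) \<le> card (lists_of m {0..<int P})"
    unfolding well_spaced_def by (intro card_mono finite_lists_of) auto
  then show ?thesis by (simp add: card_lists_of)
qed

lemma div_less_of_less_mult:
  fixes c d x :: int
  assumes "c > 0" "x < c * d"
  shows "x div c < d"
proof (rule ccontr)
  assume "\<not> x div c < d"
  then have "c * d \<le> c * (x div c)" using assms(1) by simp
  also have "\<dots> \<le> x" using assms(1) by (simp flip: minus_mod_eq_mult_div)
  finally show False using assms(2) by simp
qed

lemma card_residues_le:
  assumes "p > 0" "j \<le> m"
  shows "card {h \<in> {0..<int p ^ m}. [h = c] (mod int p ^ j)} \<le> p ^ (m - j)"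
proof -
  let ?A = "{h \<in> {0..<int p ^ m}. [h = c] (mod int p ^ j)}"
  have pm: "int p ^ m = int p ^ (m - j) * int p ^ j"
    using assms(2) by (simp flip: power_add)
  have "card ?A \<le> card {0..<int p ^ (m - j)}"
  proof (rule card_inj_on_le[where f = "\<lambda>h. h div int p ^ j"])
    show "inj_on (\<lambda>h. h div int p ^ j) ?A"
    proof (rule inj_onI)
      fix x y assume "x \<in> ?A" "y \<in> ?A" and eq: "x div int p ^ j = y div int p ^ j"
      then have "x mod int p ^ j = y mod int p ^ j" by (auto simp: cong_def)
      with eq show "x = y" by (metis div_mult_mod_eq)
    qed
    show "(\<lambda>h. h div int p ^ j) ` ?A \<subseteq> {0..<int p ^ (m - j)}"
    proof clarify
      fix h assume "h \<in> {0..<int p ^ m}"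
      then show "h div int p ^ j \<in> {0..<int p ^ (m - j)}"
        using assms(1) unfolding pm
        by (auto simp: pos_imp_zdiv_nonneg_iff mult.commute intro!: div_less_of_less_mult)
    qed
  qed simp
  then show ?thesis by (simp add: nat_power_eq)
qed

text \<open>A prescribed residue modulo \<open>p ^ j\<close> has at most \<open>p ^ (m - j)\<close>
  lifts modulo \<open>p ^ m\<close>, which gives the exponent of \<open>p\<close> in total. Once all
  power sums are fixed modulo \<open>p ^ m\<close>, Newton's identities determine the entries modulo
  \<open>p ^ m\<close>, hence exactly since \<open>P\<close> is at most
  \<open>p ^ m\<close>.\<close>

lemma card_well_spaced_cong_le:
  assumes p: "prime p" "p > m" "P \<le> p ^ m" "m > 0"
  shows "card {us \<in> well_spaced m p P. \<forall>j\<in>{1..m}. [power_sum (map (\<lambda>x. x - b) us) j = c j] (mod int p ^ j)}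
    \<le> m ^ m * p ^ (\<Sum>j<m. j)" (is "card ?V \<le> _")
proof -
  let ?N = "int p ^ m"
  have p0: "p > 0" using p(1) by (simp add: prime_gt_0_nat)
  define \<Phi> where "\<Phi> us = restrict (\<lambda>j. power_sum (map (\<lambda>x. x - b) us) j mod ?N) {1..m}" for us
  let ?H = "PiE {1..m} (\<lambda>j. {h \<in> {0..<?N}. [h = c j] (mod int p ^ j)})"
  have finH: "finite ?H"
    by (intro finite_PiE finite_subset[OF _ finite_atLeastLessThan_int[of 0 ?N]]) auto
  have sub: "?V \<subseteq> (\<Union>h\<in>?H. {us \<in> ?V. \<Phi> us = h})"
  proof
    fix us assume us: "us \<in> ?V"
    have "\<Phi> us \<in> ?H"
    proof (intro PiE_I)
      fix j assume j: "j \<in> {1..m}"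
      have "int p ^ j dvd ?N" using j by (intro le_imp_power_dvd) auto
      then have "[power_sum (map (\<lambda>x. x - b) us) j mod ?N = power_sum (map (\<lambda>x. x - b) us) j] (mod int p ^ j)"
        by (simp add: cong_def mod_mod_cancel)
      then show "\<Phi> us j \<in> {h \<in> {0..<?N}. [h = c j] (mod int p ^ j)}"
        using us j p0 by (auto simp: \<Phi>_def intro: cong_trans)
    qed (auto simp: \<Phi>_def)
    then show "us \<in> (\<Union>h\<in>?H. {us \<in> ?V. \<Phi> us = h})" using us by blast
  qed
  have fibre: "card {us \<in> ?V. \<Phi> us = h} \<le> m ^ m" for h
  proof (cases "{us \<in> ?V. \<Phi> us = h} = {}")
    case False
    then obtain us where us: "us \<in> ?V" "\<Phi> us = h" by blast
    \<comment> \<open>Only the inclusion of the entries of \<open>vs\<close> among those of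
      \<open>us\<close> is extracted, which is why \<open>m ^ m\<close> appears in place of the
      number of permutations.\<close>
    have "{us \<in> ?V. \<Phi> us = h} \<subseteq> lists_of m (set us)"
    proof
      fix vs assume vs: "vs \<in> {us \<in> ?V. \<Phi> us = h}"
      have len: "length us = m" "length vs = m" using us vs by (auto simp: well_spaced_def lists_of_def)
      have "set vs \<subseteq> set us"
      proof
        fix v assume v: "v \<in> set vs"
        have "\<exists>x\<in>set (map (\<lambda>x. x - b) us). [v - b = x] (mod ?N)"
        proof (rule equal_power_sums_imp_cong[OF _ _ p(1,2)])
          show "distinct (map (\<lambda>x. x mod int p) (map (\<lambda>x. x - b) us))"
          proof -
            have d: "distinct us" "inj_on (\<lambda>x. x mod int p) (set us)"
              using us by (auto simp: well_spaced_def distinct_map)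
            have "inj_on (\<lambda>x. (x - b) mod int p) (set us)"
            proof (rule inj_onI)
              fix x y assume "x \<in> set us" "y \<in> set us" "(x - b) mod int p = (y - b) mod int p"
              moreover from this have "x mod int p = y mod int p" by (simp add: mod_eq_dvd_iff)
              ultimately show "x = y" using d(2) by (auto dest: inj_onD)
            qed
            then show ?thesis using d(1) by (simp add: distinct_map comp_def inj_on_def)
          qed
          show "[power_sum (map (\<lambda>x. x - b) us) j = power_sum (map (\<lambda>x. x - b) vs) j] (mod ?N)"
            if "1 \<le> j" "j \<le> m" for j
          proof -
            have "\<Phi> us j = \<Phi> vs j" using us vs by simp
            then show ?thesis using that by (simp add: \<Phi>_def cong_def)
          qed
        qed (use len v p in auto)
        then obtain x where x: "x \<in> set us" "[v - b = x - b] (mod ?N)" by auto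
        then have "?N dvd v - x" by (simp add: cong_iff_dvd_diff)
        moreover have "0 \<le> x" "x < int P" "0 \<le> v" "v < int P"
          using x(1) v us vs by (auto simp: well_spaced_def lists_of_def)
        moreover have "int P \<le> ?N" using p(3) by (metis of_nat_le_iff of_nat_power)
        ultimately have "?N dvd \<bar>v - x\<bar>" "\<bar>v - x\<bar> < ?N" by (simp, linarith)
        then have "v = x" using zdvd_not_zless[of "\<bar>v - x\<bar>" ?N] by fastforce
        then show "v \<in> set us" using x(1) by simp
      qed
      then show "vs \<in> lists_of m (set us)" using len by (simp add: lists_of_def)
    qed
    then have "card {us \<in> ?V. \<Phi> us = h} \<le> card (lists_of m (set us))"
      by (intro card_mono finite_lists_of) auto
    also have "\<dots> = card (set us) ^ m" by (simp add: card_lists_of)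
    also have "\<dots> \<le> m ^ m"
      using us card_length[of us] by (intro power_mono) (auto simp: well_spaced_def lists_of_def)
    finally show ?thesis .
  next
    case True
    show ?thesis unfolding True by simp
  qed
  have "card ?V \<le> card (\<Union>h\<in>?H. {us \<in> ?V. \<Phi> us = h})"
    using finH by (intro card_mono sub) (auto intro!: finite_UN_I)
  also have "\<dots> \<le> (\<Sum>h\<in>?H. card {us \<in> ?V. \<Phi> us = h})" using finH by (rule card_UN_le)
  also have "\<dots> \<le> card ?H * m ^ m" using sum_bounded_above[of ?H _ "m ^ m"] fibre by auto
  also have "card ?H \<le> p ^ (\<Sum>j<m. j)"
  proof -
    have "card ?H = (\<Prod>j\<in>{1..m}. card {h \<in> {0..<?N}. [h = c j] (mod int p ^ j)})"
      by (rule card_PiE) auto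
    also have "\<dots> \<le> (\<Prod>j\<in>{1..m}. p ^ (m - j))"
      using p0 by (intro prod_mono conjI card_residues_le le0) auto
    also have "\<dots> = p ^ (\<Sum>j\<in>{1..m}. m - j)" by (simp add: power_sum)
    also have "(\<Sum>j\<in>{1..m}. m - j) = (\<Sum>j<m. j)"
      by (rule sum.reindex_bij_witness[of _ "\<lambda>j. m - j" "\<lambda>j. m - j"]) auto
    finally show ?thesis .
  qed
  finally show ?thesis by (simp add: mult.commute)
qed

lemma residue_class_subset:
  assumes "p > 0" "P \<le> p * P'"
  shows "{x \<in> {0..<int P}. x mod int p = b} \<subseteq> (\<lambda>z. b + int p * z) ` {0..<int P'}"
proof
  fix x assume x: "x \<in> {x \<in> {0..<int P}. x mod int p = b}"
  have "x < int p * int P'" using x assms(2) by (simp flip: of_nat_mult)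
  then have "x div int p < int P'" using assms(1) by (intro div_less_of_less_mult) auto
  moreover have "0 \<le> x div int p" using x assms(1) by (simp add: pos_imp_zdiv_nonneg_iff)
  moreover have "x = b + int p * (x div int p)" using x by auto
  ultimately show "x \<in> (\<lambda>z. b + int p * z) ` {0..<int P'}" by auto
qed

text \<open>After translation by \<open>b\<close> every free variable is divisible by
  \<open>p\<close>, so its contribution to the equation of degree \<open>j\<close> vanishes modulo
  \<open>p ^ j\<close>. The two well spaced parts then satisfy the congruences of Linnik's
  lemma.\<close>

lemma energy_well_spaced_le:
  assumes p: "prime p" "p > m" "P \<le> p ^ m" "m > 0" and P': "P \<le> p * P'"
  shows "energy {1..m} (append_sum power_sum)
      (well_spaced m p P \<times> lists_of k {x \<in> {0..<int P}. x mod int p = b})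
    \<le> P ^ m * (m ^ m * p ^ (\<Sum>j<m. j)) * vinogradov_mean m k P'"
proof -
  let ?W = "well_spaced m p P"
  let ?X = "{x \<in> {0..<int P}. x mod int p = b}"
  let ?sh = "map (\<lambda>x. x - b)"
  let ?V = "SIGMA w':?W. {w \<in> ?W. \<forall>j\<in>{1..m}. [power_sum (?sh w) j = power_sum (?sh w') j] (mod int p ^ j)}"
  \<comment> \<open>In \<open>?V\<close> the part \<open>w'\<close> comes first, because the count
    fixes \<open>w'\<close> and bounds the number of \<open>w\<close>; the swap restores the order
    expected of admissible pairs.\<close>
  let ?U = "prod.swap ` ?V"
  have p0: "p > 0" using p(1) by (simp add: prime_gt_0_nat)
  have finX: "finite ?X" by (rule finite_subset[of _ "{0..<int P}"]) auto
  have "energy {1..m} (append_sum power_sum) (?W \<times> lists_of k ?X) \<le> card ?U * energy {1..m} power_sum (lists_of k ?X)"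
  proof (rule energy_append_sum_le)
    fix w w' xs xs'
    assume w: "w \<in> ?W" "w' \<in> ?W" and xs: "xs \<in> lists_of k ?X" "xs' \<in> lists_of k ?X"
      and eq: "\<forall>j\<in>{1..m}. power_sum w j + power_sum xs j = power_sum w' j + power_sum xs' j"
    have "[power_sum (?sh w) j = power_sum (?sh w') j] (mod int p ^ j)" if j: "j \<in> {1..m}" for j
    proof -
      have shifted: "power_sum (?sh (w @ xs)) j = power_sum (?sh (w' @ xs')) j"
        using eq w xs by (intro power_sum_shift_eq[OF _ _ j]) (auto simp: well_spaced_def lists_of_def)
      have "int p ^ j dvd power_sum (?sh ys) j" if "ys \<in> lists_of k ?X" for ys
      proof -
        have "map (\<lambda>x. int p * x) (map (\<lambda>x. (x - b) div int p) ys) = ?sh ys"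
          using that p0 by (intro map_shift_scale) (auto simp: lists_of_def mod_eq_dvd_iff dest!: subsetD)
        then show ?thesis by (metis dvd_triv_left power_sum_scale)
      qed
      then have "int p ^ j dvd power_sum (?sh xs') j - power_sum (?sh xs) j"
        using xs by (intro dvd_diff) auto
      moreover have "power_sum (?sh w) j - power_sum (?sh w') j = power_sum (?sh xs') j - power_sum (?sh xs) j"
        using shifted by simp
      ultimately show ?thesis by (simp only: cong_iff_dvd_diff)
    qed
    then show "(w, w') \<in> ?U" using w by (auto simp: image_iff)
  qed (use finX in auto)
  also have "card ?U \<le> card ?V" by (rule card_image_le) auto
  also have "card ?V = (\<Sum>w'\<in>?W. card {w \<in> ?W. \<forall>j\<in>{1..m}. [power_sum (?sh w) j = power_sum (?sh w') j] (mod int p ^ j)})"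
    by (intro card_SigmaI) auto
  also have "\<dots> \<le> (\<Sum>w'\<in>?W. m ^ m * p ^ (\<Sum>j<m. j))"
    by (intro sum_mono card_well_spaced_cong_le p)
  also have "\<dots> \<le> P ^ m * (m ^ m * p ^ (\<Sum>j<m. j))"
    using card_well_spaced_le[of m p P] by (simp only: sum_constant) (auto intro!: mult_right_mono)
  also have "energy {1..m} power_sum (lists_of k ?X) \<le> vinogradov_mean m k P'"
    using p0 residue_class_subset[OF p0 P'] by (intro energy_progression_le[where c = "int p" and b = b]) auto
  finally show ?thesis by simp
qed

section \<open>Splitting tuples by positions\<close>

lemma power_sum_nths:
  "power_sum xs j = power_sum (nths xs A) j + power_sum (nths xs (- A)) j"
proof (induction xs arbitrary: A)
  case (Cons x xs)
  have "{i. Suc i \<in> - A} = - {i. Suc i \<in> A}" by auto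
  then show ?case using Cons[of "{i. Suc i \<in> A}"] by (simp add: nths_Cons)
qed simp

lemma length_nths_compl: "length (nths xs A) + length (nths xs (- A)) = length xs"
proof (induction xs arbitrary: A)
  case (Cons x xs)
  have "{i. Suc i \<in> - A} = - {i. Suc i \<in> A}" by auto
  then show ?case using Cons[of "{i. Suc i \<in> A}"] by (simp add: nths_Cons)
qed simp

lemma nths_compl_inj:
  assumes "length xs = length ys" "nths xs A = nths ys A" "nths xs (- A) = nths ys (- A)"
  shows "xs = ys"
  using assms
proof (induction xs ys arbitrary: A rule: list_induct2)
  case (Cons x xs y ys)
  have *: "{i. Suc i \<notin> A} = - {i. Suc i \<in> A}" by auto
  show ?case using Cons.prems Cons.IH[of "{i. Suc i \<in> A}"]
    by (cases "0 \<in> A") (auto simp: nths_Cons *)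
qed simp

text \<open>Recording the chosen entries by their positions \<open>A\<close> keeps the splitting
  reversible, and leaves only \<open>2 ^ length xs\<close> patterns to sum over.\<close>

lemma exists_distinct_nths:
  assumes "m \<le> card (f ` set xs)"
  shows "\<exists>A\<subseteq>{..<length xs}. length (nths xs A) = m \<and> distinct (map f (nths xs A))"
  using assms
proof (induction xs arbitrary: m)
  case (Cons x xs)
  have Suc_shift: "{i. Suc i \<in> Suc ` A} = A" "{i. Suc i \<in> insert 0 (Suc ` A)} = A" for A by auto
  show ?case
  proof (cases "m \<le> card (f ` set xs)")
    case True
    from Cons.IH[OF True] obtain A where
      "A \<subseteq> {..<length xs}" "length (nths xs A) = m" "distinct (map f (nths xs A))" by blast
    then show ?thesis by (intro exI[of _ "Suc ` A"]) (auto simp: nths_Cons Suc_shift)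
  next
    case False
    then have new: "f x \<notin> f ` set xs" using Cons.prems by (auto simp: insert_absorb)
    then have "card (f ` set (x # xs)) = Suc (card (f ` set xs))" by simp
    then obtain l where l: "m = Suc l" "l \<le> card (f ` set xs)"
      using Cons.prems False by (cases m) auto
    from Cons.IH[OF l(2)] obtain A where
      "A \<subseteq> {..<length xs}" "length (nths xs A) = l" "distinct (map f (nths xs A))" by blast
    moreover have "f x \<notin> f ` set (nths xs A)" using new set_nths_subset[of xs A] by auto
    ultimately show ?thesis using l(1)
      by (intro exI[of _ "insert 0 (Suc ` A)"]) (auto simp: nths_Cons Suc_shift)
  qed
qed auto

text \<open>Padding by repetition lets lists of one fixed length represent all small sets of
  residues, which makes their number a plain power.\<close>

lemma exists_list_of_superset:
  assumes "finite A" "A \<noteq> {}" "card A \<le> n" "A \<subseteq> B"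
  shows "\<exists>as\<in>lists_of n B. set as = A"
proof -
  obtain xs where xs: "set xs = A" "distinct xs" using finite_distinct_list[OF assms(1)] by blast
  obtain a where a: "a \<in> A" using assms(2) by blast
  have "length xs \<le> n" using xs assms(3) distinct_card[of xs] by simp
  then show ?thesis using xs a assms(4)
    by (intro bexI[of _ "xs @ replicate (n - length xs) a"]) (auto simp: lists_of_def)
qed

text \<open>The first \<open>n\<close> variables on each side are chosen freely, in
  \<open>P ^ (2 * n)\<close> ways; the others solve an inhomogeneous system.\<close>

lemma vinogradov_mean_add_le: "vinogradov_mean m (n + k) P \<le> P ^ (2 * n) * vinogradov_mean m k P"
proof -
  let ?X = "{0..<int P}"
  have "vinogradov_mean m (n + k) P \<le> energy {1..m} (append_sum power_sum) (lists_of n ?X \<times> lists_of k ?X)"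
    unfolding vinogradov_mean_def
  proof (rule energy_image_le[where g = "\<lambda>xs. (take n xs, drop n xs)"])
    show "inj_on (\<lambda>xs. (take n xs, drop n xs)) (lists_of (n + k) ?X)"
      by (rule inj_onI) (metis append_take_drop_id prod.inject)
    show "(\<lambda>xs. (take n xs, drop n xs)) ` lists_of (n + k) ?X \<subseteq> lists_of n ?X \<times> lists_of k ?X"
      by (auto simp: lists_of_def dest: in_set_takeD in_set_dropD)
    fix xs ys j
    show "append_sum power_sum (take n xs, drop n xs) j = append_sum power_sum (take n ys, drop n ys) j"
      if "\<forall>j\<in>{1..m}. power_sum xs j = power_sum ys j" "j \<in> {1..m}"
      using that by (simp add: append_sum_def flip: power_sum_append)
  qed (auto intro: finite_lists_of)
  also have "\<dots> \<le> card (lists_of n ?X \<times> lists_of n ?X) * energy {1..m} power_sum (lists_of k ?X)"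
    by (intro energy_append_sum_le) (auto intro: finite_lists_of)
  also have "\<dots> = P ^ (2 * n) * vinogradov_mean m k P"
    by (simp add: card_cartesian_product card_lists_of vinogradov_mean_def mult_2 power_add)
  finally show ?thesis .
qed

text \<open>The factor \<open>(2 ^ (m + k)) ^ 2\<close> pays for the positions of the
  \<open>m\<close> distinct residues, \<open>p ^ (2 * k)\<close> for forcing all free variables into
  one residue class by \<open>energy_holder\<close>.\<close>

lemma energy_distinct_residues_le:
  assumes p: "prime p" "p > m" "P \<le> p ^ m" "m > 0" and P': "P \<le> p * P'" and "k > 0"
  shows "energy {1..m} power_sum {xs \<in> lists_of (m + k) {0..<int P}. m \<le> card ((\<lambda>x. x mod int p) ` set xs)}
    \<le> (2 ^ (m + k))\<^sup>2 * (p ^ (2 * k) * (P ^ m * (m ^ m * p ^ (\<Sum>j<m. j)) * vinogradov_mean m k P'))"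
proof -
  let ?X = "{0..<int P}"
  let ?T = "\<lambda>A. {xs \<in> lists_of (m + k) ?X. nths xs A \<in> well_spaced m p P}"
  let ?E = "P ^ m * (m ^ m * p ^ (\<Sum>j<m. j)) * vinogradov_mean m k P'"
  let ?F = "append_sum power_sum :: int list \<times> int list \<Rightarrow> nat \<Rightarrow> int"
  have p0: "p > 0" using p(1) by (simp add: prime_gt_0_nat)
  have "energy {1..m} power_sum {xs \<in> lists_of (m + k) ?X. m \<le> card ((\<lambda>x. x mod int p) ` set xs)}
    \<le> (card (Pow {..<m + k}))\<^sup>2 * (p ^ (2 * k) * ?E)"
  proof (rule energy_Union_le)
    show "{xs \<in> lists_of (m + k) ?X. m \<le> card ((\<lambda>x. x mod int p) ` set xs)} \<subseteq> (\<Union>A\<in>Pow {..<m + k}. ?T A)"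
    proof
      fix xs assume xs: "xs \<in> {xs \<in> lists_of (m + k) ?X. m \<le> card ((\<lambda>x. x mod int p) ` set xs)}"
      then obtain A where A: "A \<subseteq> {..<length xs}" "length (nths xs A) = m" "distinct (map (\<lambda>x. x mod int p) (nths xs A))"
        using exists_distinct_nths[of m "\<lambda>x. x mod int p" xs] by auto
      then have "xs \<in> ?T A" using xs set_nths_subset[of xs A] by (auto simp: well_spaced_def lists_of_def)
      moreover have "A \<in> Pow {..<m + k}" using A xs by (auto simp: lists_of_def)
      ultimately show "xs \<in> (\<Union>A\<in>Pow {..<m + k}. ?T A)" by blast
    qed
    fix A assume "A \<in> Pow {..<m + k}"
    show "finite (?T A)" by (rule finite_subset[of _ "lists_of (m + k) ?X"]) (auto intro: finite_lists_of)
    have "energy {1..m} power_sum (?T A) \<le> energy {1..m} ?F (well_spaced m p P \<times> lists_of k ?X)"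
    proof (rule energy_image_le[where g = "\<lambda>xs. (nths xs A, nths xs (- A))"])
      show "inj_on (\<lambda>xs. (nths xs A, nths xs (- A))) (?T A)"
        by (rule inj_onI) (auto simp: lists_of_def intro: nths_compl_inj[of _ _ A])
      show "(\<lambda>xs. (nths xs A, nths xs (- A))) ` ?T A \<subseteq> well_spaced m p P \<times> lists_of k ?X"
      proof (rule image_subsetI)
        fix xs assume "xs \<in> ?T A"
        then have xs: "xs \<in> lists_of (m + k) ?X" "nths xs A \<in> well_spaced m p P" by auto
        then have "length (nths xs (- A)) = k"
          using length_nths_compl[of xs A] by (simp add: lists_of_def well_spaced_def)
        then show "(nths xs A, nths xs (- A)) \<in> well_spaced m p P \<times> lists_of k ?X"
          using xs set_nths_subset[of xs "- A"] by (auto simp: lists_of_def)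
      qed
      fix xs ys j
      show "?F (nths xs A, nths xs (- A)) j = ?F (nths ys A, nths ys (- A)) j"
        if "\<forall>j\<in>{1..m}. power_sum xs j = power_sum ys j" "j \<in> {1..m}"
        using that by (simp add: append_sum_def flip: power_sum_nths)
    qed (auto intro: finite_lists_of)
    also have "\<dots> = energy {1..m} ?F (well_spaced m p P \<times> lists_of k (\<Union>b\<in>{0..<int p}. {x \<in> ?X. x mod int p = b}))"
      by (rule arg_cong[where f = "\<lambda>X. energy {1..m} ?F (well_spaced m p P \<times> lists_of k X)"]) (use p0 in auto)
    also have "\<dots> \<le> card {0..<int p} ^ (2 * k) * ?E"
    proof (rule energy_holder)
      fix b
      show "energy {1..m} ?F (well_spaced m p P \<times> lists_of k {x \<in> ?X. x mod int p = b}) \<le> ?E"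
        by (rule energy_well_spaced_le[OF p P'])
      show "finite {x \<in> ?X. x mod int p = b}" by (rule finite_subset[of _ ?X]) auto
    qed (use \<open>k > 0\<close> in auto)
    finally show "energy {1..m} power_sum (?T A) \<le> p ^ (2 * k) * ?E" by simp
  qed simp
  then show ?thesis by (simp add: card_Pow)
qed

text \<open>The set of residues is chosen in at most \<open>p ^ (m - 1)\<close> ways, squared by the
  union bound. The power mean inequality over fewer than \<open>m\<close> classes then puts all
  variables into one class, where the range shrinks to \<open>P'\<close>.\<close>

lemma energy_few_residues_le:
  assumes "p > 0" "m > 0" and P': "P \<le> p * P'" and "s > 0"
  shows "energy {1..m} power_sum {xs \<in> lists_of s {0..<int P}. card ((\<lambda>x. x mod int p) ` set xs) < m}
    \<le> (p ^ (m - 1))\<^sup>2 * (m ^ (2 * s) * vinogradov_mean m s P')"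
proof -
  let ?X = "{0..<int P}"
  let ?C = "\<lambda>b. {x \<in> ?X. x mod int p = b}"
  let ?T = "\<lambda>as. lists_of s (\<Union>b\<in>set as. ?C b)"
  let ?E = "vinogradov_mean m s P'"
  have finC: "finite (?C b)" for b by (rule finite_subset[of _ ?X]) auto
  have "energy {1..m} power_sum {xs \<in> lists_of s ?X. card ((\<lambda>x. x mod int p) ` set xs) < m}
    \<le> (card (lists_of (m - 1) {0..<int p}))\<^sup>2 * (m ^ (2 * s) * ?E)"
  proof (rule energy_Union_le)
    show "{xs \<in> lists_of s ?X. card ((\<lambda>x. x mod int p) ` set xs) < m} \<subseteq> (\<Union>as\<in>lists_of (m - 1) {0..<int p}. ?T as)"
    proof
      fix xs assume xs: "xs \<in> {xs \<in> lists_of s ?X. card ((\<lambda>x. x mod int p) ` set xs) < m}"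
      let ?A = "(\<lambda>x. x mod int p) ` set xs"
      have "xs \<noteq> []" using xs \<open>s > 0\<close> by (auto simp: lists_of_def)
      then have "\<exists>as\<in>lists_of (m - 1) {0..<int p}. set as = ?A"
        using xs \<open>p > 0\<close> by (intro exists_list_of_superset) auto
      then obtain as where as: "as \<in> lists_of (m - 1) {0..<int p}" "set as = ?A" by blast
      have "xs \<in> ?T as" using xs unfolding as(2) by (fastforce simp: lists_of_def)
      then show "xs \<in> (\<Union>as\<in>lists_of (m - 1) {0..<int p}. ?T as)" using as(1) by blast
    qed
    fix as assume as: "as \<in> lists_of (m - 1) {0..<int p}"
    show "finite (?T as)" using finC by (intro finite_lists_of) auto
    \<comment> \<open>A trivial distinguished part of type \<open>unit\<close> makes
      \<open>energy_holder\<close> applicable although all variables are free here.\<close>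
    let ?F = "append_sum (\<lambda>_ _. 0) :: unit \<times> int list \<Rightarrow> nat \<Rightarrow> int"
    have "energy {1..m} power_sum (?T as) \<le> energy {1..m} ?F ({()} \<times> ?T as)"
      using finC by (intro energy_image_le[where g = "\<lambda>xs. ((), xs)"])
        (auto intro!: finite_lists_of simp: append_sum_def inj_on_def)
    also have "\<dots> \<le> card (set as) ^ (2 * s) * ?E"
    proof (rule energy_holder)
      fix b
      have "energy {1..m} ?F ({()} \<times> lists_of s (?C b)) \<le> energy {1..m} power_sum (lists_of s (?C b))"
        using finC by (intro energy_image_le[where g = snd]) (auto intro!: finite_lists_of simp: append_sum_def inj_on_def)
      also have "\<dots> \<le> ?E"
        using residue_class_subset[OF \<open>p > 0\<close> P'] \<open>p > 0\<close>
        by (intro energy_progression_le[where c = "int p" and b = b]) auto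
      finally show "energy {1..m} ?F ({()} \<times> lists_of s (?C b)) \<le> ?E" .
    qed (use finC \<open>s > 0\<close> in auto)
    also have "card (set as) ^ (2 * s) \<le> m ^ (2 * s)"
      using as card_length[of as] by (intro power_mono) (auto simp: lists_of_def)
    finally show "energy {1..m} power_sum (?T as) \<le> m ^ (2 * s) * ?E" by simp
  qed (auto intro: finite_lists_of)
  then show ?thesis by (simp add: card_lists_of)
qed

lemma sum_lessThan_nat: "2 * (\<Sum>j<m. j) = m * (m - 1 :: nat)"
  by (induction m) (auto simp: algebra_simps)

text \<open>Linnik's step. If m of the variables are distinct modulo p, then they are determined up to order by
  their power sums modulo \<open>p ^ m\<close>; otherwise all variables lie in fewer than m residue classes modulo p, and
  such solutions are negligible because k is at least \<open>m\<^sup>2\<close>.\<close>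

lemma vinogradov_mean_recursion:
  assumes p: "prime p" "P \<le> p ^ m" "p \<le> P" and m: "m \<ge> 3" "m\<^sup>2 \<le> p" "m\<^sup>2 \<le> k"
    and P': "P \<le> p * P'" "p * P' \<le> 2 * P"
  shows "vinogradov_mean m (m + k) P \<le>
    4 * (4 ^ (m + k) * m ^ m * p ^ (2 * k + (\<Sum>j<m. j)) * P ^ m * vinogradov_mean m k P')"
proof -
  let ?J = "vinogradov_mean m k P'"
  let ?X = "{0..<int P}"
  let ?s = "m + k"
  let ?B = "4 ^ ?s * m ^ m * p ^ (2 * k + (\<Sum>j<m. j)) * P ^ m * ?J"
  let ?r = "\<lambda>xs. card ((\<lambda>x. x mod int p) ` set xs)"
  have p0: "p > 0" using p(1) by (simp add: prime_gt_0_nat)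
  have k0: "k > 0" using m(1,3) by (cases k) auto
  have "m < m\<^sup>2" using m(1) by (simp add: power2_eq_square)
  then have pm: "m < p" using m(2) by simp
  have four: "(2 ^ ?s)\<^sup>2 = (4 :: nat) ^ ?s" by (simp add: power2_eq_square flip: power_mult_distrib)
  have 1: "energy {1..m} power_sum {xs \<in> lists_of ?s ?X. m \<le> ?r xs} \<le> ?B"
    using energy_distinct_residues_le[OF p(1) pm p(2) _ P'(1) k0] m(1)
    unfolding four by (simp add: power_add mult_ac)
  have 2: "energy {1..m} power_sum {xs \<in> lists_of ?s ?X. ?r xs < m} \<le> ?B"
  proof -
    have "energy {1..m} power_sum {xs \<in> lists_of ?s ?X. ?r xs < m} \<le> (p ^ (m - 1))\<^sup>2 * (m ^ (2 * ?s) * vinogradov_mean m ?s P')"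
      by (rule energy_few_residues_le) (use p0 m P' in auto)
    also have "\<dots> \<le> (p ^ m)\<^sup>2 * (m ^ (2 * ?s) * (P' ^ (2 * m) * ?J))"
      by (intro mult_mono power_mono vinogradov_mean_add_le power_increasing) (use p0 in auto)
    also have "\<dots> = (m\<^sup>2) ^ ?s * (p * P') ^ (2 * m) * ?J"
      by (simp add: power_mult_distrib power_mult[symmetric] mult.commute mult.left_commute)
    \<comment> \<open>The factor \<open>m ^ (2 * ?s)\<close> is paid for by
      \<open>m\<^sup>2 \<le> p\<close>; below, one of the two factors \<open>P ^ m\<close> is traded
      for \<open>p ^ (m * m)\<close>.\<close>
    also have "\<dots> \<le> p ^ ?s * (2 * P) ^ (2 * m) * ?J"
      by (intro mult_mono power_mono m P') auto
    also have "(2 * P) ^ (2 * m) = 4 ^ m * (P ^ m * P ^ m)"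
      by (simp add: power_mult power_mult_distrib power2_eq_square)
    also have "\<dots> \<le> 4 ^ ?s * m ^ m * (P ^ m * (p ^ m) ^ m)"
    proof (intro mult_mono power_mono p)
      have "(4::nat) ^ m * 1 \<le> 4 ^ ?s * m ^ m"
        using m(1) by (intro mult_mono power_increasing) (auto simp: Suc_le_eq)
      then show "(4::nat) ^ m \<le> 4 ^ ?s * m ^ m" by simp
    qed auto
    also have "p ^ ?s * (4 ^ ?s * m ^ m * (P ^ m * (p ^ m) ^ m)) * ?J = 4 ^ ?s * m ^ m * p ^ (?s + m * m) * P ^ m * ?J"
      by (simp add: power_add power_mult mult_ac)
    also have "\<dots> \<le> ?B"
    proof -
      \<comment> \<open>Equivalent to \<open>m * m + 3 * m \<le> 2 * k\<close>, which follows from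
        \<open>m * m \<le> k\<close> exactly because \<open>m \<ge> 3\<close>. Doubling avoids the
        division in the sum over \<open>j\<close>.\<close>
      have "2 * (?s + m * m) \<le> 2 * (2 * k + (\<Sum>j<m. j))"
      proof -
        define t where "t = m * (m - 1)"
        have "m * m = m + t" using m(1) by (cases m) (auto simp: t_def)
        moreover have "2 * m \<le> t" using m(1) by (simp add: t_def)
        moreover have "2 * (\<Sum>j<m. j) = t" unfolding t_def by (rule sum_lessThan_nat)
        moreover have "m * m \<le> k" using m(3) by (simp add: power2_eq_square)
        ultimately show ?thesis by simp
      qed
      then have "p ^ (?s + m * m) \<le> p ^ (2 * k + (\<Sum>j<m. j))"
        using p0 by (intro power_increasing) auto
      then show ?thesis by simp
    qed
    finally show ?thesis by simp
  qed
  \<comment> \<open>The Boolean index merges the two cases; the factor 4 is the square of their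
    number.\<close>
  have "vinogradov_mean m ?s P \<le> (card {True, False})\<^sup>2 * ?B"
    unfolding vinogradov_mean_def[of m ?s]
    by (rule energy_Union_le[where T = "\<lambda>c. if c then {xs \<in> lists_of ?s ?X. m \<le> ?r xs} else {xs \<in> lists_of ?s ?X. ?r xs < m}"])
       (use 1 2 in \<open>auto intro: finite_subset[OF _ finite_lists_of[of ?X ?s]]\<close>)
  also have "(card {True, False})\<^sup>2 = 4" by (simp add: power2_eq_square)
  finally show ?thesis .
qed

subsection \<open>Primes in intervals\<close>

text \<open>Legendre's formula in Chebyshev's form. The cutoff \<open>N\<close> is free, so that the
  factorials of \<open>2 * n\<close> and \<open>n\<close> can be expanded over a common
  range.\<close>

lemma ln_fact_eq_sum_mangoldt:
  assumes "n \<le> N"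
  shows "ln (fact n) = (\<Sum>d\<in>{1..N}. mangoldt d * real (n div d))"
  using assms
proof (induction n)
  case (Suc n)
  have "ln (fact (Suc n)) = ln (real (Suc n)) + ln (fact n)"
    by (simp only: fact_Suc of_nat_mult) (subst ln_mult; simp)
  also have "ln (real (Suc n)) = (\<Sum>d | d dvd Suc n. mangoldt d)"
    using mangoldt_sum[of "Suc n", where 'a = real] by simp
  also have "\<dots> = (\<Sum>d\<in>{1..N}. if d dvd Suc n then mangoldt d else 0)"
  proof (intro sum.mono_neutral_cong_left ballI)
    show "{d. d dvd Suc n} \<subseteq> {1..N}"
    proof
      fix d assume "d \<in> {d. d dvd Suc n}"
      then have "d dvd Suc n" by simp
      then have "0 < d" "d \<le> Suc n" by (auto intro: Nat.gr0I dest: dvd_imp_le)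
      then show "d \<in> {1..N}" using Suc.prems by simp
    qed
  qed auto
  also have "ln (fact n) = (\<Sum>d\<in>{1..N}. mangoldt d * real (n div d))"
    using Suc by simp
  also have "(\<Sum>d\<in>{1..N}. if d dvd Suc n then mangoldt d else 0) + \<dots>
     = (\<Sum>d\<in>{1..N}. mangoldt d * real (Suc n div d))"
    unfolding sum.distrib[symmetric]
    by (intro sum.cong refl) (auto simp: div_Suc dvd_eq_mod_eq_0 algebra_simps)
  finally show ?case .
qed simp

text \<open>Each power of \<open>p\<close> up to \<open>N\<close> contributes \<open>ln p\<close>,
  and if there are \<open>c\<close> of them then \<open>p ^ c\<close> is at most
  \<open>N\<close>.\<close>

lemma sum_mangoldt_primepow_le:
  assumes "prime p" "N > 0"
  shows "(\<Sum>d | d \<in> {1..N} \<and> primepow d \<and> aprimedivisor d = p. mangoldt d) \<le> ln (real N)"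
proof -
  let ?D = "{d. d \<in> {1..N} \<and> primepow d \<and> aprimedivisor d = p}"
  let ?c = "card ?D"
  have fin: "finite ?D" by (rule finite_subset[of _ "{1..N}"]) auto
  have p1: "p > 1" using assms(1) by (rule prime_gt_1_nat)
  have dec: "d = p ^ multiplicity p d" "multiplicity p d > 0" if "d \<in> ?D" for d
    using that primepow_decompose[of d] by (auto dest: primepow_gt_Suc_0)
  have inj: "inj_on (multiplicity p) ?D"
    by (rule inj_onI) (use dec in metis)
  have "p ^ ?c \<le> N"
  proof (cases "?D = {}")
    case False
    define K where "K = Max (multiplicity p ` ?D)"
    have "K \<in> multiplicity p ` ?D" unfolding K_def using False fin by (intro Max_in) auto
    then obtain d where d: "d \<in> ?D" "K = multiplicity p d" by blast
    have "?c = card (multiplicity p ` ?D)" using inj by (simp add: card_image)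
    also have "\<dots> \<le> card {1..K}"
    proof (rule card_mono)
      show "multiplicity p ` ?D \<subseteq> {1..K}"
        using fin dec(2) unfolding K_def by (fastforce simp: Suc_le_eq)
    qed simp
    finally have "?c \<le> K" by simp
    then have "p ^ ?c \<le> p ^ K" using p1 by (intro power_increasing) auto
    also have "\<dots> = d" using dec(1)[OF d(1)] d(2) by simp
    also have "\<dots> \<le> N" using d(1) by simp
    finally show ?thesis .
  next
    case True
    show ?thesis unfolding True using assms(2) by simp
  qed
  have "(\<Sum>d\<in>?D. mangoldt d) = (\<Sum>d\<in>?D. ln (real p))"
    by (intro sum.cong) (auto simp: mangoldt_def)
  also have "\<dots> = ln (real (p ^ ?c))" using p1 by (simp add: ln_realpow)
  also have "\<dots> \<le> ln (real N)"
    using \<open>p ^ ?c \<le> N\<close> p1 assms(2) by (subst ln_le_cancel_iff) (auto simp flip: of_nat_power)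
  finally show ?thesis .
qed

text \<open>Chebyshev's argument on the central binomial coefficient: in its logarithm each von
  Mangoldt term has coefficient at most 1, so every prime contributes at most
  \<open>ln (2 * n)\<close>. If no prime exceeds \<open>z\<close>, the total is at most
  \<open>z * ln (2 * n)\<close>, against the lower bound \<open>4 ^ n / (2 * n)\<close>.\<close>

lemma exists_prime_between:
  fixes n z :: nat
  assumes "n > 0" and big: "2 * real n * (2 * real n) ^ z < 4 ^ n"
  shows "\<exists>p. prime p \<and> z < p \<and> p \<le> 2 * n"
proof (rule ccontr)
  assume no: "\<not> ?thesis"
  let ?N = "2 * n"
  let ?D = "{d \<in> {1..?N}. primepow d}"
  let ?T = "{p \<in> {1..z}. prime p}"
  have "ln (4 ^ n / (2 * real n)) \<le> ln (real (?N choose n))"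
    using assms(1) by (subst ln_le_cancel_iff) (auto intro!: central_binomial_lower_bound divide_pos_pos)
  also have "real (?N choose n) = fact ?N / (fact n * fact n)"
    by (simp add: binomial_fact mult_2)
  also have "ln (fact ?N / (fact n * fact n) :: real) = ln (fact ?N) - 2 * ln (fact n)"
    by (simp add: ln_div ln_mult)
  also have "\<dots> = (\<Sum>d\<in>{1..?N}. mangoldt d * (real (?N div d) - 2 * real (n div d)))"
    using ln_fact_eq_sum_mangoldt[of ?N ?N] ln_fact_eq_sum_mangoldt[of n ?N]
    by (simp add: sum_distrib_left sum_subtractf algebra_simps)
  also have "\<dots> \<le> (\<Sum>d\<in>{1..?N}. mangoldt d)"
  proof (intro sum_mono)
    fix d assume "d \<in> {1..?N}"
    then have "n mod d < d" by simp
    moreover have "n = d * (n div d) + n mod d" by simp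
    ultimately have "?N < 2 * (d * (n div d)) + 2 * d" by linarith
    then have "?N < (2 * (n div d) + 2) * d" by (simp add: algebra_simps)
    then have "?N div d < 2 * (n div d) + 2" by (rule less_mult_imp_div_less)
    then have "?N div d \<le> 2 * (n div d) + 1" by simp
    then have "real (?N div d) \<le> real (2 * (n div d) + 1)" by (simp only: of_nat_le_iff)
    then have "real (?N div d) - 2 * real (n div d) \<le> 1" by simp
    then show "mangoldt d * (real (?N div d) - 2 * real (n div d)) \<le> mangoldt d"
      using mult_left_mono[of _ 1 "mangoldt d :: real"] mangoldt_nonneg[of d] by simp
  qed
  also have "\<dots> = (\<Sum>d\<in>?D. mangoldt d)"
    by (intro sum.mono_neutral_right) (auto simp: mangoldt_def)
  also have "\<dots> = (\<Sum>p\<in>?T. \<Sum>d | d \<in> ?D \<and> aprimedivisor d = p. mangoldt d)"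
  proof (rule sum.group[symmetric])
    show "aprimedivisor ` ?D \<subseteq> ?T"
    proof (rule image_subsetI)
      fix d assume d: "d \<in> ?D"
      then have d1: "d > 1" using primepow_gt_Suc_0[of d] by simp
      then have pr: "prime (aprimedivisor d)" by (intro prime_aprimedivisor') auto
      have "aprimedivisor d \<le> ?N" using d d1 aprimedivisor_le_nat[of d] by simp
      then have "aprimedivisor d \<le> z" using no pr by (auto simp: not_less)
      then show "aprimedivisor d \<in> ?T" using pr by (auto simp: Suc_le_eq prime_gt_0_nat)
    qed
  qed auto
  also have "\<dots> \<le> (\<Sum>p\<in>?T. ln (real ?N))"
    using assms(1) sum_mangoldt_primepow_le[of _ ?N] by (intro sum_mono) (simp add: conj_assoc)
  also have "\<dots> \<le> real z * ln (real ?N)"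
  proof -
    have "card ?T \<le> card {1..z}" by (intro card_mono) auto
    then show ?thesis using assms(1) by (simp add: mult_right_mono)
  qed
  also have "\<dots> = ln ((2 * real n) ^ z)" using assms(1) by (subst ln_realpow) auto
  finally have "4 ^ n / (2 * real n) \<le> (2 * real n) ^ z"
    using assms(1) by (subst (asm) ln_le_cancel_iff) auto
  then show False using big assms(1) by (simp add: field_simps)
qed

subsection \<open>The mean value theorem\<close>

text \<open>Linnik's step needs a prime just above the \<open>m\<close>-th root of \<open>P\<close>.
  Chebyshev's argument finds one up to a factor \<open>4 * l\<close>, with \<open>l\<close>
  logarithmic in \<open>Pmax\<close>; a fixed \<open>Pmax\<close> keeps \<open>l\<close> the same
  along the whole iteration. The lower bounds on \<open>P\<close> yield
  \<open>m\<^sup>2 \<le> p\<close> and \<open>p \<le> P\<close>.\<close>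

lemma exists_prime_root:
  fixes P m l Pmax :: nat
  assumes m: "m \<ge> 2" and P: "1 \<le> P" "P \<le> Pmax" "m ^ (2 * m) \<le> P" "16 * l\<^sup>2 \<le> P"
    and l: "l \<ge> 1" "2 * Pmax * l < 2 ^ l"
  shows "\<exists>p. prime p \<and> P \<le> p ^ m \<and> p \<le> P \<and> m\<^sup>2 \<le> p \<and> real p \<le> 4 * real l * real P powr (1 / m)"
proof -
  define r where "r = real P powr (1 / m)"
  define z where "z = nat \<lceil>r\<rceil>"
  have rm: "r ^ m = real P" using m P(1) by (simp add: r_def powr_powr flip: powr_realpow)
  have r1: "r \<ge> 1" using P(1) by (simp add: r_def ge_one_powr_ge_zero)
  have rz: "r \<le> real z" unfolding z_def by (rule real_nat_ceiling_ge)
  have z2: "real z \<le> 2 * r" unfolding z_def using r1 ceiling_correct[of r] by simp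
  have z1: "z \<ge> 1" using rz r1 by linarith
  have "r \<le> real P" using P(1) m powr_mono[of "1 / m" 1 "real P"] by (simp add: r_def)
  then have zP: "z \<le> Pmax" using P(2) unfolding z_def by (simp add: ceiling_le_iff nat_le_iff)
  \<comment> \<open>With this \<open>n\<close> one has \<open>2 * n < 2 ^ l\<close>, hence \<open>(2
    * n) ^ (z + 1) < 2 ^ (l * (z + 1)) \<le> 2 ^ (2 * z * l) = 4 ^ n\<close>.\<close>
  define n where "n = z * l"
  have n0: "n > 0" using z1 l by (simp add: n_def)
  have "2 * n < 2 ^ l"
  proof -
    have "2 * n \<le> 2 * Pmax * l" using zP by (simp add: n_def)
    then show ?thesis using l(2) by linarith
  qed
  then have "(2 * n) ^ Suc z < (2 ^ l) ^ Suc z" by (intro power_strict_mono) auto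
  also have "(2 ^ l) ^ Suc z \<le> ((2 :: nat) ^ l) ^ (2 * z)" using z1 by (intro power_increasing) auto
  also have "\<dots> = (2\<^sup>2) ^ n" unfolding n_def power_mult[symmetric] by (simp add: mult_ac)
  also have "(2\<^sup>2 :: nat) = 4" by simp
  finally have "real ((2 * n) ^ Suc z) < real (4 ^ n)" by (simp only: of_nat_less_iff)
  then have "2 * real n * (2 * real n) ^ z < 4 ^ n" by simp
  from exists_prime_between[OF n0 this] obtain p where p: "prime p" "z < p" "p \<le> 2 * n" by blast
  have pr: "r \<le> real p" using rz p(2) by linarith
  have "real P \<le> real p ^ m" unfolding rm[symmetric] using r1 pr by (intro power_mono) auto
  then have A: "P \<le> p ^ m" by (simp flip: of_nat_power)
  have "real p \<le> real (2 * n)" using p(3) by (simp only: of_nat_le_iff)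
  also have "\<dots> = 2 * real l * real z" by (simp add: n_def)
  also have "\<dots> \<le> 2 * real l * (2 * r)" using z2 by (intro mult_left_mono) auto
  finally have B: "real p \<le> 4 * real l * r" by simp
  have C: "m\<^sup>2 \<le> p"
  proof -
    have "real (m\<^sup>2) ^ m \<le> r ^ m" using P(3) unfolding rm by (simp add: power_mult flip: of_nat_power)
    then have "real (m\<^sup>2) \<le> r" using m r1 by (subst (asm) power_mono_iff) auto
    then have "real (m\<^sup>2) \<le> real p" using pr by linarith
    then show ?thesis by (simp only: of_nat_le_iff)
  qed
  have D: "p \<le> P"
  proof -
    have "(4 * real l)\<^sup>2 \<le> real P" using P(4) by (simp add: power_mult_distrib flip: of_nat_power)
    then have "4 * real l \<le> sqrt (real P)" by (rule real_le_rsqrt)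
    moreover have "r \<le> sqrt (real P)"
      using P(1) m by (simp add: r_def powr_half_sqrt[symmetric] powr_mono)
    ultimately have "4 * real l * r \<le> sqrt (real P) * sqrt (real P)" using r1 by (intro mult_mono) auto
    then have "real p \<le> real P" using B by simp
    then show ?thesis by simp
  qed
  show ?thesis using p(1) A B C D unfolding r_def by blast
qed

lemma vinogradov_mean_trivial: "vinogradov_mean m k P \<le> P ^ (2 * k)"
proof -
  have "vinogradov_mean m k P \<le> card (lists_of k {0..<int P} \<times> lists_of k {0..<int P})"
    unfolding vinogradov_mean_def energy_def by (intro card_mono) (auto intro: finite_lists_of)
  also have "\<dots> = P ^ (2 * k)" by (simp add: card_cartesian_product card_lists_of mult_2 power_add)
  finally show ?thesis .
qed

text \<open>Inserting the hypothesis at \<open>P'\<close>, about \<open>P / p\<close>, into Linnik's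
  recursion leaves \<open>P ^ (m + 2 * k - E) * p ^ (m * (m - 1) / 2 + E)\<close>. Replacing
  \<open>p\<close> by \<open>P powr (1 / m)\<close> turns \<open>E\<close> into
  \<open>(m + 1) / 2 + E * (1 - 1 / m)\<close>, an affine map with fixed point
  \<open>m * (m + 1) / 2\<close>.\<close>

lemma vinogradov_mean_step:
  fixes E :: real
  assumes m: "m \<ge> 3" and P: "1 \<le> P" "P \<le> Pmax" "m ^ (2 * m) \<le> P" "16 * l\<^sup>2 \<le> P"
    and l: "l \<ge> 1" "2 * Pmax * l < 2 ^ l" and k: "m\<^sup>2 \<le> k" and E: "0 \<le> E" "E \<le> m * (m + 1) / 2"
    and IH: "\<And>Q. 1 \<le> Q \<Longrightarrow> Q \<le> Pmax \<Longrightarrow> real (vinogradov_mean m k Q) \<le> C * real Q powr (2 * real k - E)"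
    and C: "C \<ge> 0"
  shows "real (vinogradov_mean m (m + k) P) \<le> 4 * 16 ^ (m + k) * real m ^ m * (4 * real l) ^ m\<^sup>2 * C *
     real P powr (2 * real (m + k) - ((real m + 1) / 2 + E * (1 - 1 / m)))"
proof -
  obtain p where p: "prime p" "P \<le> p ^ m" "p \<le> P" "m\<^sup>2 \<le> p" "real p \<le> 4 * real l * real P powr (1 / m)"
    using exists_prime_root[of m P Pmax l] m P l by auto
  have p0: "p > 0" using p(1) by (simp add: prime_gt_0_nat)
  define P' where "P' = (P + p - 1) div p"
  have "p * P' + (P + p - 1) mod p = P + p - 1" unfolding P'_def by simp
  moreover have "(P + p - 1) mod p < p" using p0 by simp
  ultimately have P': "P \<le> p * P'" "p * P' \<le> 2 * P" using p(3) p0 by linarith+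
  have P'1: "1 \<le> P'" using P'(1) P(1) by (cases P') auto
  have "p * P' \<le> p * P"
    using P'(2) prime_ge_2_nat[OF p(1)] by (meson le_trans mult_le_mono1)
  then have P'P: "P' \<le> Pmax" using p0 P(2) by simp
  define s where "s = (\<Sum>j<m. j)"
  have s: "real s = m * (m - 1) / 2"
  proof -
    have "real (2 * s) = real (m * (m - 1))" unfolding s_def by (simp only: sum_lessThan_nat)
    then show ?thesis using m by (simp add: of_nat_diff)
  qed
  have kE: "2 * real k - E \<ge> 0" "2 * real k - E \<le> 2 * real k"
  proof -
    have "real m * (real m + 1) / 2 \<le> 2 * (real m)\<^sup>2" using m by (simp add: power2_eq_square)
    moreover have "(real m)\<^sup>2 \<le> real k" using k by (metis of_nat_le_iff of_nat_power)
    moreover have "E \<le> real m * (real m + 1) / 2" using E(2) by simp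
    ultimately show "2 * real k - E \<ge> 0" by linarith
  qed (use E in auto)
  have R: "real p > 0" "real P > 0" using p0 P by auto
  have "real (vinogradov_mean m (m + k) P)
     \<le> real (4 * (4 ^ (m + k) * m ^ m * p ^ (2 * k + s) * P ^ m * vinogradov_mean m k P'))"
    unfolding of_nat_le_iff s_def
    by (rule vinogradov_mean_recursion) (use p P' m k in auto)
  also have "\<dots> = 4 * 4 ^ (m + k) * real m ^ m * (real p powr (2 * k + s) * real P powr m) * real (vinogradov_mean m k P')"
    using R by (simp add: powr_realpow[symmetric] powr_add)
  also have "\<dots> \<le> 4 * 4 ^ (m + k) * real m ^ m * (real p powr (2 * k + s) * real P powr m) *
      (C * (4 ^ k * (real P powr (2 * real k - E) * real p powr (- (2 * real k - E)))))"
  proof (intro mult_left_mono)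
    have "real (vinogradov_mean m k P') \<le> C * real P' powr (2 * real k - E)" by (rule IH[OF P'1 P'P])
    also have "real P' powr (2 * real k - E) \<le> (2 * (real P / real p)) powr (2 * real k - E)"
    proof (rule powr_mono2)
      have "real p * real P' \<le> 2 * real P" using P'(2) by (metis of_nat_le_iff of_nat_mult of_nat_numeral)
      then show "real P' \<le> 2 * (real P / real p)" using R by (simp add: field_simps)
    qed (use kE in auto)
    also have "\<dots> = 2 powr (2 * real k - E) * (real P powr (2 * real k - E) * real p powr (- (2 * real k - E)))"
      using R unfolding powr_minus_divide by (simp add: powr_mult powr_divide)
    also have "2 powr (2 * real k - E) \<le> (2 :: real) powr (2 * k)" using kE by (intro powr_mono) auto
    also have "\<dots> = 4 ^ k" using powr_realpow[of "2::real" "2 * k"] by (simp add: power_mult)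
    finally show "real (vinogradov_mean m k P') \<le> C * (4 ^ k * (real P powr (2 * real k - E) * real p powr (- (2 * real k - E))))"
      using C by (simp add: mult_left_mono mult_right_mono)
  qed auto
  also have "\<dots> = 4 * (4 ^ (m + k) * 4 ^ k) * real m ^ m * C * real p powr (s + E) * real P powr (real m + 2 * real k - E)"
  proof -
    have "real p powr (s + E) = real p powr (2 * k + s) * real p powr (- (2 * real k - E))"
      by (simp flip: powr_add)
    moreover have "real P powr (real m + 2 * real k - E) = real P powr m * real P powr (2 * real k - E)"
      by (simp add: add_diff_eq flip: powr_add)
    ultimately show ?thesis by (simp add: mult_ac)
  qed
  also have "\<dots> \<le> 4 * (4 ^ (m + k) * 4 ^ (m + k)) * real m ^ m * C * ((4 * real l) ^ m\<^sup>2 * real P powr ((s + E) / m)) * real P powr (real m + 2 * real k - E)"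
  proof (intro mult_mono)
    have "real p powr (s + E) \<le> (4 * real l * real P powr (1 / m)) powr (s + E)"
      using p(5) E by (intro powr_mono2) auto
    also have "\<dots> = (4 * real l) powr (s + E) * real P powr ((s + E) / m)"
      using l R by (simp add: powr_mult powr_powr)
    \<comment> \<open>The loss from the search for a prime is isolated: the exponents
      \<open>m * (m - 1) / 2\<close> and \<open>E \<le> m * (m + 1) / 2\<close> add up to at most
      \<open>m\<^sup>2\<close>.\<close>
    also have "(4 * real l) powr (s + E) \<le> (4 * real l) powr (m\<^sup>2)"
    proof (intro powr_mono)
      have "real s + E \<le> real m * (real m - 1) / 2 + real m * (real m + 1) / 2"
        using E s m by (simp add: of_nat_diff)
      also have "\<dots> = real (m\<^sup>2)" by (simp add: power2_eq_square field_simps)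
      finally show "real s + E \<le> real (m\<^sup>2)" .
    qed (use l in auto)
    also have "\<dots> = (4 * real l) ^ m\<^sup>2" using l by (subst powr_realpow) auto
    finally show "real p powr (s + E) \<le> (4 * real l) ^ m\<^sup>2 * real P powr ((s + E) / m)"
      by (simp add: mult_right_mono)
  qed (use C in auto)
  also have "(4 :: real) ^ (m + k) * 4 ^ (m + k) = 16 ^ (m + k)" by (simp flip: power_mult_distrib)
  also have "4 * 16 ^ (m + k) * real m ^ m * C * ((4 * real l) ^ m\<^sup>2 * real P powr ((s + E) / m)) * real P powr (real m + 2 * real k - E)
     = 4 * 16 ^ (m + k) * real m ^ m * (4 * real l) ^ m\<^sup>2 * C * (real P powr ((s + E) / m) * real P powr (real m + 2 * real k - E))"
    by (simp add: mult_ac)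
  also have "real P powr ((s + E) / m) * real P powr (real m + 2 * real k - E) = real P powr ((s + E) / m + (real m + 2 * real k - E))"
    by (simp flip: powr_add)
  also have "(s + E) / m + (real m + 2 * real k - E) = 2 * (m + k) - ((real m + 1) / 2 + E * (1 - 1 / m))"
    using m unfolding s by (simp add: field_simps of_nat_diff power2_eq_square)
  finally show ?thesis by (simp only: of_nat_mult of_nat_add of_nat_numeral of_nat_1)
qed

text \<open>The solution of the recursion \<open>E (t + 1) = (m + 1) / 2 + E t * (1 - 1 / m)\<close>
  with \<open>E 0 = 0\<close>. It measures how far the exponent of \<open>P\<close> lies below the
  trivial \<open>2 * k\<close> after \<open>t\<close> steps.\<close>

definition deficiency :: "nat \<Rightarrow> nat \<Rightarrow> real" where
  "deficiency m t = m * (m + 1) / 2 * (1 - (1 - 1 / m) ^ t)"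

text \<open>Linnik's step is iterated from the trivial bound at \<open>k = m ^ 2\<close>.
  \<open>A\<close> bounds the cost of every step up to \<open>T\<close>; \<open>D\<close> covers the
  ranges too short for the prime.\<close>

lemma vinogradov_mean_le:
  fixes m l Pmax T t :: nat
  assumes m: "m \<ge> 3" and l: "l \<ge> 1" "2 * Pmax * l < 2 ^ l" and P: "1 \<le> P" "P \<le> Pmax" and t: "t \<le> T"
  defines "A \<equiv> 4 * 16 ^ (m\<^sup>2 + T * m) * real m ^ m * (4 * real l) ^ m\<^sup>2"
    and "D \<equiv> (real m ^ (2 * m) * (16 * (real l)\<^sup>2)) powr (m * (m + 1) / 2)"
  shows "real (vinogradov_mean m (m\<^sup>2 + t * m) P) \<le> D * A ^ t * real P powr (2 * real (m\<^sup>2 + t * m) - deficiency m t)"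
  using t P
proof (induction t arbitrary: P)
  case 0
  have "real (vinogradov_mean m (m\<^sup>2) P) \<le> real (P ^ (2 * m\<^sup>2))"
    using vinogradov_mean_trivial by (simp only: of_nat_le_iff)
  also have "\<dots> = 1 * real P powr (2 * m\<^sup>2)" using 0 by (simp add: powr_realpow[symmetric])
  also have "\<dots> \<le> D * real P powr (2 * m\<^sup>2)"
  proof (rule mult_right_mono)
    have "1 \<le> (real l)\<^sup>2" using l by (intro one_le_power) auto
    then have l2: "1 \<le> 16 * (real l)\<^sup>2" by linarith
    have "1 * 1 \<le> real m ^ (2 * m) * (16 * (real l)\<^sup>2)"
      by (rule mult_mono) (use m l2 in \<open>auto intro: one_le_power\<close>)
    then show "1 \<le> D" unfolding D_def by (intro ge_one_powr_ge_zero) auto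
  qed simp
  finally show ?case by (simp add: deficiency_def)
next
  case (Suc t)
  let ?k = "m\<^sup>2 + t * m"
  let ?E = "deficiency m t"
  have kk: "m\<^sup>2 + Suc t * m = m + ?k" by simp
  have q: "0 \<le> 1 - 1 / real m" "1 - 1 / real m \<le> 1" using m by auto
  have E: "0 \<le> deficiency m n" "deficiency m n \<le> m * (m + 1) / 2" for n
  proof -
    show "0 \<le> deficiency m n"
      using power_le_one[OF q, of n] unfolding deficiency_def by (intro mult_nonneg_nonneg) auto
    have "deficiency m n \<le> real m * (real m + 1) / 2 * 1"
      using zero_le_power[OF q(1), of n] unfolding deficiency_def of_nat_add of_nat_mult of_nat_1
      by (intro mult_left_mono) auto
    then show "deficiency m n \<le> m * (m + 1) / 2" by (simp add: algebra_simps)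
  qed
  then have Et: "?E \<le> real m * (real m + 1) / 2" by (simp add: algebra_simps)
  have ES: "deficiency m (Suc t) = (real m + 1) / 2 + ?E * (1 - 1 / m)"
    using m by (simp add: deficiency_def field_simps)
  have lr: "real l \<ge> 1" "real m \<ge> 3" using l m by auto
  have A1: "A \<ge> 1"
  proof -
    have "1 * 1 * 1 * 1 \<le> A" unfolding A_def
      by (intro mult_mono one_le_power) (use lr in auto)
    then show ?thesis by simp
  qed
  have D0: "D \<ge> 0" unfolding D_def by simp
  show ?case
  proof (cases "m ^ (2 * m) \<le> P \<and> 16 * l\<^sup>2 \<le> P")
    case True
    have "real (vinogradov_mean m (m + ?k) P) \<le> 4 * 16 ^ (m + ?k) * real m ^ m * (4 * real l) ^ m\<^sup>2 * (D * A ^ t) *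
       real P powr (2 * real (m + ?k) - ((real m + 1) / 2 + ?E * (1 - 1 / m)))"
      using True Suc.prems Suc.IH D0 A1 E(1)[of t] Et by (intro vinogradov_mean_step[OF m _ _ _ _ l]) auto
    also have "\<dots> \<le> A * (D * A ^ t) * real P powr (2 * real (m + ?k) - ((real m + 1) / 2 + ?E * (1 - 1 / m)))"
    proof (intro mult_right_mono)
      have "m + ?k \<le> m\<^sup>2 + T * m" using Suc.prems(1) by (simp flip: mult_Suc)
      then show "4 * 16 ^ (m + ?k) * real m ^ m * (4 * real l) ^ m\<^sup>2 \<le> A"
        unfolding A_def by (intro mult_right_mono mult_left_mono power_increasing) auto
    qed (use D0 A1 in auto)
    finally show ?thesis unfolding kk ES by (simp add: mult_ac)
  next
    \<comment> \<open>For such small \<open>P\<close> the trivial bound suffices: the whole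
      deficiency is at most \<open>m * (m + 1) / 2\<close>, and that power of \<open>P\<close> is
      below \<open>D\<close>.\<close>
    case False
    let ?b = "real m ^ (2 * m) * (16 * (real l)\<^sup>2)"
    have "1 \<le> (real l)\<^sup>2" using lr by (intro one_le_power) auto
    then have b1: "1 \<le> 16 * (real l)\<^sup>2" "1 \<le> real m ^ (2 * m)" using lr by (linarith, intro one_le_power) auto
    have "real P \<le> ?b"
    proof (cases "m ^ (2 * m) \<le> P")
      case True
      then have "P \<le> 16 * l\<^sup>2" using False by simp
      then have "real P \<le> 1 * (16 * (real l)\<^sup>2)" by (simp flip: of_nat_power)
      also have "\<dots> \<le> ?b" using b1 by (intro mult_right_mono) auto
      finally show ?thesis .
    next
      case False
      then have "real P \<le> real m ^ (2 * m) * 1" by (simp flip: of_nat_power)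
      also have "\<dots> \<le> ?b" using b1 by (intro mult_left_mono) auto
      finally show ?thesis .
    qed
    then have PD: "real P powr (deficiency m (Suc t)) \<le> D"
    proof -
      have "real P powr (deficiency m (Suc t)) \<le> real P powr (m * (m + 1) / 2)"
        using E(2)[of "Suc t"] Suc.prems by (intro powr_mono) auto
      also have "\<dots> \<le> D" unfolding D_def using \<open>real P \<le> ?b\<close> by (intro powr_mono2) auto
      finally show ?thesis .
    qed
    have "real (vinogradov_mean m (m + ?k) P) \<le> real (P ^ (2 * (m + ?k)))"
      using vinogradov_mean_trivial by (simp only: of_nat_le_iff)
    also have "\<dots> = real P powr (2 * (m + ?k))" using Suc.prems by (simp add: powr_realpow[symmetric])
    also have "\<dots> = real P powr (deficiency m (Suc t)) * real P powr (2 * real (m + ?k) - deficiency m (Suc t))"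
      by (simp flip: powr_add)
    also have "\<dots> \<le> D * real P powr (2 * real (m + ?k) - deficiency m (Suc t))"
      using PD by (intro mult_right_mono) auto
    also have "\<dots> \<le> D * A ^ Suc t * real P powr (2 * real (m + ?k) - deficiency m (Suc t))"
      using D0 one_le_power[OF A1, of "Suc t"] by (intro mult_right_mono) (auto simp: mult_left_le mult_le_cancel_left1 simp del: power_Suc)
    finally show ?thesis unfolding kk by simp
  qed
qed

subsection \<open>Bilinear sums\<close>

lemma power_sum_bounds:
  assumes "xs \<in> lists_of k {0..<int P}"
  shows "0 \<le> power_sum xs j" "power_sum xs j \<le> int k * int P ^ j"
proof -
  have "0 \<le> power_sum xs j \<and> power_sum xs j \<le> int (length xs) * int P ^ j" if "set xs \<subseteq> {0..<int P}" for xs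
    using that
  proof (induction xs)
    case (Cons x xs)
    then have "0 \<le> x ^ j" "x ^ j \<le> int P ^ j" by (auto intro: power_mono)
    then show ?case using Cons by (auto simp: algebra_simps)
  qed simp
  then show "0 \<le> power_sum xs j" "power_sum xs j \<le> int k * int P ^ j"
    using assms by (auto simp: lists_of_def)
qed

definition power_sum_diff :: "nat \<Rightarrow> int list \<times> int list \<Rightarrow> nat \<Rightarrow> int" where
  "power_sum_diff m = (\<lambda>(xs, ys). restrict (\<lambda>j. power_sum xs j - power_sum ys j) {1..m})"

abbreviation list_pairs :: "nat \<Rightarrow> nat \<Rightarrow> (int list \<times> int list) set" where
  "list_pairs k P \<equiv> lists_of k {0..<int P} \<times> lists_of k {0..<int P}"

lemma power_sum_diff_mem:
  assumes "z \<in> list_pairs k P" "\<And>j. j \<in> {1..m} \<Longrightarrow> {- int (k * P ^ j)..int (k * P ^ j)} \<subseteq> \<Lambda> j"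
  shows "power_sum_diff m z \<in> PiE {1..m} \<Lambda>"
proof (intro PiE_I)
  fix j assume j: "j \<in> {1..m}"
  obtain xs ys where z: "z = (xs, ys)" by (cases z)
  have "power_sum_diff m z j \<in> {- int (k * P ^ j)..int (k * P ^ j)}"
    using assms(1) j power_sum_bounds[of xs k P j] power_sum_bounds[of ys k P j]
    by (auto simp: power_sum_diff_def z)
  then show "power_sum_diff m z j \<in> \<Lambda> j" using assms(2)[OF j] by blast
qed (auto simp: power_sum_diff_def split: prod.splits)

lemma card_power_sum_diff_le:
  "card {z \<in> list_pairs k P. power_sum_diff m z = v} \<le> vinogradov_mean m k P"
proof -
  have "card {z \<in> list_pairs k P. power_sum_diff m z = v}
     \<le> card {(x, y). x \<in> lists_of k {0..<int P} \<and> y \<in> lists_of k {0..<int P} \<and> (\<forall>j\<in>{1..m}. power_sum x j - power_sum y j = v j)}"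
    by (intro card_mono) (auto simp: power_sum_diff_def finite_lists_of intro: finite_subset[of _ "list_pairs k P"])
  also have "\<dots> \<le> vinogradov_mean m k P"
    unfolding vinogradov_mean_def by (intro card_shifted_le_energy) (auto intro: finite_lists_of)
  finally show ?thesis .
qed

text \<open>Because \<open>f\<close> is nonnegative, the range of the differences may be enlarged to
  any box. This freedom allows an interval in \<open>\<Lambda> j\<close> whose length fits the
  denominator of the coefficient.\<close>

lemma sum_power_sum_diff_le:
  fixes f :: "(nat \<Rightarrow> int) \<Rightarrow> real"
  assumes "\<And>v. f v \<ge> 0" "\<And>j. j \<in> {1..m} \<Longrightarrow> finite (\<Lambda> j)"
    "\<And>j. j \<in> {1..m} \<Longrightarrow> {- int (k * P ^ j)..int (k * P ^ j)} \<subseteq> \<Lambda> j"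
  shows "(\<Sum>z\<in>list_pairs k P. f (power_sum_diff m z)) \<le> real (vinogradov_mean m k P) * (\<Sum>v\<in>PiE {1..m} \<Lambda>. f v)"
proof -
  have fin: "finite (list_pairs k P)" by (intro finite_cartesian_product finite_lists_of) auto
  have finL: "finite (PiE {1..m} \<Lambda>)" using assms(2) by (intro finite_PiE) auto
  have "(\<Sum>z\<in>list_pairs k P. f (power_sum_diff m z))
     = (\<Sum>v\<in>PiE {1..m} \<Lambda>. \<Sum>z\<in>{z \<in> list_pairs k P. power_sum_diff m z = v}. f (power_sum_diff m z))"
    using fin finL power_sum_diff_mem[OF _ assms(3)] by (intro sum.group[symmetric]) blast+
  also have "\<dots> = (\<Sum>v\<in>PiE {1..m} \<Lambda>. real (card {z \<in> list_pairs k P. power_sum_diff m z = v}) * f v)"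
    by (intro sum.cong refl) (simp add: sum_constant)
  also have "\<dots> \<le> (\<Sum>v\<in>PiE {1..m} \<Lambda>. real (vinogradov_mean m k P) * f v)"
    by (intro sum_mono mult_right_mono) (use card_power_sum_diff_le assms(1) in auto)
  finally show ?thesis by (simp add: sum_distrib_left)
qed

lemma norm_power_sum_char:
  "of_real (norm (\<Sum>x\<in>{0..<int P}. additive_char q (\<Sum>j\<in>{1..m}. c j * x ^ j)) ^ (2 * k)) =
    (\<Sum>z\<in>list_pairs k P. additive_char q (\<Sum>j\<in>{1..m}. c j * power_sum_diff m z j))"
proof -
  let ?S = "\<Sum>x\<in>{0..<int P}. additive_char q (\<Sum>j\<in>{1..m}. c j * x ^ j)"
  have "complex_of_real (norm ?S ^ (2 * k)) = complex_of_real ((norm ?S)\<^sup>2) ^ k"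
    by (simp only: power_mult of_real_power)
  also have "\<dots> = ?S ^ k * cnj (?S ^ k)"
    by (simp only: complex_norm_square power_mult_distrib complex_cnj_power)
  also have "\<dots> = (\<Sum>(xs, ys)\<in>list_pairs k P. additive_char q (\<Sum>j\<in>{1..m}. c j * power_sum xs j) *
      cnj (additive_char q (\<Sum>j\<in>{1..m}. c j * power_sum ys j)))"
    by (subst (1 2) sum_char_lists_of[symmetric]) (simp_all add: sum_product sum.cartesian_product)
  also have "\<dots> = (\<Sum>z\<in>list_pairs k P. additive_char q (\<Sum>j\<in>{1..m}. c j * power_sum_diff m z j))"
    by (intro sum.cong)
       (auto simp: power_sum_diff_def right_diff_distrib sum_subtractf simp flip: additive_char_diff)
  finally show ?thesis .
qed

text \<open>The power mean inequality is applied to the sum over x, and then to the sum over the pairs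
  of lists produced by the inner sum over y; both times the variables are replaced by the
  differences of power sums, each value of which is taken at most \<open>vinogradov_mean\<close> times.\<close>

lemma bilinear_sum_bound:
  fixes C :: "nat \<Rightarrow> int" and P :: nat
  assumes "k > 0" "P > 0"
    and fin: "\<And>j. j \<in> {1..m} \<Longrightarrow> finite (\<Lambda> j)"
    and sub: "\<And>j. j \<in> {1..m} \<Longrightarrow> {- int (k * P ^ j)..int (k * P ^ j)} \<subseteq> \<Lambda> j"
  shows "norm (\<Sum>x\<in>{0..<int P}. \<Sum>y\<in>{0..<int P}. additive_char q (\<Sum>j\<in>{1..m}. C j * x ^ j * y ^ j)) ^ (4 * k\<^sup>2)
    \<le> real P ^ (8 * k\<^sup>2 - 4 * k) * (real (vinogradov_mean m k P))\<^sup>2 *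
       (\<Prod>j\<in>{1..m}. \<Sum>u\<in>{- int (k * P ^ j)..int (k * P ^ j)}. norm (\<Sum>v\<in>\<Lambda> j. additive_char q (C j * v * u)))"
proof -
  let ?X = "{0..<int P}"
  let ?J = "real (vinogradov_mean m k P)"
  let ?Z = "list_pairs k P"
  let ?d = "power_sum_diff m"
  define h where "h v = (\<Sum>x\<in>?X. additive_char q (\<Sum>j\<in>{1..m}. C j * v j * x ^ j))" for v
  define w where "w x = (\<Sum>y\<in>?X. additive_char q (\<Sum>j\<in>{1..m}. C j * x ^ j * y ^ j))" for x
  define W where "W = (\<Sum>x\<in>?X. w x)"
  let ?H = "\<Sum>v\<in>PiE {1..m} \<Lambda>. norm (h v) ^ (2 * k)"
  have finZ: "finite ?Z" by (intro finite_cartesian_product finite_lists_of) auto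
  have cardZ: "real (card ?Z) = real P ^ (2 * k)"
    by (simp add: card_cartesian_product card_lists_of mult_2 power_add)
  have step1: "norm W ^ (2 * k) \<le> real P ^ (2 * k - 1) * (\<Sum>z\<in>?Z. norm (h (?d z)))"
  proof -
    have "norm W ^ (2 * k) \<le> (\<Sum>x\<in>?X. norm (w x)) ^ (2 * k)"
      unfolding W_def by (intro power_mono norm_sum) auto
    also have "\<dots> \<le> real (card ?X) ^ (2 * k - 1) * (\<Sum>x\<in>?X. norm (w x) ^ (2 * k))"
      using assms(1) by (intro sum_power_le_power_mean) auto
    also have "(\<Sum>x\<in>?X. norm (w x) ^ (2 * k)) \<le> (\<Sum>z\<in>?Z. norm (h (?d z)))"
    proof -
      have "complex_of_real (\<Sum>x\<in>?X. norm (w x) ^ (2 * k))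
        = (\<Sum>x\<in>?X. \<Sum>z\<in>?Z. additive_char q (\<Sum>j\<in>{1..m}. C j * x ^ j * ?d z j))"
        unfolding of_real_sum w_def by (intro sum.cong refl norm_power_sum_char)
      also have "\<dots> = (\<Sum>z\<in>?Z. h (?d z))"
        unfolding h_def by (subst sum.swap) (simp add: mult_ac)
      finally have "norm (complex_of_real (\<Sum>x\<in>?X. norm (w x) ^ (2 * k))) \<le> (\<Sum>z\<in>?Z. norm (h (?d z)))"
        by (simp only: norm_sum)
      then show ?thesis by (simp only: norm_of_real)
    qed
    finally show ?thesis by (simp add: mult_left_mono)
  qed
  have step2: "(\<Sum>z\<in>?Z. norm (h (?d z))) ^ (2 * k) \<le> (real P ^ (2 * k)) ^ (2 * k - 1) * (?J * ?H)"
  proof -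
    have "(\<Sum>z\<in>?Z. norm (h (?d z))) ^ (2 * k) \<le> real (card ?Z) ^ (2 * k - 1) * (\<Sum>z\<in>?Z. norm (h (?d z)) ^ (2 * k))"
      using assms(1) finZ by (intro sum_power_le_power_mean) auto
    also have "(\<Sum>z\<in>?Z. norm (h (?d z)) ^ (2 * k)) \<le> ?J * ?H"
      using fin sub by (intro sum_power_sum_diff_le[of "\<lambda>v. norm (h v) ^ (2 * k)"]) auto
    finally show ?thesis unfolding cardZ by (simp add: mult_left_mono)
  qed
  let ?A = "\<lambda>j u. norm (\<Sum>v\<in>\<Lambda> j. additive_char q (C j * v * u))"
  let ?U = "\<lambda>j. {- int (k * P ^ j)..int (k * P ^ j)}"
  \<comment> \<open>Expanding the moment once more makes the phase linear in each \<open>v j\<close>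
    separately, so the sum over the box factors. Only \<open>v\<close> runs through the enlarged
    sets \<open>\<Lambda> j\<close>; \<open>u\<close> keeps its symmetric range.\<close>
  have step3: "?H \<le> ?J * (\<Prod>j\<in>{1..m}. \<Sum>u\<in>?U j. ?A j u)"
  proof -
    have "complex_of_real ?H = (\<Sum>v\<in>PiE {1..m} \<Lambda>. \<Sum>z\<in>?Z. additive_char q (\<Sum>j\<in>{1..m}. C j * v j * ?d z j))"
      unfolding of_real_sum h_def by (intro sum.cong refl norm_power_sum_char)
    also have "\<dots> = (\<Sum>z\<in>?Z. \<Sum>v\<in>PiE {1..m} \<Lambda>. \<Prod>j\<in>{1..m}. additive_char q (C j * v j * ?d z j))"
      by (subst sum.swap) (simp add: additive_char_sum)
    also have "\<dots> = (\<Sum>z\<in>?Z. \<Prod>j\<in>{1..m}. \<Sum>v\<in>\<Lambda> j. additive_char q (C j * v * ?d z j))"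
      using fin by (intro sum.cong refl prod_sum_PiE[symmetric]) auto
    finally have "norm (complex_of_real ?H) \<le> (\<Sum>z\<in>?Z. norm (\<Prod>j\<in>{1..m}. \<Sum>v\<in>\<Lambda> j. additive_char q (C j * v * ?d z j)))"
      by (simp only: norm_sum)
    then have "?H \<le> (\<Sum>z\<in>?Z. norm (\<Prod>j\<in>{1..m}. \<Sum>v\<in>\<Lambda> j. additive_char q (C j * v * ?d z j)))"
      by (simp only: norm_of_real)
    also have "\<dots> = (\<Sum>z\<in>?Z. \<Prod>j\<in>{1..m}. ?A j (?d z j))" by (simp add: prod_norm)
    also have "\<dots> \<le> ?J * (\<Sum>u\<in>PiE {1..m} ?U. \<Prod>j\<in>{1..m}. ?A j (u j))"
      by (intro sum_power_sum_diff_le[of "\<lambda>u. \<Prod>j\<in>{1..m}. ?A j (u j)"]) (auto intro: prod_nonneg)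
    also have "(\<Sum>u\<in>PiE {1..m} ?U. \<Prod>j\<in>{1..m}. ?A j (u j)) = (\<Prod>j\<in>{1..m}. \<Sum>u\<in>?U j. ?A j u)"
      by (intro prod_sum_PiE[symmetric]) auto
    finally show ?thesis .
  qed
  have k1: "k * 1 \<le> k * k" using assms(1) by (intro mult_left_mono) auto
  have "norm W ^ (4 * k\<^sup>2) = (norm W ^ (2 * k)) ^ (2 * k)"
    by (simp add: power2_eq_square flip: power_mult)
  also have "\<dots> \<le> (real P ^ (2 * k - 1) * (\<Sum>z\<in>?Z. norm (h (?d z)))) ^ (2 * k)"
    by (intro power_mono step1) auto
  also have "\<dots> = (real P ^ (2 * k - 1)) ^ (2 * k) * (\<Sum>z\<in>?Z. norm (h (?d z))) ^ (2 * k)"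
    by (simp add: power_mult_distrib)
  also have "\<dots> \<le> (real P ^ (2 * k - 1)) ^ (2 * k) * ((real P ^ (2 * k)) ^ (2 * k - 1) * (?J * (?J * (\<Prod>j\<in>{1..m}. \<Sum>u\<in>?U j. ?A j u))))"
    by (intro mult_left_mono order.trans[OF step2] mult_left_mono step3) auto
  also have "\<dots> = real P ^ ((2 * k - 1) * (2 * k) + 2 * k * (2 * k - 1)) * ?J\<^sup>2 * (\<Prod>j\<in>{1..m}. \<Sum>u\<in>?U j. ?A j u)"
    by (simp only: power_add power_mult power2_eq_square mult.assoc)
  also have "(2 * k - 1) * (2 * k) + 2 * k * (2 * k - 1) = 8 * k\<^sup>2 - 4 * k"
    by (simp add: power2_eq_square algebra_simps diff_mult_distrib)
  finally show ?thesis unfolding W_def w_def .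
qed

section \<open>Double linear sums with a given denominator\<close>

lemma card_multiples_le:
  fixes d :: int and M :: nat
  assumes "d > 0"
  shows "real (card {u \<in> {- int M..int M}. d dvd u}) \<le> 2 * real M / d + 1"
proof -
  let ?A = "{u \<in> {- int M..int M}. d dvd u}"
  let ?w = "int M div d"
  have "card ?A \<le> card {- ?w..?w}"
  proof (rule card_inj_on_le[where f = "\<lambda>u. u div d"])
    show "inj_on (\<lambda>u. u div d) ?A" using assms by (auto intro!: inj_onI elim!: dvdE)
    show "(\<lambda>u. u div d) ` ?A \<subseteq> {- ?w..?w}"
    proof clarify
      fix u assume u: "u \<in> {- int M..int M}" "d dvd u"
      then obtain w where w: "u = d * w" by blast
      have "w \<le> ?w"
        using u assms zdiv_mono1[of u "int M" d] unfolding w by simp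
      moreover have "- w \<le> ?w"
        using u assms zdiv_mono1[of "- u" "int M" d] unfolding w by (simp flip: mult_minus_right)
      ultimately show "u div d \<in> {- ?w..?w}" using assms unfolding w by simp
    qed
  qed simp
  also have "\<dots> = nat (2 * ?w + 1)" by (simp add: algebra_simps)
  finally have "real (card ?A) \<le> real (nat (2 * ?w + 1))" by (simp only: of_nat_le_iff)
  also have "\<dots> = 2 * of_int ?w + 1" using assms by (simp add: pos_imp_zdiv_nonneg_iff)
  also have "of_int ?w \<le> real M / of_int d"
    using real_of_int_div4[of "int M" d] by simp
  finally show ?thesis by simp
qed

text \<open>With \<open>v\<close> running over a multiple of \<open>d\<close> consecutive integers,
  the inner sum is exactly \<open>L\<close> or 0 according to whether \<open>d\<close> divides
  \<open>u\<close>. No estimate for incomplete geometric sums, and hence no logarithm,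
  enters.\<close>

lemma double_char_sum_bound:
  fixes q c :: int and M :: nat
  assumes q: "q > 0" and M: "M \<ge> 1"
  defines "d \<equiv> q div gcd q c"
  shows "\<exists>\<Lambda>. finite \<Lambda> \<and> {- int M..int M} \<subseteq> \<Lambda> \<and>
    (\<Sum>u\<in>{- int M..int M}. norm (\<Sum>v\<in>\<Lambda>. additive_char q (c * v * u))) \<le> (2 * real M + d)\<^sup>2 / d"
proof -
  let ?g = "gcd q c"
  have g: "?g > 0" using q by simp
  have qd: "q = ?g * d" unfolding d_def by simp
  have d0: "d > 0" using q g unfolding d_def by (simp add: pos_imp_zdiv_pos_iff zdvd_imp_le)
  have dvd_iff: "q dvd c * u \<longleftrightarrow> d dvd u" for u
  proof -
    obtain c' where c': "c = ?g * c'" by (metis dvdE gcd_dvd2)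
    have cop: "coprime d c'"
    proof -
      have "gcd (?g * d) (?g * c') = ?g" using qd c' by metis
      then have "?g * gcd d c' = ?g" using g by (simp add: gcd_mult_left abs_mult)
      then show ?thesis using g q by (simp add: coprime_iff_gcd_eq_1)
    qed
    have "q dvd c * u \<longleftrightarrow> ?g * d dvd ?g * (c' * u)" using qd c' by (metis mult.assoc)
    also have "\<dots> \<longleftrightarrow> d dvd c' * u" using q by auto
    also have "\<dots> \<longleftrightarrow> d dvd u" using cop by (simp add: coprime_dvd_mult_right_iff)
    finally show ?thesis .
  qed
  \<comment> \<open>The largest multiple of \<open>d\<close> not exceeding \<open>2 * M + d\<close>;
    it is greater than \<open>2 * M\<close>, so the interval starting at \<open>- M\<close> covers
    \<open>{- M..M}\<close>.\<close>
  define L where "L = nat (d * ((2 * int M + d) div d))"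
  have "0 \<le> (2 * int M + d) div d" using d0 by (simp add: pos_imp_zdiv_nonneg_iff)
  then have L: "int L = d * ((2 * int M + d) div d)" using d0 by (simp add: L_def)
  have mod: "d * ((2 * int M + d) div d) = 2 * int M + d - (2 * int M + d) mod d"
    by (rule minus_mod_eq_mult_div[symmetric])
  have L1: "int L \<ge> 2 * int M + 1"
    unfolding L mod using pos_mod_bound[OF d0, of "2 * int M + d"] by linarith
  have L2: "int L \<le> 2 * int M + d"
    unfolding L mod using pos_mod_sign[OF d0, of "2 * int M + d"] by linarith
  let ?\<Lambda> = "{- int M..<- int M + int L}"
  have inner: "norm (\<Sum>v\<in>?\<Lambda>. additive_char q (c * v * u)) = (if d dvd u then real L else 0)" for u
  proof -
    have "(\<Sum>v\<in>?\<Lambda>. additive_char q (c * v * u)) = (\<Sum>v\<in>?\<Lambda>. additive_char q ((c * u) * v))"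
      by (simp add: mult_ac)
    also have "\<dots> = (if q dvd c * u then of_nat L else 0)"
    proof (rule sum_additive_char_interval[OF q])
      have "q dvd c * int L" unfolding dvd_iff L by simp
      then have "q dvd u * (c * int L)" by (rule dvd_mult)
      then show "q dvd c * u * int L" by (simp add: mult_ac)
    qed
    finally show ?thesis unfolding dvd_iff by simp
  qed
  have "(\<Sum>u\<in>{- int M..int M}. norm (\<Sum>v\<in>?\<Lambda>. additive_char q (c * v * u)))
     = real (card {u \<in> {- int M..int M}. d dvd u}) * real L"
    unfolding inner by (simp add: sum.If_cases Int_def)
  also have "\<dots> \<le> (2 * real M / d + 1) * (2 * real M + d)"
  proof (rule mult_mono)
    have "real_of_int (int L) \<le> real_of_int (2 * int M + d)" using L2 by (simp only: of_int_le_iff)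
    then show "real L \<le> 2 * real M + d" by simp
  qed (use card_multiples_le[OF d0, of M] d0 in auto)
  also have "\<dots> = (2 * real M + d)\<^sup>2 / d" using d0 by (simp add: field_simps power2_eq_square)
  finally show ?thesis using L1 by (intro exI[of _ ?\<Lambda>]) auto
qed

lemma trivial_double_char_sum_bound:
  "(\<Sum>u\<in>{- int M..int M}. norm (\<Sum>v\<in>{- int M..int M}. additive_char q (c * v * u))) \<le> (2 * real M + 1)\<^sup>2"
proof -
  have "(\<Sum>u\<in>{- int M..int M}. norm (\<Sum>v\<in>{- int M..int M}. additive_char q (c * v * u)))
     \<le> (\<Sum>u\<in>{- int M..int M}. \<Sum>v\<in>{- int M..int M}. 1)"
    by (intro sum_mono order.trans[OF norm_sum]) simp
  also have "\<dots> = (2 * real M + 1)\<^sup>2" by (simp add: power2_eq_square)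
  finally show ?thesis .
qed

lemma sum_atLeast1_atMost_nat: "2 * (\<Sum>j\<in>{1..m}. j) = m * (m + 1 :: nat)"
  by (induction m) (auto simp: algebra_simps)

text \<open>Trivially the factor of degree \<open>j\<close> is of size \<open>M ^ 2\<close> with
  \<open>M = k * P ^ j\<close>, while \<open>(2 * M + d) ^ 2 / d\<close> is at most 9 times the
  larger of \<open>M ^ 2 / d\<close> and \<open>d\<close>. A denominator that is neither small nor
  close to \<open>P ^ (2 * j)\<close> thus saves \<open>\<sigma>\<close>; all degrees outside
  \<open>G\<close> are bounded trivially.\<close>

lemma bilinear_sum_saving:
  fixes C :: "nat \<Rightarrow> int" and P :: nat and \<sigma> :: real
  assumes k: "k > 0" and P: "P > 0" and q: "q > 0" and G: "G \<subseteq> {1..m}" and \<sigma>: "\<sigma> > 0"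
    and low: "\<And>j. j \<in> G \<Longrightarrow> 1 / (q div gcd q (C j)) \<le> \<sigma>"
    and high: "\<And>j. j \<in> G \<Longrightarrow> (q div gcd q (C j)) / real P ^ (2 * j) \<le> \<sigma>"
  shows "norm (\<Sum>x\<in>{0..<int P}. \<Sum>y\<in>{0..<int P}. additive_char q (\<Sum>j\<in>{1..m}. C j * x ^ j * y ^ j)) ^ (4 * k\<^sup>2)
    \<le> real P ^ (8 * k\<^sup>2 - 4 * k) * (real (vinogradov_mean m k P))\<^sup>2 *
       ((9 * (real k)\<^sup>2) ^ m * real P ^ (m * (m + 1)) * \<sigma> ^ card G)"
proof -
  let ?M = "\<lambda>j. k * P ^ j"
  let ?U = "\<lambda>j. {- int (?M j)..int (?M j)}"
  have M1: "?M j \<ge> 1" for j using k P by (simp add: Suc_le_eq)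
  have "\<exists>\<Lambda>. finite \<Lambda> \<and> ?U j \<subseteq> \<Lambda> \<and>
     (\<Sum>u\<in>?U j. norm (\<Sum>v\<in>\<Lambda>. additive_char q (C j * v * u))) \<le> 9 * (real (?M j))\<^sup>2 * (if j \<in> G then \<sigma> else 1)" for j
  proof (cases "j \<in> G")
    case True
    let ?d = "q div gcd q (C j)"
    have d0: "?d > 0" using q by (simp add: pos_imp_zdiv_pos_iff zdvd_imp_le)
    have d0r: "real_of_int ?d > 0" using d0 by (simp only: of_int_0_less_iff)
    have "(2 * real (?M j) + ?d)\<^sup>2 / ?d \<le> 9 * (real (?M j))\<^sup>2 * \<sigma>"
    proof (cases "?d \<le> real (?M j)")
      case True
      have "(2 * real (?M j) + ?d)\<^sup>2 / ?d \<le> (3 * real (?M j))\<^sup>2 / ?d"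
        using d0 True by (intro divide_right_mono power_mono) auto
      also have "\<dots> = 9 * (real (?M j))\<^sup>2 * (1 / ?d)" by (simp add: power_mult_distrib)
      also have "\<dots> \<le> 9 * (real (?M j))\<^sup>2 * \<sigma>"
        using low[OF \<open>j \<in> G\<close>] by (intro mult_left_mono) auto
      finally show ?thesis .
    next
      case False
      have "(2 * real (?M j) + ?d)\<^sup>2 / ?d \<le> (3 * real_of_int ?d)\<^sup>2 / ?d"
        using d0r False by (intro divide_right_mono power_mono) linarith+
      also have "\<dots> = 9 * ?d" using d0r by (simp add: power2_eq_square)
      also have "\<dots> \<le> 9 * (\<sigma> * real P ^ (2 * j))"
        using high[OF \<open>j \<in> G\<close>] P by (simp add: divide_le_eq)
      also have "\<dots> \<le> 9 * (\<sigma> * (real (?M j))\<^sup>2)"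
      proof -
        have "1 * real P ^ (2 * j) \<le> (real k)\<^sup>2 * real P ^ (2 * j)"
          using k by (intro mult_right_mono one_le_power) auto
        also have "\<dots> = (real (?M j))\<^sup>2" by (simp add: power_mult_distrib power_even_eq)
        finally show ?thesis using \<sigma> by simp
      qed
      finally show ?thesis by (simp add: mult_ac)
    qed
    then show ?thesis using double_char_sum_bound[OF q M1, of j "C j"] True by fastforce
  next
    case False
    have "(2 * real (?M j) + 1)\<^sup>2 \<le> (3 * real (?M j))\<^sup>2"
      using M1[of j] by (intro power_mono) (simp_all flip: of_nat_mult of_nat_power)
    also have "\<dots> = 9 * (real (?M j))\<^sup>2" by (simp add: power_mult_distrib)
    finally show ?thesis
      using trivial_double_char_sum_bound[where M = "?M j" and q = q and c = "C j"] False
      by (intro exI[of _ "?U j"]) auto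
  qed
  then obtain \<Lambda> where \<Lambda>: "\<And>j. finite (\<Lambda> j)" "\<And>j. ?U j \<subseteq> \<Lambda> j"
    "\<And>j. (\<Sum>u\<in>?U j. norm (\<Sum>v\<in>\<Lambda> j. additive_char q (C j * v * u))) \<le> 9 * (real (?M j))\<^sup>2 * (if j \<in> G then \<sigma> else 1)"
    by metis
  have "norm (\<Sum>x\<in>{0..<int P}. \<Sum>y\<in>{0..<int P}. additive_char q (\<Sum>j\<in>{1..m}. C j * x ^ j * y ^ j)) ^ (4 * k\<^sup>2)
    \<le> real P ^ (8 * k\<^sup>2 - 4 * k) * (real (vinogradov_mean m k P))\<^sup>2 *
       (\<Prod>j\<in>{1..m}. \<Sum>u\<in>?U j. norm (\<Sum>v\<in>\<Lambda> j. additive_char q (C j * v * u)))"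
    by (rule bilinear_sum_bound[OF k P \<Lambda>(1,2)])
  also have "\<dots> \<le> real P ^ (8 * k\<^sup>2 - 4 * k) * (real (vinogradov_mean m k P))\<^sup>2 *
       (\<Prod>j\<in>{1..m}. 9 * (real (?M j))\<^sup>2 * (if j \<in> G then \<sigma> else 1))"
    by (intro mult_left_mono prod_mono conjI \<Lambda>(3) sum_nonneg) auto
  also have "(\<Prod>j\<in>{1..m}. 9 * (real (?M j))\<^sup>2 * (if j \<in> G then \<sigma> else 1))
     = (\<Prod>j\<in>{1..m}. 9 * (real k)\<^sup>2) * (\<Prod>j\<in>{1..m}. real P ^ (2 * j)) * (\<Prod>j\<in>{1..m}. if j \<in> G then \<sigma> else 1)"
    unfolding prod.distrib[symmetric]
    by (intro prod.cong refl) (simp add: power_mult_distrib power_even_eq)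
  also have "(\<Prod>j\<in>{1..m}. 9 * (real k)\<^sup>2) = (9 * (real k)\<^sup>2) ^ m" by simp
  also have "(\<Prod>j\<in>{1..m}. real P ^ (2 * j)) = real P ^ (m * (m + 1))"
    unfolding power_sum[symmetric] sum_distrib_left[symmetric] sum_atLeast1_atMost_nat ..
  also have "(\<Prod>j\<in>{1..m}. if j \<in> G then \<sigma> else 1) = \<sigma> ^ card G"
  proof -
    have "{1..m} \<inter> {j. j \<in> G} = G" using G by auto
    then show ?thesis by (simp add: prod.If_cases)
  qed
  finally show ?thesis .
qed

subsection \<open>Incomplete Kloosterman sums\<close>

text \<open>\<open>D\<close> carries every prime of \<open>q\<close> with its exponent divided by
  \<open>m\<close> and rounded up. Rounding adds at most \<open>m\<close> to each exponent of
  \<open>D ^ m\<close>, that is at most one factor of the kernel to \<open>D\<close>.\<close>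

lemma exists_power_divisor:
  fixes q :: int
  assumes "q > 0" "m > 0"
  shows "\<exists>D > 0. q dvd D ^ m \<and> D ^ m dvd q * squarefree_kernel q ^ m"
proof -
  let ?e = "\<lambda>p. multiplicity p q"
  let ?c = "\<lambda>p. (?e p + m - 1) div m"
  define D where "D = (\<Prod>p\<in>prime_factors q. p ^ ?c p)"
  have qe: "q = (\<Prod>p\<in>prime_factors q. p ^ ?e p)"
    using assms(1) prod_prime_factors[of q] by simp
  have c: "?e p \<le> ?c p * m" "?c p * m \<le> ?e p + m" for p
  proof -
    have "m * ?c p + (?e p + m - 1) mod m = ?e p + m - 1" by simp
    moreover have "(?e p + m - 1) mod m < m" using assms(2) by simp
    ultimately have "?e p \<le> m * ?c p" "m * ?c p \<le> ?e p + m" using assms(2) by linarith+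
    then show "?e p \<le> ?c p * m" "?c p * m \<le> ?e p + m" by (simp_all only: mult.commute)
  qed
  have Dm: "D ^ m = (\<Prod>p\<in>prime_factors q. p ^ (?c p * m))"
    unfolding D_def prod_power_distrib[symmetric] by (simp add: power_mult prod_power_distrib)
  have "0 < p ^ ?c p" if "p \<in> prime_factors q" for p
    using that by (intro zero_less_power prime_gt_0_int) (auto simp: in_prime_factors_iff)
  then have "D > 0" unfolding D_def by (intro prod_pos)
  moreover have "q dvd D ^ m"
  proof -
    have "(\<Prod>p\<in>prime_factors q. p ^ ?e p) dvd D ^ m"
      unfolding Dm by (intro prod_dvd_prod le_imp_power_dvd c)
    then show ?thesis using qe by simp
  qed
  moreover have "D ^ m dvd q * squarefree_kernel q ^ m"
  proof -
    have "(\<Prod>p\<in>prime_factors q. p ^ ?e p) * squarefree_kernel q ^ m = (\<Prod>p\<in>prime_factors q. p ^ (?e p + m))"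
      unfolding squarefree_kernel_def prod_power_distrib[symmetric] by (simp add: power_add prod.distrib prod_power_distrib)
    moreover have "D ^ m dvd (\<Prod>p\<in>prime_factors q. p ^ (?e p + m))"
      unfolding Dm by (intro prod_dvd_prod le_imp_power_dvd c)
    ultimately show ?thesis using qe by simp
  qed
  ultimately show ?thesis by blast
qed

text \<open>Every prime of \<open>q\<close> divides \<open>D\<close>, so a shift by a multiple of
  \<open>D\<close> preserves coprimality to \<open>q\<close>.\<close>

lemma coprime_add_mult_iff:
  fixes q D :: int
  assumes "q dvd D ^ m"
  shows "coprime (n + D * t) q \<longleftrightarrow> coprime n q"
proof -
  have dvd: "p dvd D * t" if "prime p" "p dvd q" for p :: int
    using that assms by (meson dvd_mult2 dvd_trans prime_dvd_power)
  have "coprime x q" if "\<And>p. prime p \<Longrightarrow> p dvd q \<Longrightarrow> \<not> p dvd x" "x \<noteq> 0 \<or> q \<noteq> 0" for x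
  proof (rule ccontr)
    assume "\<not> coprime x q"
    then have "\<not> is_unit (gcd x q)" by (simp add: is_unit_gcd_iff coprime_iff_gcd_eq_1)
    moreover have "gcd x q \<noteq> 0" using that(2) by auto
    ultimately obtain p where "prime p" "p dvd gcd x q" using prime_divisor_exists by blast
    then show False using that(1)[of p] by auto
  qed
  note coprimeI = this
  have not_dvd: "\<not> p dvd x" if "coprime x q" "prime p" "p dvd q" for p x :: int
    using that by (meson coprime_common_divisor not_prime_unit)
  show ?thesis
  proof (cases "q = 0")
    case True
    then have "D = 0" using assms by auto
    then show ?thesis by simp
  next
    case False
    show ?thesis
    proof
      assume c: "coprime (n + D * t) q"
      have "\<not> p dvd n" if "prime p" "p dvd q" for p
        using not_dvd[OF c that] dvd[OF that] by (simp add: dvd_add_left_iff)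
      then show "coprime n q" using False by (intro coprimeI) auto
    next
      assume c: "coprime n q"
      have "\<not> p dvd n + D * t" if "prime p" "p dvd q" for p
        using not_dvd[OF c that] dvd[OF that] by (simp add: dvd_add_left_iff)
      then show "coprime (n + D * t) q" using False by (intro coprimeI) auto
    qed
  qed
qed

text \<open>The geometric series for the inverse of \<open>n (1 + n\<^sup>* D t)\<close> terminates because \<open>q dvd D ^ m\<close>.\<close>

lemma modular_inverse_expansion:
  fixes q D n t :: int
  assumes q: "q > 0" and D: "q dvd D ^ m" and n: "coprime n q"
  defines "r \<equiv> modular_inverse q n"
  shows "[modular_inverse q (n + D * t) = (\<Sum>j\<le>m. (-1) ^ j * r ^ (j + 1) * D ^ j * t ^ j)] (mod q)"
proof -
  let ?S = "\<Sum>j\<le>m. (-1) ^ j * r ^ (j + 1) * D ^ j * t ^ j"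
  let ?u = "r * D * t"
  have r: "[n * r = 1] (mod q)" unfolding r_def using n by (rule cong_modular_inverse1)
  have cop: "coprime (n + D * t) q" using coprime_add_mult_iff[OF D] n by simp
  have S: "?S = r * (\<Sum>j\<le>m. (- ?u) ^ j)"
    unfolding sum_distrib_left by (intro sum.cong refl) (simp add: power_mult_distrib power_minus[of "r * D * t"])
  have geo: "(1 + ?u) * (\<Sum>j\<le>m. (- ?u) ^ j) = 1 - (- ?u) ^ Suc m"
    using sum_gp_basic[of "- ?u" m] by simp
  have "[(n + D * t) * ?S = 1] (mod q)"
  proof -
    have "[(n + D * t) * r = 1 + ?u] (mod q)"
      using cong_add[OF r cong_refl[of ?u q]] by (simp add: algebra_simps)
    then have "[(n + D * t) * r * (\<Sum>j\<le>m. (- ?u) ^ j) = (1 + ?u) * (\<Sum>j\<le>m. (- ?u) ^ j)] (mod q)"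
      by (rule cong_scalar_right)
    then have "[(n + D * t) * ?S = 1 - (- ?u) ^ Suc m] (mod q)" unfolding geo S by (simp add: mult.assoc)
    moreover have "q dvd (- ?u) ^ Suc m"
    proof -
      have "- ?u = D * (- (r * t))" by simp
      then have "(- ?u) ^ Suc m = D ^ Suc m * (- (r * t)) ^ Suc m" by (simp only: power_mult_distrib)
      moreover have "q dvd D ^ Suc m" using D by simp
      ultimately show ?thesis by (simp only: dvd_mult2)
    qed
    then have "[1 - (- ?u) ^ Suc m = 1 - 0] (mod q)"
      by (intro cong_diff) (simp_all add: cong_0_iff)
    ultimately show ?thesis using cong_trans by fastforce
  qed
  moreover have "[(n + D * t) * modular_inverse q (n + D * t) = 1] (mod q)"
    using cop by (rule cong_modular_inverse1)
  ultimately have "[(n + D * t) * modular_inverse q (n + D * t) = (n + D * t) * ?S] (mod q)"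
    using cong_sym cong_trans by blast
  then show ?thesis using cop by (simp add: cong_mult_lcancel)
qed

section \<open>From the Kloosterman sum to bilinear sums\<close>

definition kloosterman_term :: "int \<Rightarrow> int \<Rightarrow> int \<Rightarrow> int \<Rightarrow> complex" where
  "kloosterman_term q a b n = (if coprime n q then additive_char q (a * modular_inverse q n + b * n) else 0)"

lemma norm_kloosterman_term_le: "norm (kloosterman_term q a b n) \<le> 1"
  by (simp add: kloosterman_term_def)

text \<open>Extending the summand by zero removes the coprimality condition from the range, so that
  a shift affects only the ends of an interval.\<close>

lemma incomplete_kloosterman_sum_eq:
  "incomplete_kloosterman_sum q N a b c = (\<Sum>n\<in>{c<..c + N}. kloosterman_term q a b n)"
proof -
  have "(\<Sum>n\<in>{c<..c + N}. kloosterman_term q a b n) =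
     (\<Sum>n | c < n \<and> n \<le> c + N \<and> coprime n q. additive_char q (a * modular_inverse q n + b * n))"
    by (rule sum.mono_neutral_cong_right) (auto simp: kloosterman_term_def)
  then show ?thesis
    unfolding incomplete_kloosterman_sum_def
    by (simp add: additive_char_def cis_conv_exp mult_ac)
qed

text \<open>Each unit shift drops one term and adds one, both of norm at most 1.\<close>

lemma sum_shift_bound:
  fixes f :: "int \<Rightarrow> complex"
  assumes "\<And>n. norm (f n) \<le> 1" "N \<ge> 0"
  shows "norm ((\<Sum>n\<in>{c<..c + N}. f n) - (\<Sum>n\<in>{c<..c + N}. f (n + int h))) \<le> 2 * real h"
proof (induction h)
  case (Suc h)
  let ?T = "\<lambda>h. \<Sum>n\<in>{c<..c + N}. f (n + int h)"
  have shift: "?T h' = (\<Sum>n\<in>{c + int h'<..c + int h' + N}. f n)" for h'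
    by (rule sum.reindex_bij_witness[of _ "\<lambda>n. n - int h'" "\<lambda>n. n + int h'"]) auto
  let ?c = "c + int h"
  have "norm (?T h - ?T (Suc h)) \<le> 2"
  proof (cases "N = 0")
    case False
    then have N: "N \<ge> 1" using assms(2) by simp
    let ?M = "{?c + 1<..?c + N}"
    have "{?c<..?c + N} = insert (?c + 1) ?M" "{?c + 1<..?c + 1 + N} = insert (?c + 1 + N) ?M"
      using N by auto
    then have "?T h = f (?c + 1) + sum f ?M" "?T (Suc h) = f (?c + 1 + N) + sum f ?M"
      unfolding shift by (simp_all add: add.assoc) (simp_all add: add.commute add.left_commute)
    then have "?T h - ?T (Suc h) = f (?c + 1) - f (?c + 1 + N)" by simp
    also have "norm \<dots> \<le> 1 + 1" by (intro norm_triangle_le_diff add_mono assms)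
    finally show ?thesis by simp
  qed simp
  moreover have "norm ((\<Sum>n\<in>{c<..c + N}. f n) - ?T (Suc h)) \<le> norm ((\<Sum>n\<in>{c<..c + N}. f n) - ?T h) + norm (?T h - ?T (Suc h))"
    using norm_triangle_ineq[of "(\<Sum>n\<in>{c<..c + N}. f n) - ?T h" "?T h - ?T (Suc h)"] by simp
  ultimately show ?case using Suc.IH by simp
qed simp

text \<open>The coefficient of \<open>t ^ j\<close> in the phase at \<open>n + D * t\<close>, with
  \<open>r\<close> the inverse of \<open>n\<close>. For \<open>j \<ge> 2\<close> it is
  \<open>D ^ j\<close> times a unit modulo \<open>q\<close>, so its denominator depends neither on
  \<open>n\<close> nor on \<open>a\<close> and \<open>b\<close>.\<close>

definition expansion_coeff :: "int \<Rightarrow> int \<Rightarrow> int \<Rightarrow> int \<Rightarrow> nat \<Rightarrow> int" where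
  "expansion_coeff a b D r j = a * (-1) ^ j * r ^ (j + 1) * D ^ j + (if j = 1 then b * D else 0)"

lemma kloosterman_term_shift:
  assumes q: "q > 0" and D: "q dvd D ^ m" and n: "coprime n q" and m: "m \<ge> 1"
  shows "kloosterman_term q a b (n + D * t) = kloosterman_term q a b n *
    additive_char q (\<Sum>j\<in>{1..m}. expansion_coeff a b D (modular_inverse q n) j * t ^ j)"
proof -
  let ?r = "modular_inverse q n"
  let ?g = "\<lambda>j. (-1) ^ j * ?r ^ (j + 1) * D ^ j * t ^ j"
  have "[a * modular_inverse q (n + D * t) + b * (n + D * t) = a * (\<Sum>j\<le>m. ?g j) + b * (n + D * t)] (mod q)"
    by (intro cong_add cong_mult cong_refl modular_inverse_expansion q D n)
  also have "a * (\<Sum>j\<le>m. ?g j) + b * (n + D * t) = (a * ?r + b * n) +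
     (\<Sum>j\<in>{1..m}. expansion_coeff a b D ?r j * t ^ j)"
  proof -
    have "(\<Sum>j\<le>m. ?g j) = ?r + (\<Sum>j\<in>{1..m}. ?g j)"
    proof -
      have "{..m} = insert 0 {1..m}" by auto
      then show ?thesis by simp
    qed
    moreover have "(\<Sum>j\<in>{1..m}. expansion_coeff a b D ?r j * t ^ j) = a * (\<Sum>j\<in>{1..m}. ?g j) + b * D * t"
    proof -
      have "(\<Sum>j\<in>{1..m}. (if j = 1 then b * D else 0) * t ^ j) = (\<Sum>j\<in>{1..m}. if j = 1 then b * D * t else 0)"
        by (intro sum.cong) auto
      also have "\<dots> = b * D * t" using m by simp
      finally have "(\<Sum>j\<in>{1..m}. (if j = 1 then b * D else 0) * t ^ j) = b * D * t" .
      moreover have "(\<Sum>j\<in>{1..m}. expansion_coeff a b D ?r j * t ^ j) =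
          (\<Sum>j\<in>{1..m}. a * ?g j + (if j = 1 then b * D else 0) * t ^ j)"
        by (intro sum.cong refl) (simp add: expansion_coeff_def algebra_simps)
      ultimately show ?thesis by (simp only: sum.distrib sum_distrib_left)
    qed
    ultimately show ?thesis by (simp add: algebra_simps)
  qed
  finally have "additive_char q (a * modular_inverse q (n + D * t) + b * (n + D * t)) =
     additive_char q (a * ?r + b * n) * additive_char q (\<Sum>j\<in>{1..m}. expansion_coeff a b D ?r j * t ^ j)"
    using q by (simp add: additive_char_cong flip: additive_char_add)
  then show ?thesis
    using n coprime_add_mult_iff[OF D] by (simp add: kloosterman_term_def)
qed

text \<open>The sum is averaged over \<open>P ^ 2\<close> shifts, each changing it by at most
  \<open>2 * D * P ^ 2\<close>. For fixed \<open>n\<close> a term of norm at most 1 factors out,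
  leaving a bilinear sum bounded uniformly in \<open>n\<close>.\<close>

lemma incomplete_kloosterman_sum_le_bilinear:
  fixes P :: nat and B :: real
  assumes q: "q > 0" and D: "q dvd D ^ m" "D > 0" and m: "m \<ge> 1" and P: "P > 0" and N: "N \<ge> 0" and B: "B \<ge> 0"
    and bound: "\<And>n. coprime n q \<Longrightarrow>
      norm (\<Sum>x\<in>{0..<int P}. \<Sum>y\<in>{0..<int P}. additive_char q
        (\<Sum>j\<in>{1..m}. expansion_coeff a b D (modular_inverse q n) j * x ^ j * y ^ j)) \<le> B * (real P)\<^sup>2"
  shows "norm (incomplete_kloosterman_sum q N a b c) \<le> real_of_int N * B + 2 * real_of_int D * (real P)\<^sup>2"
proof -
  let ?X = "{0..<int P}"
  let ?f = "kloosterman_term q a b"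
  let ?I = "{c<..c + N}"
  let ?S = "\<Sum>n\<in>?I. ?f n"
  have card: "real (card (?X \<times> ?X)) = (real P)\<^sup>2" by (simp add: card_cartesian_product power2_eq_square)
  have 1: "norm ((\<Sum>(x, y)\<in>?X \<times> ?X. ?S) - (\<Sum>(x, y)\<in>?X \<times> ?X. \<Sum>n\<in>?I. ?f (n + D * (x * y))))
     \<le> (real P)\<^sup>2 * (2 * real_of_int D * (real P)\<^sup>2)"
  proof -
    have "norm (\<Sum>(x, y)\<in>?X \<times> ?X. ?S - (\<Sum>n\<in>?I. ?f (n + D * (x * y))))
       \<le> (\<Sum>z\<in>?X \<times> ?X. 2 * real_of_int D * (real P)\<^sup>2)"
    proof (rule order.trans[OF norm_sum], intro sum_mono, clarify)
      fix x y assume xy: "x \<in> ?X" "y \<in> ?X"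
      define h where "h = nat (D * (x * y))"
      have h: "int h = D * (x * y)" using xy D(2) by (simp add: h_def)
      have "real h = real_of_int D * (real_of_int x * real_of_int y)"
        by (metis h of_int_mult of_int_of_nat_eq)
      also have "\<dots> \<le> real_of_int D * (real P * real P)"
        using xy D(2) by (intro mult_left_mono mult_mono) auto
      finally have "2 * real h \<le> 2 * real_of_int D * (real P)\<^sup>2" by (simp add: power2_eq_square)
      then show "norm (?S - (\<Sum>n\<in>?I. ?f (n + D * (x * y)))) \<le> 2 * real_of_int D * (real P)\<^sup>2"
        using sum_shift_bound[of ?f N c h] norm_kloosterman_term_le N unfolding h by (meson order.trans)
    qed
    also have "\<dots> = (real P)\<^sup>2 * (2 * real_of_int D * (real P)\<^sup>2)" by (simp only: sum_constant card)
    finally show ?thesis by (simp add: sum_subtractf case_prod_unfold)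
  qed
  have 2: "norm (\<Sum>(x, y)\<in>?X \<times> ?X. \<Sum>n\<in>?I. ?f (n + D * (x * y))) \<le> real_of_int N * (B * (real P)\<^sup>2)"
  proof -
    have "(\<Sum>(x, y)\<in>?X \<times> ?X. \<Sum>n\<in>?I. ?f (n + D * (x * y))) = (\<Sum>n\<in>?I. \<Sum>(x, y)\<in>?X \<times> ?X. ?f (n + D * (x * y)))"
      by (subst sum.swap) (simp add: case_prod_unfold)
    also have "norm \<dots> \<le> (\<Sum>n\<in>?I. B * (real P)\<^sup>2)"
    proof (rule order.trans[OF norm_sum], intro sum_mono)
      fix n
      show "norm (\<Sum>(x, y)\<in>?X \<times> ?X. ?f (n + D * (x * y))) \<le> B * (real P)\<^sup>2"
      proof (cases "coprime n q")
        case True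
        have eq: "(\<Sum>(x, y)\<in>?X \<times> ?X. ?f (n + D * (x * y))) = ?f n * (\<Sum>x\<in>?X. \<Sum>y\<in>?X. additive_char q
           (\<Sum>j\<in>{1..m}. expansion_coeff a b D (modular_inverse q n) j * x ^ j * y ^ j))"
          unfolding sum.cartesian_product sum_distrib_left
          by (intro sum.cong refl) (auto simp: kloosterman_term_shift[OF q D(1) True m] power_mult_distrib mult.assoc)
        show ?thesis unfolding eq
        proof (rule order.trans[OF _ bound[OF True]])
          show "norm (?f n * (\<Sum>x\<in>?X. \<Sum>y\<in>?X. additive_char q
             (\<Sum>j\<in>{1..m}. expansion_coeff a b D (modular_inverse q n) j * x ^ j * y ^ j))) \<le> norm (\<Sum>x\<in>?X. \<Sum>y\<in>?X. additive_char q
           (\<Sum>j\<in>{1..m}. expansion_coeff a b D (modular_inverse q n) j * x ^ j * y ^ j))"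
            unfolding norm_mult by (intro mult_left_le_one_le norm_kloosterman_term_le norm_ge_zero)
        qed
      next
        case False
        then have "?f (n + D * (x * y)) = 0" for x y
          using coprime_add_mult_iff[OF D(1)] by (simp add: kloosterman_term_def)
        then show ?thesis using B by simp
      qed
    qed
    also have "\<dots> = real_of_int N * (B * (real P)\<^sup>2)" using N by simp
    finally show ?thesis .
  qed
  have "(real P)\<^sup>2 * norm ?S = norm (\<Sum>(x, y)\<in>?X \<times> ?X. ?S)"
    using card by (simp add: case_prod_unfold norm_mult power2_eq_square)
  also have "\<dots> \<le> (real P)\<^sup>2 * (2 * real_of_int D * (real P)\<^sup>2) + real_of_int N * (B * (real P)\<^sup>2)"
    using 1 2 norm_triangle_sub[of "\<Sum>(x, y)\<in>?X \<times> ?X. ?S" "\<Sum>(x, y)\<in>?X \<times> ?X. \<Sum>n\<in>?I. ?f (n + D * (x * y))"]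
    by linarith
  also have "\<dots> = (real P)\<^sup>2 * (real_of_int N * B + 2 * real_of_int D * (real P)\<^sup>2)"
    by (simp add: algebra_simps)
  finally show ?thesis
    using P unfolding incomplete_kloosterman_sum_eq by (subst (asm) mult_le_cancel_left_pos) auto
qed

subsection \<open>Choice of parameters\<close>

lemma gcd_expansion_coeff:
  assumes "j \<ge> 2" "coprime a q" "coprime r q"
  shows "gcd q (expansion_coeff a b D r j) = gcd q (D ^ j)"
proof -
  have "coprime q (a * (-1) ^ j * r ^ (j + 1))"
    using assms by (auto simp: coprime_commute)
  then show ?thesis
    using assms(1) by (simp add: expansion_coeff_def gcd_mult_right_left_cancel)
qed

text \<open>The lower bound holds because the gcd is at most \<open>D ^ j\<close>. For the upper
  bound, \<open>q ^ j\<close> divides both \<open>q ^ m\<close> and \<open>D ^ (j * m)\<close>,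
  hence the \<open>m\<close>-th power of the gcd, which is therefore at least
  \<open>q powr (j / m)\<close>.\<close>

lemma ln_gcd_power_bounds:
  fixes q D :: int
  assumes q: "q > 0" and D: "D > 0" "q dvd D ^ m" and j: "j \<le> m" "m > 0"
  defines "d \<equiv> q div gcd q (D ^ j)"
  shows "d > 0" "ln (real_of_int d) \<ge> ln (real_of_int q) - j * ln (real_of_int D)"
    "ln (real_of_int d) \<le> ln (real_of_int q) - j / m * ln (real_of_int q)"
proof -
  let ?g = "gcd q (D ^ j)"
  have g: "?g > 0" using q by simp
  have qd: "q = ?g * d" unfolding d_def by simp
  show d0: "d > 0" using q g unfolding d_def by (simp add: pos_imp_zdiv_pos_iff zdvd_imp_le)
  have "real_of_int q = real_of_int ?g * real_of_int d" using qd by (metis of_int_mult)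
  then have ln: "ln (real_of_int q) = ln (real_of_int ?g) + ln (real_of_int d)"
    using g d0 by (simp add: ln_mult)
  have "real_of_int ?g \<le> real_of_int (D ^ j)"
    using D(1) by (subst of_int_le_iff) (auto intro: zdvd_imp_le)
  then have "ln (real_of_int ?g) \<le> ln (real_of_int D ^ j)"
    using g D(1) zero_less_power[of "real_of_int D" j] by (subst ln_le_cancel_iff) auto
  then show "ln (real_of_int d) \<ge> ln (real_of_int q) - j * ln (real_of_int D)"
    using ln D(1) by (simp add: ln_realpow)
  have "q ^ j dvd ?g ^ m"
  proof -
    have "q ^ j dvd q ^ m" using j by (intro le_imp_power_dvd)
    moreover have "q ^ j dvd (D ^ j) ^ m"
      using D(2) by (metis dvd_power_same mult.commute power_mult)
    ultimately show ?thesis using gcd_exp[of q m "D ^ j"] by (metis gcd_greatest)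
  qed
  then have "real_of_int (q ^ j) \<le> real_of_int (?g ^ m)"
    using g by (subst of_int_le_iff) (intro zdvd_imp_le zero_less_power)
  then have "ln (real_of_int q ^ j) \<le> ln (real_of_int ?g ^ m)"
    using g q by (subst ln_le_cancel_iff) auto
  then have "j * ln (real_of_int q) \<le> m * ln (real_of_int ?g)" using g q by (simp add: ln_realpow)
  then have "j / m * ln (real_of_int q) \<le> ln (real_of_int ?g)" using j(2) by (simp add: field_simps)
  then show "ln (real_of_int d) \<le> ln (real_of_int q) - j / m * ln (real_of_int q)" using ln by simp
qed

section \<open>Numerical form of the mean value bound\<close>

lemma exp_6_ge: "exp (6 :: real) \<ge> 240"
proof -
  have "(5 / 2 :: real) \<le> exp 1" using exp_lower_Taylor_quadratic[of 1] by simp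
  then have "(5 / 2 :: real) ^ 6 \<le> exp 1 ^ 6" by (intro power_mono) auto
  also have "\<dots> = exp (6 :: real)" by (simp flip: exp_of_nat_mult)
  finally show ?thesis by (simp add: power_divide)
qed

text \<open>After \<open>6 * m\<close> steps the relative defect
  \<open>(1 - 1 / m) ^ (6 * m)\<close> is at most \<open>exp (- 6)\<close>, and
  \<open>(5 / 2) ^ 6\<close> exceeds 240.\<close>

lemma deficiency_6_ge:
  assumes "m \<ge> 1"
  shows "m * (m + 1) / 2 * (1 - 1 / 240) \<le> deficiency m (6 * m)"
proof -
  have "(1 - 1 / real m) ^ (6 * m) \<le> exp (- (1 / real m)) ^ (6 * m)"
    using assms exp_ge_add_one_self[of "- (1 / real m)"] by (intro power_mono) auto
  also have "\<dots> = exp (- 6)" using assms by (simp flip: exp_of_nat_mult)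
  also have "\<dots> \<le> 1 / 240" using exp_6_ge by (simp add: exp_minus field_simps)
  finally show ?thesis unfolding deficiency_def by (intro mult_left_mono) auto
qed

text \<open>\<open>7 * m\<^sup>2\<close> is the starting value \<open>m\<^sup>2\<close> plus
  \<open>m\<close> for each of the \<open>6 * m\<close> steps. In the exponent the logarithms of
  \<open>D\<close> and \<open>A ^ (6 * m)\<close> give \<open>m ^ 4\<close> and
  \<open>m ^ 3 * ln l\<close>, up to constants.\<close>

lemma vinogradov_mean_le_exp:
  fixes m l P :: nat
  assumes m: "m \<ge> 10" and l: "l \<ge> 1" "2 * P * l < 2 ^ l" and P: "P \<ge> 1"
  shows "real (vinogradov_mean m (7 * m\<^sup>2) P) \<le>
    exp (22 * real m ^ 4 + (31 / 5) * real m ^ 3 * ln l + (14 * (real m)\<^sup>2 - real m * (real m + 1) / 2 * (1 - 1 / 240)) * ln P)"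
proof -
  have ln2: "ln (2 :: real) \<le> 1" using ln_2_less_1 by simp
  have ln4: "ln (4 :: real) \<le> 2" "ln (16 :: real) \<le> 4"
    using ln2 ln_realpow[of 2 2] ln_realpow[of 2 4] by simp_all
  have lm: "ln (real m) \<le> real m" using m ln_le_minus_one[of "real m"] by simp
  have ll: "0 \<le> ln (real l)" using l by simp
  define D where "D = (real m ^ (2 * m) * (16 * (real l)\<^sup>2)) powr (m * (m + 1) / 2)"
  define A where "A = 4 * 16 ^ (m\<^sup>2 + 6 * m * m) * real m ^ m * (4 * real l) ^ m\<^sup>2"
  have pos: "D > 0" "A > 0" using m l by (auto simp: D_def A_def)
  have pw: "real m * real m = (real m)\<^sup>2" "(real m)\<^sup>2 * real m = real m ^ 3" "(real m)\<^sup>2 * (real m)\<^sup>2 = real m ^ 4"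
    by (simp_all add: power2_eq_square power3_eq_cube power4_eq_xxxx)
  have m2: "100 \<le> (real m)\<^sup>2" "10 * real m ^ 3 \<le> real m ^ 4" "100 * (real m)\<^sup>2 \<le> real m ^ 4" "10 * (real m)\<^sup>2 \<le> real m ^ 3"
  proof -
    have m10: "10 \<le> real m" using m by simp
    have "10 * 10 \<le> real m * real m" using m10 by (intro mult_mono) auto
    then show h: "100 \<le> (real m)\<^sup>2" by (simp add: power2_eq_square)
    show "100 * (real m)\<^sup>2 \<le> real m ^ 4" using mult_right_mono[OF h, of "(real m)\<^sup>2"] pw by simp
    have "10 * real m ^ 3 \<le> real m * real m ^ 3" using m10 by (intro mult_right_mono) auto
    then show "10 * real m ^ 3 \<le> real m ^ 4" by (simp add: numeral_eq_Suc)
    have "10 * (real m)\<^sup>2 \<le> real m * (real m)\<^sup>2" using m10 by (intro mult_right_mono) auto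
    then show "10 * (real m)\<^sup>2 \<le> real m ^ 3" by (simp add: numeral_eq_Suc)
  qed
  have lnD: "ln D \<le> (real m)\<^sup>2 * (2 * (real m)\<^sup>2 + 4 + 2 * ln l)"
  proof -
    have "ln D = real m * (real m + 1) / 2 * (2 * m * ln m + (ln 16 + 2 * ln l))"
      using m l by (simp add: D_def ln_powr ln_mult ln_realpow) (simp add: algebra_simps)
    also have "\<dots> \<le> (real m)\<^sup>2 * (2 * (real m)\<^sup>2 + 4 + 2 * ln l)"
    proof (rule mult_mono)
      show "real m * (real m + 1) / 2 \<le> (real m)\<^sup>2" using m by (simp add: power2_eq_square)
      have "real m * ln m \<le> real m * real m" using lm by (intro mult_left_mono) auto
      then show "2 * m * ln m + (ln 16 + 2 * ln l) \<le> 2 * (real m)\<^sup>2 + 4 + 2 * ln l"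
        using ln4 by (simp add: power2_eq_square)
    qed (use m l in auto)
    finally show ?thesis .
  qed
  have lnA: "ln A \<le> 32 * (real m)\<^sup>2 + (real m)\<^sup>2 * ln l"
  proof -
    have "ln A = ln 4 + (m\<^sup>2 + 6 * m * m) * ln 16 + m * ln m + m\<^sup>2 * (ln 4 + ln l)"
      using m l by (simp add: A_def ln_mult ln_realpow ring_distribs)
    also have "\<dots> = ln 4 + 7 * (real m)\<^sup>2 * ln 16 + m * ln m + (real m)\<^sup>2 * (ln 4 + ln l)"
      by (simp add: power2_eq_square)
    also have "\<dots> \<le> 2 + 7 * (real m)\<^sup>2 * 4 + m * m + (real m)\<^sup>2 * (2 + ln l)"
      using ln4 mult_left_mono[OF lm, of "real m"] by (intro add_mono mult_left_mono) auto
    also have "\<dots> \<le> 32 * (real m)\<^sup>2 + (real m)\<^sup>2 * ln l" using m2(1) by (simp add: algebra_simps power2_eq_square)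
    finally show ?thesis .
  qed
  have "ln (D * A ^ (6 * m)) = ln D + 6 * m * ln A" using pos by (simp add: ln_mult ln_realpow)
  also have "\<dots> \<le> (real m)\<^sup>2 * (2 * (real m)\<^sup>2 + 4 + 2 * ln l) + 6 * m * (32 * (real m)\<^sup>2 + (real m)\<^sup>2 * ln l)"
    using lnD lnA by (intro add_mono mult_left_mono) auto
  also have "\<dots> = 2 * real m ^ 4 + 4 * (real m)\<^sup>2 + 192 * real m ^ 3 + (2 * (real m)\<^sup>2 + 6 * real m ^ 3) * ln l"
    by (simp add: algebra_simps power2_eq_square power3_eq_cube power4_eq_xxxx)
  \<comment> \<open>The fraction 31/5 is 6 from \<open>A ^ (6 * m)\<close> plus 1/5 for the
    contribution \<open>2 * m\<^sup>2\<close> of \<open>D\<close>, as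
    \<open>m \<ge> 10\<close>.\<close>
  also have "\<dots> \<le> 2 * real m ^ 4 + 4 * (real m)\<^sup>2 + 192 * real m ^ 3 + ((31 / 5) * real m ^ 3) * ln l"
    using m2 ll by (intro add_mono mult_right_mono) auto
  also have "\<dots> \<le> 22 * real m ^ 4 + (31 / 5) * real m ^ 3 * ln l" using m2 by simp
  finally have K: "D * A ^ (6 * m) \<le> exp (22 * real m ^ 4 + (31 / 5) * real m ^ 3 * ln l)"
    using pos by (metis exp_le_cancel_iff exp_ln mult_pos_pos zero_less_power)
  have k: "m\<^sup>2 + 6 * m * m = 7 * m\<^sup>2" by (simp add: power2_eq_square)
  have "real (vinogradov_mean m (m\<^sup>2 + 6 * m * m) P) \<le> D * A ^ (6 * m) * real P powr (2 * real (m\<^sup>2 + 6 * m * m) - deficiency m (6 * m))"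
    unfolding D_def A_def by (rule vinogradov_mean_le) (use m l P in auto)
  also have "\<dots> \<le> exp (22 * real m ^ 4 + (31 / 5) * real m ^ 3 * ln l) *
      real P powr (14 * (real m)\<^sup>2 - real m * (real m + 1) / 2 * (1 - 1 / 240))"
  proof (intro mult_mono K powr_mono)
    show "2 * real (m\<^sup>2 + 6 * m * m) - deficiency m (6 * m) \<le> 14 * (real m)\<^sup>2 - real m * (real m + 1) / 2 * (1 - 1 / 240)"
      using deficiency_6_ge[of m] m by (simp add: k algebra_simps power2_eq_square)
  qed (use P in auto)
  also have "\<dots> = exp (22 * real m ^ 4 + (31 / 5) * real m ^ 3 * ln l + (14 * (real m)\<^sup>2 - real m * (real m + 1) / 2 * (1 - 1 / 240)) * ln P)"
    using P by (simp add: powr_def exp_add mult.commute)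
  finally show ?thesis unfolding k .
qed

text \<open>The threshold makes the fourth root \<open>s\<close> of \<open>H\<close> at least 200,
  and \<open>ln (2 * s ^ 4)\<close> is below \<open>6 * s\<close>, hence below
  \<open>(3 / 100) * s ^ 2\<close>. This lets \<open>m ^ 3 * ln l\<close> be absorbed through
  \<open>R = O (sqrt H)\<close>.\<close>

lemma ln_ceiling_le:
  fixes H :: real
  assumes "H \<ge> 2 * 10 ^ 9"
  shows "ln (real (nat \<lceil>H\<rceil>)) \<le> (3 / 100) * sqrt H"
proof -
  define s where "s = sqrt (sqrt H)"
  have s2: "s * s = sqrt H" using assms by (simp add: s_def)
  have "s ^ 4 = (s * s) * (s * s)" by (simp add: power4_eq_xxxx)
  then have s4: "s ^ 4 = H" unfolding s2 using assms by simp
  have s: "s \<ge> 200"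
  proof (rule ccontr)
    assume "\<not> s \<ge> 200"
    moreover have "s \<ge> 0" using assms by (simp add: s_def)
    ultimately have "s ^ 4 \<le> 200 ^ 4" by (intro power_mono) auto
    then show False using assms s4 by simp
  qed
  have "real (nat \<lceil>H\<rceil>) \<le> 2 * s ^ 4" using assms ceiling_correct[of H] s4 by simp
  then have "ln (real (nat \<lceil>H\<rceil>)) \<le> ln (2 * s ^ 4)"
    using assms s by (subst ln_le_cancel_iff) (auto simp: zero_less_nat_eq)
  also have "\<dots> = ln 2 + 4 * ln s" using s by (simp add: ln_mult ln_realpow)
  also have "\<dots> \<le> 1 + 4 * (s - 1)"
    using s ln_le_minus_one[of s] ln_2_less_1 by (intro add_mono mult_left_mono) auto
  also have "\<dots> \<le> (3 / 100) * (200 * s)" using s by simp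
  also have "\<dots> \<le> (3 / 100) * (s * s)" using s by (intro mult_left_mono mult_right_mono) auto
  finally show ?thesis by (simp add: s2)
qed

text \<open>Makes \<open>l\<close>, the ceiling of \<open>H\<close>, admissible in the prime search:
  \<open>P\<close> uses 3/10 of the exponent, the factor \<open>2 * l\<close> at most 1/5, and their
  sum 1/2 is at most \<open>ln 2\<close>.\<close>

lemma exp_less_two_power:
  fixes H :: real and P :: nat
  assumes "H \<ge> 100" "real P \<le> exp ((3 / 10) * H)"
  shows "2 * P * nat \<lceil>H\<rceil> < 2 ^ nat \<lceil>H\<rceil>"
proof -
  define l where "l = nat \<lceil>H\<rceil>"
  define x where "x = real l / 5"
  have l: "H \<le> real l" unfolding l_def by (rule real_nat_ceiling_ge)
  have "real P \<le> exp (3 / 10 * real l)"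
    using assms l by (intro order.trans[OF assms(2)]) simp
  then have "real P * (2 * real l) \<le> exp (3 / 10 * real l) * (2 * real l)"
    by (intro mult_right_mono) auto
  also have "\<dots> < exp (3 / 10 * real l) * exp x"
  proof -
    have "2 * real l < exp x"
    proof -
      have "100 * real l \<le> real l * real l" using l assms(1) by (intro mult_right_mono) auto
      moreover have "1 + x + x\<^sup>2 / 2 = 1 + real l / 5 + real l * real l / 50"
        by (simp add: x_def power2_eq_square)
      ultimately have "2 * real l < 1 + x + x\<^sup>2 / 2" using l assms(1) by linarith
      also have "\<dots> \<le> exp x" by (rule exp_lower_Taylor_quadratic) (simp add: x_def)
      finally show ?thesis .
    qed
    then show ?thesis by simp
  qed
  also have "\<dots> = exp (real l * (1 / 2))" by (simp add: x_def flip: exp_add)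
  also have "\<dots> \<le> exp (real l * ln 2)"
  proof -
    have "ln (1 / 2 :: real) \<le> 1 / 2 - 1" by (rule ln_le_minus_one) simp
    then have "1 / 2 \<le> ln (2 :: real)" by (simp add: ln_div)
    then have "real l * (1 / 2) \<le> real l * ln 2" by (intro mult_left_mono) auto
    then show ?thesis by (subst exp_le_cancel_iff)
  qed
  also have "\<dots> = 2 ^ l" by (simp add: exp_of_nat_mult)
  finally have "real (2 * P * l) < real (2 ^ l)" by (simp add: mult_ac)
  then show ?thesis unfolding l_def by (simp only: of_nat_less_iff)
qed

text \<open>An interval of length \<open>R\<close> contains more than \<open>R - 1\<close> integers,
  and \<open>R - 1\<close> is at least \<open>R / 2\<close> when \<open>R \<ge> 2\<close>.\<close>

lemma card_middle_range_ge:
  fixes R :: real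
  assumes R: "R \<ge> 2" and m: "real m \<ge> 5 * R"
  shows "R / 2 \<le> real (card {j \<in> {2..m}. (3 / 2) * R \<le> real j \<and> real j \<le> (5 / 2) * R})"
proof -
  let ?G = "{j \<in> {2..m}. (3 / 2) * R \<le> real j \<and> real j \<le> (5 / 2) * R}"
  let ?a = "nat \<lceil>(3 / 2) * R\<rceil>" and ?b = "nat \<lfloor>(5 / 2) * R\<rfloor>"
  have a: "(3 / 2) * R \<le> real ?a" "real ?a < (3 / 2) * R + 1" using R by linarith+
  have b: "real ?b \<le> (5 / 2) * R" "(5 / 2) * R < real ?b + 1" using R by linarith+
  have "{?a..?b} \<subseteq> ?G"
  proof
    fix j assume "j \<in> {?a..?b}"
    then have "real ?a \<le> real j" "real j \<le> real ?b" by auto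
    then have "(3 / 2) * R \<le> real j" "real j \<le> (5 / 2) * R" using a b by linarith+
    moreover from this have "2 \<le> real j" "real j \<le> real m" using R m by linarith+
    ultimately show "j \<in> ?G" by simp
  qed
  then have "card {?a..?b} \<le> card ?G" by (intro card_mono) auto
  then have "real ?b + 1 \<le> real (card ?G) + real ?a" by simp
  then show ?thesis using a b R by linarith
qed

text \<open>The middle range \<open>1.5 R \<le> j \<le> 2.5 R\<close> consists of the coefficients whose denominator is larger than
  a power of N but smaller than \<open>P ^ (2 * j)\<close>; each of them saves a factor \<open>N ^ (0.14 * R)\<close>, where \<open>N = exp H\<close>.\<close>

lemma kloosterman_bilinear_bound:
  fixes R H :: real and q D :: int and C :: "nat \<Rightarrow> int" and P m :: nat
  assumes R: "R \<ge> 2" and H: "H \<ge> 900 ^ 3 * R\<^sup>2" and q: "q > 0" "ln (real_of_int q) = R * H"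
    and m: "5 * R \<le> real m" "real m \<le> 5 * R + 1"
    and D: "D > 0" "q dvd D ^ m" "ln (real_of_int D) \<le> R * H / m + H / 15"
    and C: "\<And>j. 2 \<le> j \<Longrightarrow> gcd q (C j) = gcd q (D ^ j)"
    and P: "exp ((29 / 100) * H) \<le> real P" "real P \<le> exp ((3 / 10) * H)"
  shows "norm (\<Sum>x\<in>{0..<int P}. \<Sum>y\<in>{0..<int P}. additive_char q (\<Sum>j\<in>{1..m}. C j * x ^ j * y ^ j))
    \<le> exp (- (11 / 10 ^ 8) * (H / R\<^sup>2)) * (real P)\<^sup>2"
proof -
  define w where "w = norm (\<Sum>x\<in>{0..<int P}. \<Sum>y\<in>{0..<int P}. additive_char q (\<Sum>j\<in>{1..m}. C j * x ^ j * y ^ j))"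
  define p where "p = ln (real P)"
  define l where "l = nat \<lceil>H\<rceil>"
  define G where "G = {j \<in> {2..m}. (3 / 2) * R \<le> real j \<and> real j \<le> (5 / 2) * R}"
  define \<sigma> where "\<sigma> = exp (- ((7 / 50) * (R * H)))"
  define k where "k = 7 * m\<^sup>2"
  have R4: "R\<^sup>2 \<ge> 4" using power_mono[OF R, of 2] by simp
  have Hbig: "H \<ge> 2 * 10 ^ 9" using H R4 by simp
  have P0: "real P > 0" using less_le_trans[OF exp_gt_zero P(1)] .
  have pP: "real P = exp p" using P0 by (simp add: p_def)
  have p: "(29 / 100) * H \<le> p" "p \<le> (3 / 10) * H" using P unfolding pP by simp_all
  have m55: "real m \<le> (11 / 2) * R" and m10: "m \<ge> 10" using m R by linarith+
  \<comment> \<open>From \<open>m\<close> between \<open>5 * R\<close> and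
    \<open>(11 / 2) * R\<close> the quotient \<open>R * H / m\<close>, the main part of
    \<open>ln D\<close>, lies between \<open>2 / 11 * H\<close> and \<open>H / 5\<close>.\<close>
  have RmH: "R * H / m \<le> H / 5"
  proof -
    have "5 * R * H \<le> m * H" using m(1) Hbig by (intro mult_right_mono) auto
    then show ?thesis using m10 by (simp add: field_simps)
  qed
  have RmH2: "2 / 11 * H \<le> R * H / m"
  proof -
    have "m * H \<le> (11 / 2) * R * H" using m55 Hbig by (intro mult_right_mono) auto
    then show ?thesis using m10 by (simp add: field_simps)
  qed
  let ?d = "\<lambda>j. q div gcd q (C j)"
  have low: "1 / ?d j \<le> \<sigma>" and high: "?d j / real P ^ (2 * j) \<le> \<sigma>" if "j \<in> G" for j
  proof -
    have j: "2 \<le> j" "j \<le> m" "(3 / 2) * R \<le> real j" "real j \<le> (5 / 2) * R" using that by (auto simp: G_def)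
    have m0: "m > 0" using m10 by simp
    note d = ln_gcd_power_bounds[OF q(1) D(1,2) j(2) m0, folded C[OF j(1)]]
    have dr: "real_of_int (?d j) > 0" using d(1) by (simp only: of_int_0_less_iff)
    have dexp: "real_of_int (?d j) = exp (ln (real_of_int (?d j)))" using dr by simp
    have sum_le: "2 / 11 * H + (29 / 50) * H \<le> R * H / m + 2 * p" using RmH2 p by linarith
    have "0 \<le> R * H" using R Hbig by simp
    have "real j * ln (real_of_int D) \<le> ((5 / 2) * R) * (4 / 15 * H)"
    proof (rule mult_mono)
      show "ln (real_of_int D) \<le> 4 / 15 * H" using D(3) RmH by simp
      show "0 \<le> ln (real_of_int D)" using D(1) by simp
    qed (use j R in auto)
    also have "\<dots> = 2 / 3 * (R * H)" by simp
    finally have "(7 / 50) * (R * H) \<le> ln (real_of_int (?d j))"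
      using d(2) \<open>0 \<le> R * H\<close> unfolding q(2) by linarith
    then have "1 / exp (ln (real_of_int (?d j))) \<le> \<sigma>"
      unfolding \<sigma>_def by (simp add: exp_minus inverse_eq_divide frac_le)
    then show "1 / ?d j \<le> \<sigma>" using dexp by metis
    \<comment> \<open>The left side is \<open>1257 / 1100 * (R * H)\<close>. Its excess over
      \<open>R * H\<close> is slightly above \<open>7 / 50 * (R * H)\<close> and dictates the size
      of \<open>\<sigma>\<close>; the lower bound for the denominator leaves a full
      \<open>1 / 3 * (R * H)\<close>.\<close>
    have "((3 / 2) * R) * (2 / 11 * H + (29 / 50) * H) \<le> real j * (R * H / m + 2 * p)"
      using j sum_le R Hbig by (intro mult_mono) auto
    moreover have "real j * (R * H / m + 2 * p) = j / m * (R * H) + real (2 * j) * p"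
      by (simp add: algebra_simps)
    moreover have "((3 / 2) * R) * (2 / 11 * H + (29 / 50) * H) = 1257 / 1100 * (R * H)"
      by (simp add: algebra_simps)
    ultimately have "ln (real_of_int (?d j)) - real (2 * j) * p \<le> - ((7 / 50) * (R * H))"
      using d(3) \<open>0 \<le> R * H\<close> unfolding q(2) by linarith
    then have "exp (ln (real_of_int (?d j)) - real (2 * j) * p) \<le> \<sigma>" unfolding \<sigma>_def by simp
    then show "?d j / real P ^ (2 * j) \<le> \<sigma>"
      using dr unfolding pP exp_diff exp_of_nat_mult by simp
  qed
  have g: "R / 2 \<le> real (card G)" unfolding G_def by (rule card_middle_range_ge[OF R m(1)])
  have k0: "k > 0" using m10 by (simp add: k_def)
  have kr: "real k = 7 * (real m)\<^sup>2" by (simp add: k_def)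
  have w: "w ^ (4 * k\<^sup>2) \<le> real P ^ (8 * k\<^sup>2 - 4 * k) * (real (vinogradov_mean m k P))\<^sup>2 *
       ((9 * (real k)\<^sup>2) ^ m * real P ^ (m * (m + 1)) * \<sigma> ^ card G)"
    unfolding w_def using k0 P0 q(1) low high
    by (intro bilinear_sum_saving) (auto simp: G_def \<sigma>_def)
  define e where "e = real m * (real m + 1) / 2 * (1 - 1 / 240)"
  define \<kappa> where "\<kappa> = 22 * real m ^ 4 + (31 / 5) * real m ^ 3 * ln l"
  have J: "real (vinogradov_mean m k P) \<le> exp (\<kappa> + (14 * (real m)\<^sup>2 - e) * p)"
    unfolding k_def \<kappa>_def e_def p_def
  proof (rule vinogradov_mean_le_exp[OF m10])
    show "1 \<le> l" unfolding l_def using Hbig by (simp add: Suc_le_eq)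
    show "2 * P * l < 2 ^ l" unfolding l_def using P(2) Hbig by (intro exp_less_two_power) auto
    show "1 \<le> P" using P0 by simp
  qed
  have f1: "real P ^ (8 * k\<^sup>2 - 4 * k) = exp ((8 * (real k)\<^sup>2 - 4 * real k) * p)"
  proof -
    have "4 * k * 1 \<le> 4 * k * (2 * k)" using k0 by (intro mult_le_mono2) simp
    then have "real (8 * k\<^sup>2 - 4 * k) = 8 * (real k)\<^sup>2 - 4 * real k"
      by (simp add: of_nat_diff power2_eq_square)
    then show ?thesis unfolding pP by (metis exp_of_nat_mult)
  qed
  have f2: "(real (vinogradov_mean m k P))\<^sup>2 \<le> exp (2 * \<kappa> + 2 * (14 * (real m)\<^sup>2 - e) * p)"
  proof -
    have "(real (vinogradov_mean m k P))\<^sup>2 \<le> (exp (\<kappa> + (14 * (real m)\<^sup>2 - e) * p))\<^sup>2"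
      using J by (intro power_mono) auto
    also have "\<dots> = exp (2 * \<kappa> + 2 * (14 * (real m)\<^sup>2 - e) * p)"
      by (simp add: exp_double[symmetric] algebra_simps)
    finally show ?thesis .
  qed
  have f3: "(9 * (real k)\<^sup>2) ^ m \<le> exp (13 * (real m)\<^sup>2)"
  proof -
    have m0: "real m > 0" using m10 by simp
    have "ln (441 :: real) \<le> ln (2 ^ 9)" by (subst ln_le_cancel_iff) auto
    also have "\<dots> = 9 * ln 2" by (simp only: ln_realpow)
    also have "\<dots> \<le> 9" using ln_2_less_1 by simp
    finally have "ln (441 * real m ^ 4) \<le> 9 + 4 * real m"
      using m0 ln_le_minus_one[OF m0] by (simp add: ln_mult ln_realpow)
    then have "ln (441 * real m ^ 4) \<le> 13 * real m" using m10 by simp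
    then have "441 * real m ^ 4 \<le> exp (13 * real m)" using m0 by (metis exp_le_cancel_iff exp_ln mult_pos_pos zero_less_numeral zero_less_power)
    moreover have "9 * (real k)\<^sup>2 = 441 * real m ^ 4" by (simp add: kr power2_eq_square power4_eq_xxxx)
    ultimately have "(9 * (real k)\<^sup>2) ^ m \<le> exp (13 * real m) ^ m" by (intro power_mono) auto
    also have "\<dots> = exp (13 * (real m)\<^sup>2)" by (simp add: power2_eq_square mult_ac flip: exp_of_nat_mult)
    finally show ?thesis .
  qed
  have f4: "real P ^ (m * (m + 1)) = exp (real m * (real m + 1) * p)"
    unfolding pP exp_of_nat_mult[symmetric] by (simp add: algebra_simps)
  have f5: "\<sigma> ^ card G \<le> exp (- ((7 / 100) * (R\<^sup>2 * H)))"
  proof -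
    have "0 \<le> (7 / 50) * (R * H)" using R Hbig by simp
    then have "(7 / 50) * (R * H) * (R / 2) \<le> (7 / 50) * (R * H) * real (card G)" by (intro mult_left_mono g)
    then show ?thesis unfolding \<sigma>_def exp_of_nat_mult[symmetric] by (simp add: power2_eq_square mult_ac)
  qed
  have m4: "real m ^ 4 \<le> 916 * R ^ 4" "real m ^ 3 \<le> 167 * R ^ 3" "real m * (real m + 1) \<le> 33 * R\<^sup>2"
  proof -
    have "real m ^ 4 \<le> ((11 / 2) * R) ^ 4" "real m ^ 3 \<le> ((11 / 2) * R) ^ 3" using m55 by (auto intro!: power_mono)
    moreover have "0 \<le> R ^ 4" "0 \<le> R ^ 3" using R by auto
    moreover have "((11 / 2) * R) ^ 4 = 14641 / 16 * R ^ 4" "((11 / 2) * R) ^ 3 = 1331 / 8 * R ^ 3"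
      by (simp_all add: power_mult_distrib power_divide)
    ultimately show "real m ^ 4 \<le> 916 * R ^ 4" "real m ^ 3 \<le> 167 * R ^ 3" by linarith+
    have "real m * (real m + 1) \<le> ((11 / 2) * R) * (6 * R)" using m55 m R by (intro mult_mono) auto
    then show "real m * (real m + 1) \<le> 33 * R\<^sup>2" by (simp add: power2_eq_square)
  qed
  have R24: "729000000 * R ^ 4 \<le> R\<^sup>2 * H"
    using mult_left_mono[OF H, of "R\<^sup>2"] by (simp add: power4_eq_xxxx power2_eq_square mult_ac)
  have sq: "27000 * R \<le> sqrt H"
    using H R by (intro real_le_rsqrt) (simp add: power_mult_distrib)
  \<comment> \<open>The budget against the saving 7/100: 1/250 for \<open>c1\<close>, 1/250 for
    \<open>c2\<close> and 33/800 for \<open>c3\<close>, in total less than 1/20, so that 1/50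
    remains. The first two rest on \<open>H \<ge> 900 ^ 3 * R\<^sup>2\<close>.\<close>
  have rest: "2 * \<kappa> + 13 * (real m)\<^sup>2 + real m * (real m + 1) / 240 * p \<le> (1 / 20) * (R\<^sup>2 * H)"
  proof -
    have "13 * (real m)\<^sup>2 \<le> real m ^ 4"
    proof -
      have "13 \<le> (real m)\<^sup>2" using power_mono[of 10 "real m" 2] m10 by simp
      then have "13 * (real m)\<^sup>2 \<le> (real m)\<^sup>2 * (real m)\<^sup>2" by (intro mult_right_mono) auto
      then show ?thesis by (simp add: power4_eq_xxxx power2_eq_square mult_ac)
    qed
    moreover have "0 \<le> R ^ 4" using R by simp
    ultimately have c1: "44 * real m ^ 4 + 13 * (real m)\<^sup>2 \<le> (1 / 250) * (R\<^sup>2 * H)"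
      using m4(1) R24 by linarith
    have c2: "(62 / 5) * real m ^ 3 * ln l \<le> (1 / 250) * (R\<^sup>2 * H)"
    proof -
      have "(62 / 5) * real m ^ 3 * ln l \<le> (62 / 5) * (167 * R ^ 3) * ((3 / 100) * sqrt H)"
        using m4(2) ln_ceiling_le[OF Hbig] R Hbig unfolding l_def by (intro mult_mono) (auto simp: Suc_le_eq)
      also have "\<dots> = ((15531 / 250) / 27000) * (R\<^sup>2 * ((27000 * R) * sqrt H))" by (simp add: power2_eq_square power3_eq_cube)
      also have "\<dots> \<le> ((15531 / 250) / 27000) * (R\<^sup>2 * (sqrt H * sqrt H))"
        using sq Hbig by (intro mult_left_mono mult_right_mono) auto
      also have "sqrt H * sqrt H = H" using Hbig by simp
      also have "((15531 / 250) / 27000) * (R\<^sup>2 * H) \<le> (1 / 250) * (R\<^sup>2 * H)" using Hbig by (intro mult_right_mono) auto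
      finally show ?thesis .
    qed
    have c3: "real m * (real m + 1) / 240 * p \<le> (33 / 800) * (R\<^sup>2 * H)"
    proof -
      have "real m * (real m + 1) * p \<le> (33 * R\<^sup>2) * ((3 / 10) * H)"
        by (rule mult_mono) (use m4(3) p Hbig in auto)
      moreover have "real m * (real m + 1) / 240 * p = 1 / 240 * (real m * (real m + 1) * p)" by simp
      moreover have "(33 * R\<^sup>2) * ((3 / 10) * H) = 99 / 10 * (R\<^sup>2 * H)" by simp
      ultimately show ?thesis by linarith
    qed
    have "0 \<le> R\<^sup>2 * H" using Hbig by simp
    then show ?thesis using c1 c2 c3 unfolding \<kappa>_def by simp
  qed
  have "w ^ (4 * k\<^sup>2) \<le> exp ((8 * (real k)\<^sup>2 - 4 * real k) * p) * exp (2 * \<kappa> + 2 * (14 * (real m)\<^sup>2 - e) * p) *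
     (exp (13 * (real m)\<^sup>2) * exp (real m * (real m + 1) * p) * exp (- ((7 / 100) * (R\<^sup>2 * H))))"
    by (rule order.trans[OF w]) (unfold f1 f4, intro mult_mono order.refl f2 f3 f5, auto simp: \<sigma>_def)
  \<comment> \<open>The powers of \<open>P\<close> nearly cancel: \<open>4 * k\<close> equals
    \<open>2 * 14 * m\<^sup>2\<close>, and \<open>m * (m + 1) - 2 * e\<close> leaves only
    \<open>m * (m + 1) / 240\<close>.\<close>
  also have "\<dots> = exp (8 * (real k)\<^sup>2 * p + (2 * \<kappa> + 13 * (real m)\<^sup>2 + real m * (real m + 1) / 240 * p) - (7 / 100) * (R\<^sup>2 * H))"
    unfolding exp_add[symmetric] kr e_def by (rule arg_cong[where f = exp]) (simp add: field_simps)
  also have "\<dots> \<le> exp (8 * (real k)\<^sup>2 * p - (1 / 50) * (R\<^sup>2 * H))"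
    unfolding exp_le_cancel_iff using rest by linarith
  \<comment> \<open>Here the root is prepared: \<open>4 * k\<^sup>2 = 196 * m ^ 4\<close> is at most
    \<open>717409 / 4 * R ^ 4\<close>, and 11 / 10 ^ 8 times this constant is just below
    1/50.\<close>
  also have "\<dots> \<le> exp (real (4 * k\<^sup>2) * (2 * p - 11 / 10 ^ 8 * (H / R\<^sup>2)))"
  proof -
    have "real (4 * k\<^sup>2) = 196 * real m ^ 4" by (simp add: k_def power_mult_distrib flip: power_mult)
    also have "\<dots> \<le> 196 * ((11 / 2) * R) ^ 4" using m55 by (intro mult_left_mono power_mono) auto
    also have "\<dots> = (717409 / 4) * R ^ 4" by (simp add: power_mult_distrib power_divide)
    finally have "real (4 * k\<^sup>2) * (11 / 10 ^ 8 * (H / R\<^sup>2)) \<le> (717409 / 4) * R ^ 4 * (11 / 10 ^ 8 * (H / R\<^sup>2))"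
      using Hbig by (intro mult_right_mono) auto
    also have "\<dots> = (7891499 / 400000000) * (R\<^sup>2 * H)" using R by (simp add: power4_eq_xxxx power2_eq_square)
    also have "\<dots> \<le> (1 / 50) * (R\<^sup>2 * H)" using Hbig by (intro mult_right_mono) auto
    finally show ?thesis by (simp add: right_diff_distrib)
  qed
  also have "\<dots> = exp (2 * p - 11 / 10 ^ 8 * (H / R\<^sup>2)) ^ (4 * k\<^sup>2)" by (simp only: exp_of_nat_mult)
  finally have "w \<le> exp (2 * p - 11 / 10 ^ 8 * (H / R\<^sup>2))"
    using k0 by (subst (asm) power_mono_iff) (auto simp: w_def)
  also have "\<dots> = exp (- (11 / 10 ^ 8) * (H / R\<^sup>2)) * (real P)\<^sup>2"
  proof -
    have "(real P)\<^sup>2 = exp (2 * p)" unfolding pP by (simp add: exp_double)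
    then show ?thesis by (simp flip: exp_add)
  qed
  finally show ?thesis unfolding w_def .
qed

lemma floor_exp_bounds:
  fixes H :: real
  assumes "H \<ge> 100"
  shows "exp (29 / 100 * H) \<le> real (nat \<lfloor>exp (3 / 10 * H)\<rfloor>)" "real (nat \<lfloor>exp (3 / 10 * H)\<rfloor>) \<le> exp (3 / 10 * H)"
proof -
  let ?P = "nat \<lfloor>exp (3 / 10 * H)\<rfloor>"
  have P: "real ?P \<le> exp (3 / 10 * H)" "exp (3 / 10 * H) < real ?P + 1"
    using exp_gt_zero[of "3 / 10 * H"] by linarith+
  have "2 \<le> exp (H / 100)" using exp_ge_add_one_self[of "H / 100"] assms by linarith
  then have "exp (29 / 100 * H) * 2 \<le> exp (29 / 100 * H) * exp (H / 100)" by (intro mult_left_mono) auto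
  also have "\<dots> = exp (3 / 10 * H)" by (simp flip: exp_add)
  finally have "2 * exp (29 / 100 * H) \<le> exp (3 / 10 * H)" by simp
  moreover have "1 \<le> exp (29 / 100 * H)" using assms by simp
  ultimately show "exp (29 / 100 * H) \<le> real ?P" using P(2) by linarith
  show "real ?P \<le> exp (3 / 10 * H)" by (rule P(1))
qed

text \<open>Both exponents exceed \<open>H / R\<^sup>2 / 160 ^ 4\<close> so widely that each
  exponential is at most one eighth of the right-hand side. This absorbs the factor 2 and makes the
  inequality strict.\<close>

lemma final_exponent_bound:
  fixes H R :: real
  assumes R: "R \<ge> 2" and H: "H \<ge> 900 ^ 3 * R\<^sup>2"
  shows "exp (- (11 / 10 ^ 8) * (H / R\<^sup>2)) + 2 * exp (- (2 / 15) * H) < exp (- (1 / 160 ^ 4) * (H / R\<^sup>2))"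
proof -
  let ?x = "H / R\<^sup>2"
  let ?E = "exp (- (1 / 160 ^ 4) * ?x)"
  have R4: "R\<^sup>2 \<ge> 4" using power_mono[OF R, of 2] by simp
  have x: "900 ^ 3 \<le> ?x" using H R by (simp add: le_divide_eq)
  have H0: "H \<ge> 2 * 10 ^ 9" using H R4 by simp
  have xH: "?x \<le> H / 4" using R4 H0 by (intro divide_left_mono) auto
  have "8 * exp (- (11 / 10 ^ 8) * ?x) \<le> ?E"
  proof -
    have "7 \<le> 10 / 10 ^ 8 * ?x" using x by simp
    then have "8 \<le> exp (10 / 10 ^ 8 * ?x)" using exp_ge_add_one_self[of "10 / 10 ^ 8 * ?x"] by linarith
    then have "8 * exp (- (11 / 10 ^ 8) * ?x) \<le> exp (10 / 10 ^ 8 * ?x) * exp (- (11 / 10 ^ 8) * ?x)"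
      by (intro mult_right_mono) auto
    also have "\<dots> = exp (- (1 / 10 ^ 8) * ?x)" by (simp flip: exp_add)
    also have "\<dots> \<le> ?E" using x by simp
    finally show ?thesis .
  qed
  moreover have "8 * exp (- (2 / 15) * H) \<le> ?E"
  proof -
    have "7 \<le> H / 15" using H0 by simp
    then have "8 \<le> exp (H / 15)" using exp_ge_add_one_self[of "H / 15"] by linarith
    then have "8 * exp (- (2 / 15) * H) \<le> exp (H / 15) * exp (- (2 / 15) * H)"
      by (intro mult_right_mono) auto
    also have "\<dots> = exp (- (1 / 15) * H)" by (simp flip: exp_add)
    also have "\<dots> \<le> ?E" using xH H0 by simp
    finally show ?thesis .
  qed
  ultimately show ?thesis using exp_gt_zero[of "- (1 / 160 ^ 4) * ?x"] by linarith
qed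

theorem theorem1:
  shows "\<exists>q\<^sub>0 :: int. \<forall>q \<ge> q\<^sub>0. \<forall>N :: int.
    max (of_int (squarefree_kernel q) ^ 15) (exp (900 * (ln (real_of_int q)) powr (2 / 3))) \<le> real_of_int N \<longrightarrow>
    real_of_int N \<le> sqrt (real_of_int q) \<longrightarrow>
    (\<forall>a b c :: int. coprime a q \<longrightarrow>
      cmod (incomplete_kloosterman_sum q N a b c)
        < real_of_int N * exp (- (1 / 160 ^ 4) * (ln (real_of_int N)) ^ 3 / (ln (real_of_int q)) ^ 2))"
proof (rule exI[of _ 2], intro allI impI)
  fix q N a b c :: int
  \<comment> \<open>The threshold can be this small because the two bounds on \<open>N\<close>
    already force \<open>ln N \<ge> 2 * 10 ^ 9\<close>.\<close>
  assume q2: "q \<ge> 2"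
    and N1: "max (of_int (squarefree_kernel q) ^ 15) (exp (900 * (ln (real_of_int q)) powr (2 / 3))) \<le> real_of_int N"
    and N2: "real_of_int N \<le> sqrt (real_of_int q)" and a: "coprime a q"
  define L where "L = ln (real_of_int q)"
  define H where "H = ln (real_of_int N)"
  define R where "R = L / H"
  define d where "d = squarefree_kernel q"
  have q0: "q > 0" using q2 by simp
  have L0: "L > 0" using q2 by (simp add: L_def)
  have "exp (900 * L powr (2 / 3)) \<le> real_of_int N" using N1 by (simp add: L_def)
  then have N0: "real_of_int N > 0" by (rule less_le_trans[OF exp_gt_zero])
  have NH: "real_of_int N = exp H" using N0 by (simp add: H_def)
  have HL: "900 * L powr (2 / 3) \<le> H" using N1 unfolding NH L_def by simp
  have "0 < L powr (2 / 3)" using L0 by simp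
  then have H0: "H > 0" using HL by linarith
  have "H \<le> ln (sqrt (real_of_int q))" unfolding H_def using N0 N2 q0 by (subst ln_le_cancel_iff) auto
  then have "2 * H \<le> L" using q0 by (simp add: L_def ln_sqrt)
  then have R: "R \<ge> 2" using H0 by (simp add: R_def field_simps)
  have LRH: "L = R * H" using H0 by (simp add: R_def)
  \<comment> \<open>Cubing the lower bound for \<open>ln N\<close> removes the exponent 2/3 and
    gives \<open>900 ^ 3 * L\<^sup>2 \<le> H ^ 3\<close>; with \<open>L = R * H\<close> the factor
    \<open>H\<^sup>2\<close> cancels.\<close>
  have HR: "H \<ge> 900 ^ 3 * R\<^sup>2"
  proof -
    have "(900 * L powr (2 / 3)) ^ 3 \<le> H ^ 3" using HL by (intro power_mono) auto
    moreover have "(L powr (2 / 3)) ^ 3 = L\<^sup>2"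
    proof -
      have "(L powr (2 / 3)) ^ 3 = L powr (2 / 3 + 2 / 3 + 2 / 3)"
        by (simp only: power3_eq_cube powr_add)
      also have "\<dots> = L powr 2" by simp
      finally show ?thesis using L0 by simp
    qed
    ultimately have "900 ^ 3 * L\<^sup>2 \<le> H ^ 3" by (simp only: power_mult_distrib)
    then have "900 ^ 3 * R\<^sup>2 * H\<^sup>2 \<le> H * H\<^sup>2"
      unfolding LRH by (simp add: power3_eq_cube power2_eq_square mult_ac)
    then show ?thesis using H0 by (simp only: mult_le_cancel_right_pos zero_less_power)
  qed
  have R4: "R\<^sup>2 \<ge> 4" using power_mono[OF R, of 2] by simp
  have Hbig: "H \<ge> 2 * 10 ^ 9" using HR R4 by simp
  have d: "d \<ge> 1" "ln (real_of_int d) \<le> H / 15"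
  proof -
    have "d > 0" unfolding d_def squarefree_kernel_def
      by (rule prod_pos) (auto simp: in_prime_factors_iff intro: prime_gt_0_int)
    then show "d \<ge> 1" by simp
    have "real_of_int d ^ 15 \<le> real_of_int N" using N1 unfolding d_def by simp
    then have "ln (real_of_int d ^ 15) \<le> H"
      unfolding H_def using \<open>d > 0\<close> N0 by (subst ln_le_cancel_iff) auto
    then show "ln (real_of_int d) \<le> H / 15" using \<open>d > 0\<close> by (simp add: ln_realpow)
  qed
  define m where "m = nat \<lceil>5 * R\<rceil>"
  have m: "5 * R \<le> real m" "real m \<le> 5 * R + 1" using R unfolding m_def by linarith+
  have m0: "m > 0" using m R by (cases m) auto
  obtain D where D: "D > 0" "q dvd D ^ m" "D ^ m dvd q * d ^ m"
    using exists_power_divisor[OF q0 m0] unfolding d_def by blast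
  have lnD: "ln (real_of_int D) \<le> R * H / m + H / 15"
  proof -
    have "D ^ m \<le> q * d ^ m" using D(3) q0 d(1) by (intro zdvd_imp_le) auto
    then have "real_of_int (D ^ m) \<le> real_of_int (q * d ^ m)" by (simp only: of_int_le_iff)
    then have "ln (real_of_int D ^ m) \<le> ln (real_of_int q * real_of_int d ^ m)"
      using D(1) q0 d(1) by (subst ln_le_cancel_iff) auto
    then have "m * ln (real_of_int D) \<le> R * H + m * ln (real_of_int d)"
      using D(1) q0 d(1) LRH by (simp add: ln_mult ln_realpow L_def)
    also have "\<dots> \<le> R * H + m * (H / 15)" using d(2) by (intro add_left_mono mult_left_mono) auto
    also have "\<dots> = m * (R * H / m + H / 15)" using m0 by (simp add: field_simps)
    finally show ?thesis using m0 by simp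
  qed
  define P where "P = nat \<lfloor>exp (3 / 10 * H)\<rfloor>"
  have "H \<ge> 100" using Hbig by simp
  note P = floor_exp_bounds[OF this, folded P_def]
  have P0: "P > 0" using less_le_trans[OF exp_gt_zero P(1)] by simp
  let ?B = "exp (- (11 / 10 ^ 8) * (H / R\<^sup>2))"
  have "cmod (incomplete_kloosterman_sum q N a b c) \<le> real_of_int N * ?B + 2 * real_of_int D * (real P)\<^sup>2"
  proof (rule incomplete_kloosterman_sum_le_bilinear[OF q0 D(2,1) _ P0])
    fix n assume n: "coprime n q"
    show "norm (\<Sum>x\<in>{0..<int P}. \<Sum>y\<in>{0..<int P}. additive_char q
        (\<Sum>j\<in>{1..m}. expansion_coeff a b D (modular_inverse q n) j * x ^ j * y ^ j)) \<le> ?B * (real P)\<^sup>2"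
      using LRH a n
      by (intro kloosterman_bilinear_bound[OF R HR q0 _ m D(1,2) lnD _ P])
         (auto simp: L_def intro: gcd_expansion_coeff)
  qed (use m0 N0 in auto)
  \<comment> \<open>The exponents 4/15 of \<open>D\<close> and 3/5 of \<open>P ^ 2\<close> add up to
    13/15, which leaves a saving of \<open>N ^ (2 / 15)\<close> in the error of the shifts.\<close>
  also have "2 * real_of_int D * (real P)\<^sup>2 \<le> real_of_int N * (2 * exp (- (2 / 15) * H))"
  proof -
    have "R * H / m \<le> H / 5"
    proof -
      have "5 * R * H \<le> m * H" using m(1) H0 by (intro mult_right_mono) auto
      then show ?thesis using m0 by (simp add: field_simps)
    qed
    then have "real_of_int D \<le> exp (4 / 15 * H)"
      using lnD D(1) by (subst ln_le_cancel_iff[symmetric]) auto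
    moreover have "(real P)\<^sup>2 \<le> (exp (3 / 10 * H))\<^sup>2" using P(2) by (intro power_mono) auto
    ultimately have "real_of_int D * (real P)\<^sup>2 \<le> exp (4 / 15 * H) * (exp (3 / 10 * H))\<^sup>2"
      by (intro mult_mono) auto
    also have "\<dots> = exp H * exp (- (2 / 15) * H)"
      by (simp flip: exp_add exp_double)
    finally show ?thesis unfolding NH by simp
  qed
  also have "real_of_int N * ?B + real_of_int N * (2 * exp (- (2 / 15) * H))
     = real_of_int N * (?B + 2 * exp (- (2 / 15) * H))" by (simp add: distrib_left)
  also have "\<dots> < real_of_int N * exp (- (1 / 160 ^ 4) * (H / R\<^sup>2))"
    using final_exponent_bound[OF R HR] N0 by (intro mult_strict_left_mono)
  also have "- (1 / 160 ^ 4) * (H / R\<^sup>2) = - (1 / 160 ^ 4) * H ^ 3 / L\<^sup>2"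
    using H0 R unfolding LRH by (simp add: power3_eq_cube power2_eq_square)
  finally show "cmod (incomplete_kloosterman_sum q N a b c)
        < real_of_int N * exp (- (1 / 160 ^ 4) * (ln (real_of_int N)) ^ 3 / (ln (real_of_int q)) ^ 2)"
    unfolding H_def L_def by simp
qed

end
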